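(* Let $T\subseteq X\times Y\times Z_A\times Z_B$ be a relation on finite sets, $\varepsilon\in(0,1)$ and $\alpha\in(0,1)$. Then $$QIC\!\left(T,\frac{\varepsilon}{\alpha}\right)\le\frac{QIC_D(T,\varepsilon)}{1-\alpha}.$$
   Context: Quantum communication model: Alice holds $x\in X$ in register $A_{in}$, Bob holds $y\in Y$ in $B_{in}$. A protocol $\Pi$ with $r$ rounds ($r$ any finite number) consists of a shared pure state on registers $T_A,T_B$ of arbitrary finite dimension and isometries applied alternately by Alice (odd rounds) and Bob (even rounds); after round $i$ Alice holds $A_i$, Bob holds $B_i$ (the non-acting party's register is unchanged) and $C_i$ is the message of round $i$; final isometries produce outputs $z_A\in Z_A$, $z_B\in Z_B$. For a distribution $\mu$ on $X\times Y$ the input state $\sum\mu(x,y)|x\rangle\langle x|\otimes|y\rangle\langle y|$ is purified by an untouched reference register $R$ and $QIC(\Pi,\mu)=\sum_{i\text{ odd}}\frac12 I(C_i;R|B_i)+\sum_{i\text{ even}}\frac12 I(C_i;R|A_i)$ (evaluated after round $i$). $\Pi$ errs on $(x,y)$ if $(x,y,z_A,z_B)\notin T$. $QIC(T,\mu,\varepsilon)=\inf QIC(\Pi,\mu)$ over protocols (any number of rounds) with error probability averaged over $\mu$ at most $\varepsilon$; $QIC_D(T,\varepsilon)=\max_\mu QIC(T,\mu,\varepsilon)$; $QIC(T,\varepsilon)=\inf_\Pi\max_\mu QIC(\Pi,\mu)$ over protocols (any number of rounds) with error probability at most $\varepsilon$ on every input. *)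

theory Defs
  imports
    "Jordan_Normal_Form.Schur_Decomposition"
    "Jordan_Normal_Form.Spectral_Radius"
    "HOL-Library.Countable_Set"
    "HOL-Library.Extended_Real"
    "HOL-Probability.Probability_Mass_Function"
begin

text \<open>Quantum registers are the spaces \<open>\<complex>\<^sup>d\<close> with an arbitrary natural number \<open>d\<close> as dimension;
  pure states are column vectors, i.e. matrices with a single column.  A composite register
  \<open>P \<otimes> Q\<close> of dimensions \<open>p, q\<close> has the basis index \<open>i * q + j\<close> for the pair \<open>(i, j)\<close>.\<close>

definition kron :: "complex mat \<Rightarrow> complex mat \<Rightarrow> complex mat" where
  "kron A B = Matrix.mat (dim_row A * dim_row B) (dim_col A * dim_col B)
     (\<lambda>(i, j). A $$ (i div dim_row B, j div dim_col B) * B $$ (i mod dim_row B, j mod dim_col B))"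

text \<open>For \<open>m = 1\<close> the following says that \<open>V\<close> is a unit vector of dimension \<open>n\<close>.\<close>

definition isometry :: "nat \<Rightarrow> nat \<Rightarrow> complex mat \<Rightarrow> bool" where
  "isometry m n V \<longleftrightarrow> V \<in> carrier_mat n m \<and> mat_adjoint V * V = 1\<^sub>m m"

text \<open>The partial trace of an operator on a register \<open>d1 \<otimes> d2 \<otimes> d3\<close> over its middle factor.
  The other partial traces are the cases \<open>d1 = 1\<close> and \<open>d3 = 1\<close>.\<close>

definition ptrace :: "nat \<Rightarrow> nat \<Rightarrow> nat \<Rightarrow> complex mat \<Rightarrow> complex mat" where
  "ptrace d1 d2 d3 \<rho> = Matrix.mat (d1 * d3) (d1 * d3)
     (\<lambda>(i, j). \<Sum>k<d2. \<rho> $$ ((i div d3 * d2 + k) * d3 + i mod d3,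
                            (j div d3 * d2 + k) * d3 + j mod d3))"

text \<open>The von Neumann entropy \<open>- tr (\<rho> log \<rho>)\<close> in bits: the sum of \<open>- \<lambda> log \<lambda>\<close> over the eigenvalues,
  each counted with its multiplicity.  The convention \<open>0 log 0 = 0\<close> holds automatically.\<close>

definition vn_entropy :: "complex mat \<Rightarrow> real" where
  "vn_entropy \<rho> =
     - (\<Sum>e\<in>spectrum \<rho>. real (Polynomial.order e (char_poly \<rho>)) * (Re e * log 2 (Re e)))"

text \<open>\<open>I(P;Q|K) = S(PK) + S(QK) - S(K) - S(PQK)\<close>, for an operator on \<open>P \<otimes> Q \<otimes> K\<close> (first version)
  and for an operator on \<open>P \<otimes> K \<otimes> Q\<close> (second version).\<close>

definition cmi_last :: "nat \<Rightarrow> nat \<Rightarrow> nat \<Rightarrow> complex mat \<Rightarrow> real" where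
  "cmi_last p q k \<rho> =
     vn_entropy (ptrace p q k \<rho>) + vn_entropy (ptrace 1 p (q * k) \<rho>)
     - vn_entropy (ptrace 1 (p * q) k \<rho>) - vn_entropy \<rho>"

definition cmi_mid :: "nat \<Rightarrow> nat \<Rightarrow> nat \<Rightarrow> complex mat \<Rightarrow> real" where
  "cmi_mid p k q \<rho> =
     vn_entropy (ptrace (p * k) q 1 \<rho>) + vn_entropy (ptrace 1 p (k * q) \<rho>)
     - vn_entropy (ptrace 1 p k (ptrace (p * k) q 1 \<rho>)) - vn_entropy \<rho>"

text \<open>The computational basis state \<open>|x\<rangle>\<close>; a finite type is enumerated by \<^const>\<open>to_nat_on\<close>,
  which is a bijection onto \<open>{..<CARD('a)}\<close>.\<close>

definition basis_ket :: "'a::finite \<Rightarrow> complex mat" where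
  "basis_ket x = Matrix.mat CARD('a) 1 (\<lambda>(k, _). if k = to_nat_on (UNIV :: 'a set) x then 1 else 0)"

text \<open>The type parameters are the input alphabets \<open>X\<close>, \<open>Y\<close> and the output alphabets \<open>Z\<^sub>A\<close>, \<open>Z\<^sub>B\<close>.  They
  only fix the dimensions of the input and output registers, in \<open>valid_protocol\<close> below.
  The joint register after round \<open>i\<close> is ordered as \<open>A\<^sub>i \<otimes> C\<^sub>i \<otimes> B\<^sub>i\<close>, so that each party acts on two
  adjacent factors.  Initially \<open>A\<^sub>0 = A\<^sub>i\<^sub>n \<otimes> T\<^sub>A\<close>, \<open>B\<^sub>0 = B\<^sub>i\<^sub>n \<otimes> T\<^sub>B\<close> and \<open>C\<^sub>0\<close> is trivial.  The final
  isometries end in \<open>Z\<^sub>A \<otimes> G\<^sub>A\<close> and \<open>Z\<^sub>B \<otimes> G\<^sub>B\<close>, where the \<open>G\<close> registers are discarded.\<close>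

datatype ('x, 'y, 'za, 'zb) protocol = Protocol
  (rounds: nat)
  (dim_TA: nat)
  (dim_TB: nat)
  (shared: "complex mat")
  (dim_A: "nat \<Rightarrow> nat")
  (dim_B: "nat \<Rightarrow> nat")
  (dim_C: "nat \<Rightarrow> nat")
  (round_iso: "nat \<Rightarrow> complex mat")
  (dim_GA: nat)
  (dim_GB: nat)
  (final_A: "complex mat")
  (final_B: "complex mat")

text \<open>The last message \<open>C\<^sub>r\<close> is with Bob if \<open>r\<close> is odd and with Alice if \<open>r\<close> is even.\<close>

definition valid_protocol :: "('x::finite, 'y::finite, 'za::finite, 'zb::finite) protocol \<Rightarrow> bool"
where
  "valid_protocol P \<longleftrightarrow>
     isometry 1 (dim_TA P * dim_TB P) (shared P) \<and>
     dim_A P 0 = CARD('x) * dim_TA P \<and>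
     dim_B P 0 = CARD('y) * dim_TB P \<and>
     dim_C P 0 = 1 \<and>
     (\<forall>i\<in>{1..rounds P}.
        if odd i
        then dim_B P i = dim_B P (i - 1) \<and>
             isometry (dim_A P (i - 1) * dim_C P (i - 1)) (dim_A P i * dim_C P i) (round_iso P i)
        else dim_A P i = dim_A P (i - 1) \<and>
             isometry (dim_C P (i - 1) * dim_B P (i - 1)) (dim_C P i * dim_B P i) (round_iso P i)) \<and>
     (let r = rounds P; outA = CARD('za) * dim_GA P; outB = CARD('zb) * dim_GB P in
        if odd r
        then isometry (dim_A P r) outA (final_A P) \<and>
             isometry (dim_C P r * dim_B P r) outB (final_B P)
        else isometry (dim_A P r * dim_C P r) outA (final_A P) \<and>
             isometry (dim_B P r) outB (final_B P))"

text \<open>The operator from \<open>A\<^sub>0 \<otimes> C\<^sub>0 \<otimes> B\<^sub>0\<close> to \<open>A\<^sub>i \<otimes> C\<^sub>i \<otimes> B\<^sub>i\<close> performed by the first \<open>i\<close> rounds.\<close>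

fun run :: "('x, 'y, 'za, 'zb) protocol \<Rightarrow> nat \<Rightarrow> complex mat" where
  "run P 0 = 1\<^sub>m (dim_A P 0 * dim_C P 0 * dim_B P 0)"
| "run P (Suc i) =
     (if odd (Suc i) then kron (round_iso P (Suc i)) (1\<^sub>m (dim_B P i))
      else kron (1\<^sub>m (dim_A P i)) (round_iso P (Suc i))) * run P i"

text \<open>The input \<open>|x\<rangle>|y\<rangle>\<close> together with the shared state, arranged as \<open>A\<^sub>i\<^sub>n \<otimes> T\<^sub>A \<otimes> B\<^sub>i\<^sub>n \<otimes> T\<^sub>B\<close>.\<close>

definition initial_state ::
    "('x::finite, 'y::finite, 'za, 'zb) protocol \<Rightarrow> 'x \<Rightarrow> 'y \<Rightarrow> complex mat" where
  "initial_state P x y =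
     kron (kron (basis_ket x) (1\<^sub>m (dim_TA P))) (kron (basis_ket y) (1\<^sub>m (dim_TB P))) * shared P"

text \<open>The probability that the computational basis measurement of the output registers yields
  \<open>(z\<^sub>A, z\<^sub>B)\<close> on input \<open>(x, y)\<close>.\<close>

definition output_prob ::
    "('x::finite, 'y::finite, 'za::finite, 'zb::finite) protocol \<Rightarrow> 'x \<Rightarrow> 'y \<Rightarrow> 'za \<Rightarrow> 'zb \<Rightarrow> real"
where
  "output_prob P x y za zb =
     (let out = kron (final_A P) (final_B P) * (run P (rounds P) * initial_state P x y);
          a = to_nat_on (UNIV :: 'za set) za; b = to_nat_on (UNIV :: 'zb set) zb in
      \<Sum>g<dim_GA P. \<Sum>h<dim_GB P.
        (cmod (out $$ ((a * dim_GA P + g) * (CARD('zb) * dim_GB P) + (b * dim_GB P + h), 0)))\<^sup>2)"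

definition error_prob ::
    "('x \<times> 'y \<times> 'za \<times> 'zb) set \<Rightarrow> ('x::finite, 'y::finite, 'za::finite, 'zb::finite) protocol
     \<Rightarrow> 'x \<Rightarrow> 'y \<Rightarrow> real" where
  "error_prob T P x y = (\<Sum>(za, zb) | (x, y, za, zb) \<notin> T. output_prob P x y za zb)"

text \<open>The input state is purified by \<open>R = X \<otimes> Y\<close> to \<open>\<Sum> \<surd>\<mu>(x,y) |x,y\<rangle>\<^sub>R |x\<rangle> |y\<rangle>\<close>.  As all purifications agree
  up to a local isometry on \<open>R\<close>, the choice does not affect the information quantities.\<close>

definition purified_input ::
    "('x::finite, 'y::finite, 'za, 'zb) protocol \<Rightarrow> ('x \<times> 'y) pmf \<Rightarrow> complex mat" where
  "purified_input P \<mu> =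
     Matrix.mat (CARD('x) * CARD('y) * (dim_A P 0 * dim_C P 0 * dim_B P 0)) 1
       (\<lambda>ij. \<Sum>x\<in>UNIV. \<Sum>y\<in>UNIV. complex_of_real (sqrt (pmf \<mu> (x, y))) *
          kron (kron (basis_ket x) (basis_ket y)) (initial_state P x y) $$ ij)"

text \<open>The pure state on \<open>R \<otimes> A\<^sub>i \<otimes> C\<^sub>i \<otimes> B\<^sub>i\<close> after round \<open>i\<close>, as a density operator.\<close>

definition round_state ::
    "('x::finite, 'y::finite, 'za, 'zb) protocol \<Rightarrow> ('x \<times> 'y) pmf \<Rightarrow> nat \<Rightarrow> complex mat" where
  "round_state P \<mu> i =
     (let v = kron (1\<^sub>m (CARD('x) * CARD('y))) (run P i) * purified_input P \<mu>
      in v * mat_adjoint v)"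

definition QIC_protocol ::
    "('x::finite, 'y::finite, 'za, 'zb) protocol \<Rightarrow> ('x \<times> 'y) pmf \<Rightarrow> real" where
  "QIC_protocol P \<mu> =
     (let r = CARD('x) * CARD('y); a = dim_A P; b = dim_B P; c = dim_C P; \<rho> = round_state P \<mu> in
      (\<Sum>i | i \<in> {1..rounds P} \<and> odd i.
         1/2 * cmi_last r (c i) (b i) (ptrace r (a i) (c i * b i) (\<rho> i))) +
      (\<Sum>i | i \<in> {1..rounds P} \<and> even i.
         1/2 * cmi_mid r (a i) (c i) (ptrace (r * a i * c i) (b i) 1 (\<rho> i))))"

text \<open>The infima and suprema are taken in \<^typ>\<open>ereal\<close>, since the infimum is over the empty set (and
  hence infinite) if no protocol meets the error bound.\<close>

definition QIC_dist ::
    "('x::finite \<times> 'y::finite \<times> 'za::finite \<times> 'zb::finite) set \<Rightarrow> ('x \<times> 'y) pmf \<Rightarrow> real \<Rightarrow> ereal"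
where
  "QIC_dist T \<mu> \<epsilon> =
     (INF P \<in> {P :: ('x, 'y, 'za, 'zb) protocol. valid_protocol P \<and>
                 measure_pmf.expectation \<mu> (\<lambda>(x, y). error_prob T P x y) \<le> \<epsilon>}.
        ereal (QIC_protocol P \<mu>))"

definition QIC_D ::
    "('x::finite \<times> 'y::finite \<times> 'za::finite \<times> 'zb::finite) set \<Rightarrow> real \<Rightarrow> ereal" where
  "QIC_D T \<epsilon> = (SUP \<mu>. QIC_dist T \<mu> \<epsilon>)"

definition QIC ::
    "('x::finite \<times> 'y::finite \<times> 'za::finite \<times> 'zb::finite) set \<Rightarrow> real \<Rightarrow> ereal" where
  "QIC T \<epsilon> =
     (INF P \<in> {P :: ('x, 'y, 'za, 'zb) protocol. valid_protocol P \<and>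
                 (\<forall>x y. error_prob T P x y \<le> \<epsilon>)}.
        SUP \<mu>. ereal (QIC_protocol P \<mu>))"

end

theory Submission
  imports Defs
begin

text \<open>Fix \<open>I > QIC\<^sub>D(T, \<epsilon>)\<close> and consider the zero-sum game with payoff
  \<open>(1 - \<alpha>) QIC(\<Pi>, \<mu>) / I + \<alpha> err(\<Pi>, \<mu>) / \<epsilon>\<close>.  Against every \<open>\<mu>\<close> there is a protocol with payoff less than 1.
  The payoff is affine under mixing protocols by shared randomness and concave in \<open>\<mu>\<close>, hence some protocol has
  payoff at most 1 against all \<open>\<mu>\<close>; its information cost is at most \<open>I / (1 - \<alpha>)\<close>, and its error is at
  most \<open>\<epsilon> / \<alpha>\<close> on each input, because the information cost is 0 at point masses.

  Concavity in \<open>\<mu>\<close> amounts to strong subadditivity of the entropy.  With \<open>p\<close> and \<open>q\<close> the eigenvalues of \<open>P\<close> and \<open>Q\<close>,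
  the relative entropy of \<open>P\<close> and \<open>Q\<close> is, up to linear terms, an integral over \<open>s \<in> (0, 1)\<close> of \<open>s\<close> times the sums
  of \<open>(q - p)\<^sup>2 / ((1 - s) p + s q)\<close> weighted by the squared overlaps of the eigenvectors; each such sum
  is a supremum of functionals that are linear in \<open>(P, Q)\<close>.\<close>

subsection \<open>Entropy from an orthonormal decomposition\<close>

text \<open>The infima need not be attained and the protocols carry no useful topology, since rounds
  and dimensions are unbounded. The minimax step is therefore done for finitely many payoffs and up
  to a slack, by separation in the plane. Strong subadditivity enters through conditional entropies:
  S(CB) - S(B) is, up to a trace term, minus the relative entropy of the state with respect to the
  identity on C tensored with its marginal on B. Affinity under mixing dictates the form of the
  mixed protocol. Shared states have to be pure, so the random index is a coherent label held by
  both parties. Tracing out one party leaves a state that is block diagonal in the label of the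
  other, and the entropy of the label cancels in S(CB) - S(B) and in S(CA) - S(A). Protocols of
  different dimensions become blocks of unequal size in a common space, and the isometries have to
  be completed outside of the blocks. Operators are handled as functions on arbitrary finite index
  sets, so that a composite register is a product of sets; matrices return only where the
  definitions speak of them.\<close>

lemma char_poly_mult_commute:
  fixes A B :: "complex mat"
  assumes A: "A \<in> carrier_mat n m" and B: "B \<in> carrier_mat m n"
  shows "[:0, 1:] ^ m * char_poly (A * B) = [:0, 1:] ^ n * char_poly (B * A)"
proof -
  let ?x = "[:0, 1:] :: complex poly"
  let ?A = "map_mat (\<lambda>a. [:a:]) A" and ?B = "map_mat (\<lambda>a. [:a:]) B"
  let ?I = "\<lambda>n. 1\<^sub>m n :: complex poly mat" and ?O = "\<lambda>n m. 0\<^sub>m n m :: complex poly mat"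
  have const_sum: "[:\<Sum>i\<in>S. f i:] = (\<Sum>i\<in>S. [:f i :: complex:])" for S :: "nat set" and f
  proof (induction S rule: infinite_finite_induct)
    case (insert i S)
    have "[:\<Sum>i\<in>insert i S. f i:] = [:f i:] + [:\<Sum>i\<in>S. f i:]"
      using insert.hyps by simp
    then show ?case unfolding insert.IH sum.insert[OF insert.hyps] .
  qed auto
  have A': "?A \<in> carrier_mat n m" and B': "?B \<in> carrier_mat m n" using A B by auto
  have AB: "?A * ?B = map_mat (\<lambda>a. [:a:]) (A * B)" and BA: "?B * ?A = map_mat (\<lambda>a. [:a:]) (B * A)"
    using A B by (auto intro!: eq_matI simp: scalar_prod_def const_sum ac_simps)
  have cAB: "char_poly_matrix (A * B) = ?x \<cdot>\<^sub>m ?I n - ?A * ?B"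
    and cBA: "char_poly_matrix (B * A) = ?x \<cdot>\<^sub>m ?I m - ?B * ?A"
    unfolding AB BA char_poly_matrix_def using A B by (auto intro!: eq_matI)
  \<comment> \<open>Sylvester's trick: a block triangular factor, once on the right and once on the
    left, clears the lower left block of \<open>M\<close>, which computes the determinant of
    \<open>M\<close> in two ways. The powers of the variable account for the surplus zero
    eigenvalues of the larger product.\<close>
  define M where "M = four_block_mat (?x \<cdot>\<^sub>m ?I n) ?A ?B (?I m)"
  have Mc: "M \<in> carrier_mat (n + m) (n + m)"
    unfolding M_def using A' B' by (intro four_block_carrier_mat) auto
  have M1: "M * four_block_mat (?I n) (?O n m) (- ?B) (?I m)
      = four_block_mat (?x \<cdot>\<^sub>m ?I n - ?A * ?B) ?A (?O m n) (?I m)"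
    unfolding M_def using A' B'
    by (subst mult_four_block_mat[where ?n1.0 = n and ?n2.0 = m and ?nr1.0 = n and ?nr2.0 = m and
        ?nc1.0 = n and ?nc2.0 = m])
       (auto intro!: cong_four_block_mat eq_matI)
  have M2: "four_block_mat (?I n) (?O n m) (- ?B) (?x \<cdot>\<^sub>m ?I m) * M
      = four_block_mat (?x \<cdot>\<^sub>m ?I n) ?A (?O m n) (?x \<cdot>\<^sub>m ?I m - ?B * ?A)"
    unfolding M_def using A' B'
    by (subst mult_four_block_mat[where ?n1.0 = n and ?n2.0 = m and ?nr1.0 = n and ?nr2.0 = m and
        ?nc1.0 = n and ?nc2.0 = m])
       (auto intro!: cong_four_block_mat eq_matI)
  have d1: "Determinant.det (four_block_mat (?I n) (?O n m) (- ?B) (?I m)) = 1"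
    using B' by (subst det_four_block_mat_upper_right_zero[of _ n _ m]) auto
  have d2: "Determinant.det (four_block_mat (?x \<cdot>\<^sub>m ?I n - ?A * ?B) ?A (?O m n) (?I m))
      = char_poly (A * B)"
    using A' B' by (subst det_four_block_mat_lower_left_zero[of _ n _ m]) (auto
        simp: char_poly_def cAB)
  have d3: "Determinant.det (four_block_mat (?I n) (?O n m) (- ?B) (?x \<cdot>\<^sub>m ?I m)) = ?x ^ m"
    using B' by (subst det_four_block_mat_upper_right_zero[of _ n _ m]) auto
  have d4: "Determinant.det (four_block_mat (?x \<cdot>\<^sub>m ?I n) ?A (?O m n) (?x \<cdot>\<^sub>m ?I m - ?B * ?A))
      = ?x ^ n * char_poly (B * A)"
    using A' B' by (subst det_four_block_mat_lower_left_zero[of _ n _ m]) (auto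
        simp: char_poly_def cBA)
  have c1: "four_block_mat (?I n) (?O n m) (- ?B) (?I m) \<in> carrier_mat (n + m) (n + m)"
    and c2: "four_block_mat (?I n) (?O n m) (- ?B) (?x \<cdot>\<^sub>m ?I m) \<in> carrier_mat (n + m) (n + m)"
    using B' by (auto intro!: four_block_carrier_mat)
  have "Determinant.det M = char_poly (A * B)"
    using det_mult[OF Mc c1] unfolding M1 d1 d2 by simp
  moreover have "?x ^ m * Determinant.det M = ?x ^ n * char_poly (B * A)"
    using det_mult[OF c2 Mc] unfolding M2 d3 d4 by simp
  ultimately show ?thesis by simp
qed

definition orthonormal_family :: "'i set \<Rightarrow> 'k set \<Rightarrow> ('k \<Rightarrow> 'i \<Rightarrow> complex) \<Rightarrow> bool" where
  "orthonormal_family I K u \<longleftrightarrow>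
     (\<forall>k\<in>K. \<forall>l\<in>K. (\<Sum>i\<in>I. cnj (u k i) * u l i) = (if k = l then 1 else 0))"

text \<open>The family need not span the space, and zero eigenvalues may be listed or omitted. This
  freedom is used for reduced states of pure states, where only the support is decomposed.\<close>

definition eigdec ::
  "'i set \<Rightarrow> ('i \<Rightarrow> 'i \<Rightarrow> complex) \<Rightarrow> 'k set \<Rightarrow> ('k \<Rightarrow> 'i \<Rightarrow> complex) \<Rightarrow> ('k \<Rightarrow> real) \<Rightarrow> bool" where
  "eigdec I \<rho> K u p \<longleftrightarrow> finite K \<and> orthonormal_family I K u \<and>
     (\<forall>i\<in>I. \<forall>j\<in>I. \<rho> i j = (\<Sum>k\<in>K. of_real (p k) * u k i * cnj (u k j)))"

lemma eigdec_reindex: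
  assumes "eigdec I \<rho> K u p" and h: "bij_betw h K' K"
  shows "eigdec I \<rho> K' (\<lambda>k. u (h k)) (\<lambda>k. p (h k))"
proof -
  have "finite K'" using assms bij_betw_finite unfolding eigdec_def by blast
  moreover have "h k = h l \<longleftrightarrow> k = l" "h k \<in> K" if "k \<in> K'" "l \<in> K'" for k l
    using h that by (auto simp: bij_betw_def inj_on_def)
  moreover have "(\<Sum>k\<in>K. f k) = (\<Sum>k\<in>K'. f (h k))" for f :: "_ \<Rightarrow> complex"
    using sum.reindex_bij_betw[OF h, of f] by simp
  ultimately show ?thesis
    using assms(1) unfolding eigdec_def orthonormal_family_def by auto
qed

text \<open>Links the flattened matrix indices of the protocol definitions to index sets that are
  products, one component per register.\<close>

definition mat_represents :: "nat \<Rightarrow> complex mat \<Rightarrow> 'i set \<Rightarrow> ('i \<Rightarrow> nat) \<Rightarrow> ('i \<Rightarrow> 'i \<Rightarrow> complex)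
    \<Rightarrow> bool" where
  "mat_represents n M I enc \<rho> \<longleftrightarrow> M \<in> carrier_mat n n \<and> bij_betw enc I {..<n} \<and>
     (\<forall>i\<in>I. \<forall>j\<in>I. M $$ (enc i, enc j) = \<rho> i j)"

lemma order_diagonal_prod:
  fixes m :: nat
  shows "Polynomial.order e (\<Prod>k<m. [:- f k, 1:]) = card {k. k < m \<and> f k = (e :: complex)}"
proof (induction m)
  case (Suc m)
  have nz: "(\<Prod>k<m. [:- f k, 1:]) \<noteq> 0" by (auto simp: prod_zero_iff)
  have *: "{k. k < Suc m \<and> f k = e} = (if f m = e then insert m {k. k < m \<and> f k = e}
      else {k. k < m \<and> f k = e})"
    by (auto simp: less_Suc_eq)
  have o: "Polynomial.order e [:- f m, 1:] = (if f m = e then 1 else 0)"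
    using order_power_n_n[of e 1] by (auto intro!: order_0I)
  have "Polynomial.order e (\<Prod>k<Suc m. [:- f k, 1:])
      = Polynomial.order e (\<Prod>k<m. [:- f k, 1:]) + Polynomial.order e [:- f m, 1:]"
    unfolding prod.lessThan_Suc
        by (rule order_mult) (use no_zero_divisors[OF nz, of "[:- f m, 1:]"] in simp)
  then show ?case unfolding Suc * o by simp
qed (simp add: order_0I)

text \<open>Write \<open>M = A * B\<close>, where the columns of \<open>A\<close> are the
  eigenvectors scaled by their eigenvalues and the rows of \<open>B\<close> are their conjugates. By
  orthonormality \<open>B * A\<close> is the diagonal matrix of the \<open>p k\<close>, and both
  products have the same nonzero eigenvalues with multiplicity. At 0 the multiplicities may differ,
  as the family may be incomplete.\<close>

lemma order_char_poly_eigdec: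
  fixes \<rho> :: "'i \<Rightarrow> 'i \<Rightarrow> complex" and m :: nat
  assumes M: "mat_represents n M I enc \<rho>" and d: "eigdec I \<rho> {..<m} u p" and e: "e \<noteq> 0"
  shows "Polynomial.order e (char_poly M) = card {k. k < m \<and> of_real (p k) = e}"
proof -
  define dec where "dec = inv_into I enc"
  have enc: "bij_betw enc I {..<n}" and Mc: "M \<in> carrier_mat n n" using M
      by (auto simp: mat_represents_def)
  have dec: "bij_betw dec {..<n} I" unfolding dec_def by (rule bij_betw_inv_into[OF enc])
  have Mij: "M $$ (i, j) = \<rho> (dec i) (dec j)" if "i < n" "j < n" for i j
  proof -
    have "dec i \<in> I" "dec j \<in> I" "enc (dec i) = i" "enc (dec j) = j"
      using that enc dec bij_betw_inv_into_right[OF enc] by (auto simp: dec_def bij_betw_def)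
    then show ?thesis using M unfolding mat_represents_def by metis
  qed
  define A where "A = Matrix.mat n m (\<lambda>(i, k). of_real (p k) * u k (dec i))"
  define B where "B = Matrix.mat m n (\<lambda>(k, i). cnj (u k (dec i)))"
  have A: "A \<in> carrier_mat n m" and B: "B \<in> carrier_mat m n" by (auto simp: A_def B_def)
  have AB: "M = A * B"
  proof (rule eq_matI)
    fix i j assume "i < dim_row (A * B)" "j < dim_col (A * B)"
    then have ij: "i < n" "j < n" using A B by auto
    then have "dec i \<in> I" "dec j \<in> I" using dec by (auto simp: bij_betw_def)
    then show "M $$ (i, j) = (A * B) $$ (i, j)"
      using d ij by (simp add: Mij eigdec_def A_def B_def scalar_prod_def lessThan_atLeast0)
  qed (use A B Mc in auto)
  have sum_dec: "(\<Sum>i<n. f (dec i)) = sum f I" for f :: "'i \<Rightarrow> complex"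
    using sum.reindex_bij_betw[OF dec] .
  have BA: "(B * A) $$ (k, l) = (if k = l then of_real (p k) else 0)" if "k < m" "l < m" for k l
  proof -
    have "(B * A) $$ (k, l) = (\<Sum>i<n. cnj (u k (dec i)) * (of_real (p l) * u l (dec i)))"
      using that by (simp add: A_def B_def scalar_prod_def lessThan_atLeast0)
    also have "\<dots> = of_real (p l) * (\<Sum>i\<in>I. cnj (u k i) * u l i)"
      unfolding sum_distrib_left by (subst sum_dec[symmetric]) (simp add: mult_ac)
    also have "\<dots> = (if k = l then of_real (p k) else 0)"
      using d that by (auto simp: eigdec_def orthonormal_family_def)
    finally show ?thesis .
  qed
  have BAc: "B * A \<in> carrier_mat m m" using A B by auto
  have "char_poly (B * A) = (\<Prod>a\<leftarrow>diag_mat (B * A). [:- a, 1:])"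
    by (rule char_poly_upper_triangular[OF BAc]) (use BA BAc in \<open>auto simp: upper_triangular_def\<close>)
  also have "\<dots> = (\<Prod>k<m. [:- (B * A) $$ (k, k), 1:])"
    using B by (simp add: diag_mat_def prod.list_conv_set_nth lessThan_atLeast0)
  also have "\<dots> = (\<Prod>k<m. [:- of_real (p k), 1:])"
    using BA by simp
  finally have cBA: "char_poly (B * A) = (\<Prod>k<m. [:- of_real (p k), 1:])" .
  have ne: "char_poly M \<noteq> 0" "char_poly (B * A) \<noteq> 0"
    using degree_monic_char_poly[OF Mc] degree_monic_char_poly[OF BAc] by auto
  have xo: "Polynomial.order e ([:0, 1:] ^ j) = 0" for j
    using e by (intro order_0I) (simp add: poly_power)
  have "Polynomial.order e ([:0, 1:] ^ m * char_poly M) = Polynomial.order e (char_poly M)"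
    using ne xo by (subst order_mult) auto
  moreover have "Polynomial.order e ([:0, 1:] ^ n * char_poly (B * A))
      = Polynomial.order e (char_poly (B * A))"
    using ne xo by (subst order_mult) auto
  ultimately have "Polynomial.order e (char_poly M) = Polynomial.order e (char_poly (B * A))"
    using char_poly_mult_commute[OF A B] AB by simp
  then show ?thesis unfolding cBA order_diagonal_prod .
qed

text \<open>Only nonzero eigenvalues have a controlled multiplicity, which suffices because 0
  contributes nothing to the entropy. The indices \<open>k\<close> are grouped by the value of
  \<open>p k\<close>.\<close>

lemma vn_entropy_eigdec_nat:
  fixes m :: nat
  assumes M: "mat_represents n M I enc \<rho>" and d: "eigdec I \<rho> {..<m} u p"
  shows "vn_entropy M = - (\<Sum>k<m. p k * log 2 (p k))"
proof -
  have Mc: "M \<in> carrier_mat n n" using M by (auto simp: mat_represents_def)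
  define F where "F = (\<lambda>e. real (Polynomial.order e (char_poly M)) * (Re e * log 2 (Re e)))"
  have ne: "char_poly M \<noteq> 0" using degree_monic_char_poly[OF Mc] by auto
  have sp: "spectrum M = {e. poly (char_poly M) e = 0}"
    using eigenvalue_root_char_poly[OF Mc] by (auto simp: spectrum_def)
  then have fin: "finite (spectrum M)" using poly_roots_finite[OF ne] by simp
  let ?N = "{k. k < m \<and> p k \<noteq> 0}"
  have oc: "Polynomial.order e (char_poly M) = card {k. k < m \<and> of_real (p k) = e}" if "e \<noteq> 0" for e
    by (rule order_char_poly_eigdec[OF M d that])
  have mem: "complex_of_real (p k) \<in> spectrum M - {0}" if "k \<in> ?N" for k
  proof -
    have "k \<in> {l. l < m \<and> complex_of_real (p l) = of_real (p k)}" using that by auto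
    moreover have "finite {l. l < m \<and> complex_of_real (p l) = of_real (p k)}" by auto
    ultimately have "Polynomial.order (of_real (p k)) (char_poly M) \<noteq> 0"
      using oc[of "of_real (p k)"] that by (auto simp: card_eq_0_iff)
    then show ?thesis using that ne by (simp add: sp order_root)
  qed
  have "(\<Sum>e\<in>spectrum M. F e) = (\<Sum>e\<in>spectrum M - {0}. F e)"
    by (intro sum.mono_neutral_right fin) (auto simp: F_def)
  also have "\<dots> = (\<Sum>e\<in>spectrum M - {0}. \<Sum>k | k \<in> ?N \<and> complex_of_real (p k) = e. p k * log 2 (p k))"
  proof (rule sum.cong[OF refl])
    fix e assume e: "e \<in> spectrum M - {0}"
    have "{k. k < m \<and> of_real (p k) = e} = {k. k \<in> ?N \<and> complex_of_real (p k) = e}"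
      using e by auto
    moreover have "(\<Sum>k | k \<in> ?N \<and> complex_of_real (p k) = e. p k * log 2 (p k))
        = (\<Sum>k | k \<in> ?N \<and> complex_of_real (p k) = e. Re e * log 2 (Re e))"
      by (rule sum.cong) auto
    ultimately show "F e = (\<Sum>k | k \<in> ?N \<and> complex_of_real (p k) = e. p k * log 2 (p k))"
      using e oc[of e] by (simp add: F_def)
  qed
  also have "\<dots> = (\<Sum>k\<in>?N. p k * log 2 (p k))"
    using mem fin by (intro sum.group) auto
  also have "\<dots> = (\<Sum>k<m. p k * log 2 (p k))"
    by (intro sum.mono_neutral_left) auto
  finally show ?thesis by (simp add: vn_entropy_def F_def)
qed

lemma vn_entropy_eigdec:
  assumes M: "mat_represents n M I enc \<rho>" and d: "eigdec I \<rho> K u p"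
  shows "vn_entropy M = - (\<Sum>k\<in>K. p k * log 2 (p k))"
proof -
  have "finite K" using d by (auto simp: eigdec_def)
  then obtain h where h: "bij_betw h {..<card K} K"
    using ex_bij_betw_nat_finite[of K] by (auto simp: lessThan_atLeast0)
  show ?thesis
    using vn_entropy_eigdec_nat[OF M eigdec_reindex[OF d h]]
      sum.reindex_bij_betw[OF h, of "\<lambda>k. p k * log 2 (p k)"] by simp
qed

subsection \<open>The spectral theorem\<close>

definition hermitian_on :: "'i set \<Rightarrow> ('i \<Rightarrow> 'i \<Rightarrow> complex) \<Rightarrow> bool" where
  "hermitian_on I \<rho> \<longleftrightarrow> (\<forall>i\<in>I. \<forall>j\<in>I. cnj (\<rho> i j) = \<rho> j i)"

text \<open>Orthonormality says that a square matrix has a left inverse; completeness says that the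
  same matrix is a right inverse.\<close>

lemma orthonormal_family_complete_nat:
  fixes n :: nat
  assumes u: "orthonormal_family {..<n} {..<n} u" and ij: "i < n" "j < n"
  shows "(\<Sum>k<n. u k i * cnj (u k j)) = (if i = j then 1 else 0)"
proof -
  define U where "U = Matrix.mat n n (\<lambda>(i, k). u k i)"
  define V where "V = Matrix.mat n n (\<lambda>(k, i). cnj (u k i))"
  have "V * U = 1\<^sub>m n"
    using u by (intro eq_matI)
      (auto simp: U_def V_def scalar_prod_def orthonormal_family_def lessThan_atLeast0)
  then have "U * V = 1\<^sub>m n"
    by (rule mat_mult_left_right_inverse[rotated 2]) (auto simp: U_def V_def)
  then have "(U * V) $$ (i, j) = 1\<^sub>m n $$ (i, j)" by simp
  then show ?thesis using ij
    by (simp add: U_def V_def scalar_prod_def lessThan_atLeast0)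
qed

lemma sum_sandwich:
  fixes r :: "'a \<Rightarrow> 'b \<Rightarrow> complex"
  shows "(\<Sum>c\<in>A. (\<Sum>i\<in>K. f i c) * (\<Sum>d\<in>B. r c d * (\<Sum>j\<in>L. g j d)))
     = (\<Sum>i\<in>K. \<Sum>j\<in>L. \<Sum>c\<in>A. \<Sum>d\<in>B. f i c * r c d * g j d)"
proof -
  have "(\<Sum>c\<in>A. (\<Sum>i\<in>K. f i c) * (\<Sum>d\<in>B. r c d * (\<Sum>j\<in>L. g j d)))
      = (\<Sum>c\<in>A. \<Sum>i\<in>K. \<Sum>d\<in>B. \<Sum>j\<in>L. f i c * r c d * g j d)"
    unfolding sum_distrib_right unfolding sum_distrib_left by (simp only: mult.assoc)
  also have "\<dots> = (\<Sum>i\<in>K. \<Sum>c\<in>A. \<Sum>j\<in>L. \<Sum>d\<in>B. f i c * r c d * g j d)"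
    by (subst sum.swap) (intro sum.cong refl sum.swap)
  also have "\<dots> = (\<Sum>i\<in>K. \<Sum>j\<in>L. \<Sum>c\<in>A. \<Sum>d\<in>B. f i c * r c d * g j d)"
    by (intro sum.cong refl sum.swap)
  finally show ?thesis .
qed

text \<open>The completion is the Householder reflection that maps the first basis vector to \<open>x\<close>.
  Since \<open>x 0 \<le> 0\<close>, the reflection vector \<open>e\<^sub>0 - x\<close> is bounded away from zero.\<close>

lemma orthonormal_completion_nat:
  fixes x :: "nat \<Rightarrow> complex"
  assumes nx: "(\<Sum>i<Suc n. cnj (x i) * x i) = 1" and x0: "x 0 = - of_real r" "r \<ge> 0"
  obtains U where "orthonormal_family {..<Suc n} {..<Suc n} U" "\<And>i. U 0 i = x i"
proof -
  define w where "w i = (if i = 0 then 1 else 0) - x i" for i :: nat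
  \<comment> \<open>\<open>t\<close> is both \<open>w 0\<close> and half the squared norm of
    \<open>w\<close>. Hence the operator with columns \<open>U k\<close> is the identity minus 2 w
    w* / |w|^2, and \<open>t \<ge> 1\<close> allows the division.\<close>
  define t where "t = complex_of_real (1 + r)"
  have t: "t \<noteq> 0" "cnj t = t" using x0(2) by (auto simp: t_def simp flip: of_real_add)
  define U where "U k i = (if i = k then 1 else 0) - w i * cnj (w k) / t" for k i
  have w0: "w 0 = t" by (simp add: w_def x0 t_def)
  have nw: "(\<Sum>i<Suc n. cnj (w i) * w i) = 2 * t"
  proof -
    have "(\<Sum>i<Suc n. cnj (w i) * w i)
        = (\<Sum>i<Suc n. (if i = 0 then 1 - x 0 - cnj (x 0) else 0) + cnj (x i) * x i)"
      by (intro sum.cong refl) (auto simp: w_def algebra_simps)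
    also have "\<dots> = 1 - x 0 - cnj (x 0) + 1" unfolding sum.distrib nx by simp
    finally show ?thesis by (simp add: x0 t_def)
  qed
  have "(\<Sum>i<Suc n. cnj (U k i) * U l i) = (if k = l then 1 else 0)" if "k < Suc n" "l < Suc n"
      for k l
  proof -
    have "(\<Sum>i<Suc n. cnj (U k i) * U l i)
        = (\<Sum>i<Suc n. (if i = k then (if k = l then 1 else 0) else 0)
            - (if i = k then w k * cnj (w l) / t else 0) - (if i = l then cnj (w l) * w k / t else
                0)
            + cnj (w i) * w i * (w k * cnj (w l) / t\<^sup>2))"
      using t by (intro sum.cong refl) (auto simp: U_def algebra_simps power2_eq_square)
    also have "\<dots> = (if k = l then 1 else 0) - w k * cnj (w l) / t - cnj (w l) * w k / t
        + 2 * t * (w k * cnj (w l) / t\<^sup>2)"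
      unfolding sum.distrib sum_subtractf sum_distrib_right[symmetric] nw using that by simp
    also have "\<dots> = (if k = l then 1 else 0)"
      using t by (simp add: field_simps power2_eq_square)
    finally show ?thesis .
  qed
  then have "orthonormal_family {..<Suc n} {..<Suc n} U" by (auto simp: orthonormal_family_def)
  moreover have "U 0 i = x i" for i
    using t w0 by (auto simp: U_def) (auto simp: w_def)
  ultimately show ?thesis using that by blast
qed

text \<open>An eigenvector exists because the spectrum of a complex matrix is nonempty. Its length
  and phase are normalised to meet the requirements of
  \<open>orthonormal_completion_nat\<close>.\<close>

lemma hermitian_eigenvector_nat:
  fixes \<rho> :: "nat \<Rightarrow> nat \<Rightarrow> complex"
  assumes h: "hermitian_on {..<Suc n} \<rho>"
  obtains x r e where "(\<Sum>i<Suc n. cnj (x i) * x i) = 1" "x 0 = - of_real r" "r \<ge> 0"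
    "\<And>i. i < Suc n \<Longrightarrow> (\<Sum>j<Suc n. \<rho> i j * x j) = of_real e * x i"
proof -
  define M where "M = Matrix.mat (Suc n) (Suc n) (\<lambda>(i, j). \<rho> i j)"
  have Mc: "M \<in> carrier_mat (Suc n) (Suc n)" by (simp add: M_def)
  obtain e where "e \<in> spectrum M" using spectrum_non_empty[OF Mc] by auto
  then obtain v where v: "v \<in> carrier_vec (Suc n)" "v \<noteq> 0\<^sub>v (Suc n)" "M *\<^sub>v v = e \<cdot>\<^sub>v v"
    using Mc by (auto simp: spectrum_def eigenvalue_def eigenvector_def)
  define y where "y i = vec_index v i" for i
  have ev: "(\<Sum>j<Suc n. \<rho> i j * y j) = e * y i" if "i < Suc n" for i
  proof -
    have "vec_index (M *\<^sub>v v) i = vec_index (e \<cdot>\<^sub>v v) i" using v(3) by simp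
    then show ?thesis
      using that v(1) by (simp add: M_def y_def scalar_prod_def lessThan_atLeast0)
  qed
  define N where "N = (\<Sum>i<Suc n. (cmod (y i))\<^sup>2)"
  obtain i where i: "i < Suc n" "y i \<noteq> 0"
    using v(1,2) by (metis y_def carrier_vecD eq_vecI index_zero_vec(1,2))
  have N: "N > 0"
    unfolding N_def by (rule sum_pos2[of _ i]) (use i in auto)
  define s where "s = sqrt N"
  have s: "s > 0" "s\<^sup>2 = N" using N by (auto simp: s_def)
  \<comment> \<open>The phase turns \<open>y 0\<close> into minus its modulus; the division by
    \<open>s\<close> normalises.\<close>
  define c where "c = (if y 0 = 0 then 1 else - cnj (y 0) / of_real (cmod (y 0))) / of_real s"
  define x where "x i = c * y i" for i
  have cc: "cnj c * c = 1 / of_real N"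
  proof -
    have "cmod c = 1 / s" using s by (auto simp: c_def norm_divide)
    then show ?thesis
      using s by (subst mult.commute) (simp only: complex_norm_square[symmetric] power_divide, simp)
  qed
  have yN: "(\<Sum>i<Suc n. cnj (y i) * y i) = of_real N"
    unfolding N_def of_real_sum complex_norm_square by (intro sum.cong refl mult.commute)
  have nx: "(\<Sum>i<Suc n. cnj (x i) * x i) = 1"
  proof -
    have "(\<Sum>i<Suc n. cnj (x i) * x i) = (cnj c * c) * (\<Sum>i<Suc n. cnj (y i) * y i)"
      unfolding sum_distrib_left x_def by (intro sum.cong refl) (simp add: mult_ac)
    then show ?thesis using N by (simp only: cc yN) simp
  qed
  have x0: "x 0 = - of_real (cmod (y 0) / s)"
  proof (cases "y 0 = 0")
    case False
    have "x 0 = - (y 0 * cnj (y 0)) / (of_real (cmod (y 0)) * of_real s)"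
      using False by (simp add: x_def c_def)
    also have "\<dots> = - of_real (cmod (y 0) / s)"
      using False s(1) unfolding complex_norm_square[symmetric] by (simp add: power2_eq_square)
    finally show ?thesis .
  qed (simp add: x_def)
  have evx: "(\<Sum>j<Suc n. \<rho> i j * x j) = e * x i" if "i < Suc n" for i
  proof -
    have "(\<Sum>j<Suc n. \<rho> i j * x j) = c * (\<Sum>j<Suc n. \<rho> i j * y j)"
      unfolding sum_distrib_left x_def by (intro sum.cong refl) (simp add: mult_ac)
    then show ?thesis by (simp only: ev[OF that]) (simp add: x_def)
  qed
  \<comment> \<open>As \<open>x\<close> is a unit vector, \<open>e\<close> is the value of the
    quadratic form at \<open>x\<close>, which a Hermitian matrix makes equal to its own
    conjugate.\<close>
  have e1: "e = (\<Sum>i<Suc n. \<Sum>j<Suc n. cnj (x i) * \<rho> i j * x j)"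
  proof -
    have "(\<Sum>i<Suc n. \<Sum>j<Suc n. cnj (x i) * \<rho> i j * x j) = (\<Sum>i<Suc n. cnj (x i) * (e * x i))"
      using evx by (intro sum.cong refl) (simp add: mult.assoc sum_distrib_left[symmetric] del:
          sum.lessThan_Suc)
    also have "\<dots> = e * (\<Sum>i<Suc n. cnj (x i) * x i)"
      unfolding sum_distrib_left by (intro sum.cong refl) (simp add: mult_ac)
    finally show ?thesis unfolding nx by simp
  qed
  have "cnj e = (\<Sum>i<Suc n. \<Sum>j<Suc n. cnj (x j) * \<rho> j i * x i)"
    using h unfolding e1 cnj_sum
    by (intro sum.cong refl) (auto simp: hermitian_on_def mult_ac)
  also have "\<dots> = e" unfolding e1 by (rule sum.swap)
  finally have er: "e = of_real (Re e)" by (simp add: complex_eq_iff)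
  show ?thesis
    by (rule that[OF nx x0, of "Re e"]) (use s evx er in auto)
qed

text \<open>Deflation: in an orthonormal basis that starts with an eigenvector, the first column of
  \<open>R\<close> vanishes off the diagonal, hence by Hermiticity the first row does too, and the
  remaining block is diagonalised by induction.\<close>

lemma spectral_theorem_nat:
  fixes \<rho> :: "nat \<Rightarrow> nat \<Rightarrow> complex"
  shows "hermitian_on {..<n} \<rho> \<Longrightarrow> \<exists>u p. eigdec {..<n} \<rho> {..<n} u p"
proof (induction n arbitrary: \<rho>)
  case 0
  then show ?case by (auto simp: eigdec_def orthonormal_family_def)
next
  case (Suc n)
  obtain x e r where nx: "(\<Sum>i<Suc n. cnj (x i) * x i) = 1" "x 0 = - of_real r" "r \<ge> 0"
    and ev: "\<And>i. i < Suc n \<Longrightarrow> (\<Sum>j<Suc n. \<rho> i j * x j) = of_real e * x i"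
    using hermitian_eigenvector_nat[OF Suc.prems] by blast
  obtain U where U: "orthonormal_family {..<Suc n} {..<Suc n} U" and U0: "\<And>i. U 0 i = x i"
    using orthonormal_completion_nat[OF nx] by blast
  have on: "(\<Sum>a<Suc n. cnj (U i a) * U j a) = (if i = j then 1 else 0)" if "i < Suc n" "j < Suc n"
      for i j
    using U that unfolding orthonormal_family_def by blast
  have co: "(\<Sum>k<Suc n. U k a * cnj (U k b)) = (if a = b then 1 else 0)" if "a < Suc n" "b < Suc n"
      for a b
    using orthonormal_family_complete_nat[OF U that] .
  define R where "R i j = (\<Sum>a<Suc n. \<Sum>b<Suc n. cnj (U i a) * \<rho> a b * U j b)" for i j
  have R0: "R i 0 = (if i = 0 then of_real e else 0)" if "i < Suc n" for i
  proof -
    have "R i 0 = (\<Sum>a<Suc n. cnj (U i a) * (of_real e * x a))"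
      unfolding R_def using ev
      by (intro sum.cong refl) (simp add: U0 mult.assoc sum_distrib_left[symmetric] del:
          sum.lessThan_Suc)
    also have "\<dots> = of_real e * (\<Sum>a<Suc n. cnj (U i a) * U 0 a)"
      unfolding sum_distrib_left U0 by (intro sum.cong refl) (simp add: mult_ac)
    finally show ?thesis unfolding on[OF that zero_less_Suc] by simp
  qed
  have Rh: "cnj (R i j) = R j i" for i j
  proof -
    have "cnj (R i j) = (\<Sum>a<Suc n. \<Sum>b<Suc n. cnj (U j b) * \<rho> b a * U i a)"
      unfolding R_def cnj_sum using Suc.prems
      by (intro sum.cong refl) (auto simp: hermitian_on_def mult_ac)
    also have "\<dots> = R j i" unfolding R_def by (rule sum.swap)
    finally show ?thesis by simp
  qed
  have "hermitian_on {..<n} (\<lambda>i j. R (Suc i) (Suc j))"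
    using Rh unfolding hermitian_on_def by blast
  from Suc.IH[OF this] obtain u p where up: "eigdec {..<n} (\<lambda>i j. R (Suc i) (Suc j)) {..<n} u p"
      by blast
  have Rs: "R (Suc i) (Suc j) = (\<Sum>k<n. of_real (p k) * u k i * cnj (u k j))" if "i < n" "j < n"
      for i j
    using up that by (auto simp: eigdec_def)
  have onu: "(\<Sum>i<n. cnj (u k i) * u l i) = (if k = l then 1 else 0)" if "k < n" "l < n" for k l
    using up that by (auto simp: eigdec_def orthonormal_family_def)
  \<comment> \<open>The new eigenbasis: \<open>x\<close>, followed by the eigenvectors of the
    smaller block carried back by \<open>U\<close>.\<close>
  define t where "t k a = (case k of 0 \<Rightarrow> x a | Suc k \<Rightarrow> (\<Sum>i<n. u k i * U (Suc i) a))" for k a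
  define q where "q k = (case k of 0 \<Rightarrow> e | Suc k \<Rightarrow> p k)" for k
  have onc: "(\<Sum>a<Suc n. cnj (t (Suc k) a) * U j a) = (case j of 0 \<Rightarrow> 0 | Suc j \<Rightarrow> cnj (u k j))"
    if "k < n" "j < Suc n" for k j
  proof -
    have "(\<Sum>a<Suc n. cnj (t (Suc k) a) * U j a)
        = (\<Sum>a<Suc n. \<Sum>i<n. cnj (u k i) * (cnj (U (Suc i) a) * U j a))"
      by (simp add: t_def cnj_sum sum_distrib_right mult.assoc del: sum.lessThan_Suc)
    also have "\<dots> = (\<Sum>i<n. cnj (u k i) * (\<Sum>a<Suc n. cnj (U (Suc i) a) * U j a))"
      by (subst sum.swap) (simp only: sum_distrib_left)
    also have "\<dots> = (\<Sum>i<n. cnj (u k i) * (if Suc i = j then 1 else 0))"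
      using on that by (intro sum.cong refl) (simp del: sum.lessThan_Suc)
    also have "\<dots> = (case j of 0 \<Rightarrow> 0 | Suc j \<Rightarrow> cnj (u k j))"
    proof (cases j)
      case (Suc j')
      have "(\<Sum>i<n. cnj (u k i) * (if Suc i = j then 1 else 0)) = (\<Sum>i<n. if i = j' then cnj (u k i)
          else 0)"
        by (intro sum.cong refl) (simp add: Suc)
      then show ?thesis using that Suc by simp
    qed simp
    finally show ?thesis .
  qed
  have tt: "(\<Sum>a<Suc n. cnj (t k a) * t l a) = (if k = l then 1 else 0)" if "k < Suc n" "l < Suc n"
      for k l
  proof -
    have *: "(\<Sum>a<Suc n. cnj (t (Suc k) a) * t l a) = (if Suc k = l then 1 else 0)"
        if "k < n" "l < Suc n" for k l
    proof (cases l)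
      case 0
      then have "(\<Sum>a<Suc n. cnj (t (Suc k) a) * t l a) = (\<Sum>a<Suc n. cnj (t (Suc k) a) * U 0 a)"
        by (intro sum.cong refl) (simp add: t_def U0)
      then show ?thesis using onc[of k 0] that 0 by (simp del: sum.lessThan_Suc)
    next
      case (Suc l')
      have "(\<Sum>a<Suc n. cnj (t (Suc k) a) * t l a)
          = (\<Sum>a<Suc n. \<Sum>i<n. u l' i * (cnj (t (Suc k) a) * U (Suc i) a))"
        by (intro sum.cong refl) (simp add: Suc t_def[of "Suc l'"] sum_distrib_left mult_ac)
      also have "\<dots> = (\<Sum>i<n. u l' i * (\<Sum>a<Suc n. cnj (t (Suc k) a) * U (Suc i) a))"
        by (subst sum.swap) (simp only: sum_distrib_left)
      also have "\<dots> = (\<Sum>i<n. u l' i * cnj (u k i))"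
        using onc that by (intro sum.cong refl) (simp del: sum.lessThan_Suc)
      also have "\<dots> = (\<Sum>i<n. cnj (u k i) * u l' i)" by (simp add: mult.commute)
      finally show ?thesis using onu[of k l'] that Suc by auto
    qed
    show ?thesis
    proof (cases k)
      case (Suc k')
      then show ?thesis using * that by auto
    next
      case 0
      show ?thesis
      proof (cases l)
        case 0
        then show ?thesis using \<open>k = 0\<close> nx(1) by (simp add: t_def del: sum.lessThan_Suc)
      next
        case (Suc l')
        have A: "(\<Sum>a<Suc n. cnj (t k a) * t l a) = cnj (\<Sum>a<Suc n. cnj (t (Suc l') a) * t k a)"
          unfolding cnj_sum Suc by (intro sum.cong refl) (simp add: mult.commute)
        have B: "(\<Sum>a<Suc n. cnj (t (Suc l') a) * t k a) = 0"
          using *[of l' k] Suc 0 that by (simp del: sum.lessThan_Suc)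
        show ?thesis unfolding A B using 0 Suc by simp
      qed
    qed
  qed
  have "\<rho> a b = (\<Sum>k<Suc n. of_real (q k) * t k a * cnj (t k b))" if ab: "a < Suc n" "b < Suc n"
      for a b
  proof -
    have "(\<Sum>d<Suc n. \<rho> c d * (if d = b then 1 else 0)) = (\<Sum>d<Suc n. if d = b then \<rho> c d else 0)"
        for c
      by (intro sum.cong refl) simp
    then have *: "(\<Sum>d<Suc n. \<rho> c d * (if d = b then 1 else 0)) = \<rho> c b" for c
      using ab by (simp del: sum.lessThan_Suc)
    have "(\<Sum>c<Suc n. (if a = c then 1 else 0) * \<rho> c b) = (\<Sum>c<Suc n. if c = a then \<rho> c b else 0)"
      by (intro sum.cong refl) simp
    also have "\<dots> = \<rho> a b" using ab by (simp del: sum.lessThan_Suc)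
    finally have "\<rho> a b = (\<Sum>c<Suc n. (if a = c then 1 else 0) * (\<Sum>d<Suc n. \<rho> c d * (if d = b then 1
        else 0)))"
      unfolding * by simp
    \<comment> \<open>The completeness relation \<open>co\<close> is inserted on both sides of
      \<open>\<rho>\<close>, so that the matrix elements \<open>R i j\<close> appear.\<close>
    also have "\<dots> = (\<Sum>c<Suc n. (\<Sum>i<Suc n. U i a * cnj (U i c)) *
        (\<Sum>d<Suc n. \<rho> c d * (\<Sum>j<Suc n. U j d * cnj (U j b))))"
      by (intro sum.cong refl arg_cong2[of _ _ _ _ "(*)"]) (use ab co in \<open>simp_all del:
          sum.lessThan_Suc\<close>)
    also have "\<dots> = (\<Sum>i<Suc n. \<Sum>j<Suc n. U i a * R i j * cnj (U j b))"
      unfolding sum_sandwich unfolding R_def sum_distrib_left sum_distrib_right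
      by (intro sum.cong refl) (simp add: mult_ac)
    also have "\<dots> = U 0 a * of_real e * cnj (U 0 b) + (\<Sum>i<n. \<Sum>j<n. U (Suc i) a * R (Suc i) (Suc j)
        * cnj (U (Suc j) b))"
    proof -
      have "R 0 (Suc j) = 0" if "j < n" for j using Rh[of "Suc j" 0] R0[of "Suc j"] that by simp
      then show ?thesis using R0 by (simp add: sum.lessThan_Suc_shift del: sum.lessThan_Suc)
    qed
    also have "(\<Sum>i<n. \<Sum>j<n. U (Suc i) a * R (Suc i) (Suc j) * cnj (U (Suc j) b))
        = (\<Sum>i<n. \<Sum>j<n. \<Sum>k<n. of_real (p k) * (u k i * U (Suc i) a) * (cnj (u k j * U (Suc j) b)))"
      using Rs by (intro sum.cong refl) (simp add: sum_distrib_left sum_distrib_right mult_ac)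
    also have "\<dots> = (\<Sum>i<n. \<Sum>k<n. \<Sum>j<n. of_real (p k) * (u k i * U (Suc i) a)
        * (cnj (u k j * U (Suc j) b)))"
      by (intro sum.cong refl sum.swap)
    also have "\<dots> = (\<Sum>k<n. \<Sum>i<n. \<Sum>j<n. of_real (p k) * (u k i * U (Suc i) a)
        * (cnj (u k j * U (Suc j) b)))"
      by (rule sum.swap)
    also have "\<dots> = (\<Sum>k<n. of_real (p k) * t (Suc k) a * cnj (t (Suc k) b))"
      by (simp add: t_def sum_distrib_left sum_distrib_right mult_ac)
    also have "U 0 a * of_real e * cnj (U 0 b) = of_real (q 0) * t 0 a * cnj (t 0 b)"
      by (simp add: t_def q_def U0)
    finally show ?thesis
      unfolding sum.lessThan_Suc_shift by (simp add: q_def)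
  qed
  then have "eigdec {..<Suc n} \<rho> {..<Suc n} t q"
    using tt unfolding eigdec_def orthonormal_family_def by blast
  then show ?case by blast
qed

lemma spectral_theorem:
  assumes "finite I" and h: "hermitian_on I \<rho>"
  shows "\<exists>u p. eigdec I \<rho> {..<card I} u p \<and>
    (\<forall>i\<in>I. \<forall>j\<in>I. (\<Sum>k<card I. u k i * cnj (u k j)) = (if i = j then 1 else 0))"
proof -
  let ?n = "card I"
  obtain f where f: "bij_betw f I {..<?n}"
    using ex_bij_betw_finite_nat[OF assms(1)] by (auto simp: lessThan_atLeast0)
  define g where "g = inv_into I f"
  have g: "bij_betw g {..<?n} I" unfolding g_def by (rule bij_betw_inv_into[OF f])
  have fg: "g (f i) = i" "f i < ?n" if "i \<in> I" for i
    using that f bij_betw_inv_into_left[OF f] by (auto simp: g_def bij_betw_def)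
  have "hermitian_on {..<?n} (\<lambda>i j. \<rho> (g i) (g j))"
    using h g by (auto simp: hermitian_on_def bij_betw_def)
  from spectral_theorem_nat[OF this] obtain u p
    where d: "eigdec {..<?n} (\<lambda>i j. \<rho> (g i) (g j)) {..<?n} u p" by blast
  have on: "orthonormal_family {..<?n} {..<?n} u" using d by (simp add: eigdec_def)
  have sf: "(\<Sum>i\<in>I. F (f i)) = (\<Sum>i<?n. F i)" for F :: "nat \<Rightarrow> complex"
    using sum.reindex_bij_betw[OF f] .
  have inj: "f i = f j \<longleftrightarrow> i = j" if "i \<in> I" "j \<in> I" for i j
    using f that by (auto simp: bij_betw_def inj_on_def)
  have "eigdec I \<rho> {..<?n} (\<lambda>k i. u k (f i)) p"
    unfolding eigdec_def orthonormal_family_def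
  proof (intro conjI ballI)
    fix k l assume "k \<in> {..<?n}" "l \<in> {..<?n}"
    then show "(\<Sum>i\<in>I. cnj (u k (f i)) * u l (f i)) = (if k = l then 1 else 0)"
      using on sf[of "\<lambda>i. cnj (u k i) * u l i"] by (simp add: orthonormal_family_def)
  next
    fix i j assume ij: "i \<in> I" "j \<in> I"
    then have "f i \<in> {..<?n}" "f j \<in> {..<?n}" using fg by auto
    then have "\<rho> (g (f i)) (g (f j)) = (\<Sum>k<?n. complex_of_real (p k) * u k (f i) * cnj (u k (f j)))"
      using d unfolding eigdec_def by blast
    then show "\<rho> i j = (\<Sum>k<?n. complex_of_real (p k) * u k (f i) * cnj (u k (f j)))"
      using fg ij by simp
  qed simp
  moreover have "(\<Sum>k<?n. u k (f i) * cnj (u k (f j))) = (if i = j then 1 else 0)" if "i \<in> I" "j \<in> I"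
      for i j
    using orthonormal_family_complete_nat[OF on, of "f i" "f j"] fg inj that by simp
  ultimately show ?thesis by blast
qed

subsection \<open>Entropy of positive operators on finite index sets\<close>

definition psd_on :: "'i set \<Rightarrow> ('i \<Rightarrow> 'i \<Rightarrow> complex) \<Rightarrow> bool" where
  "psd_on I \<rho> \<longleftrightarrow> hermitian_on I \<rho> \<and> (\<forall>v. 0 \<le> Re (\<Sum>i\<in>I. \<Sum>j\<in>I. cnj (v i) * \<rho> i j * v j))"

text \<open>The reduced state on \<open>I\<close> of the unnormalised pure state
  \<open>\<psi>\<close> on two registers \<open>I\<close> and \<open>E\<close>.\<close>

definition gram :: "'e set \<Rightarrow> ('i \<Rightarrow> 'e \<Rightarrow> complex) \<Rightarrow> 'i \<Rightarrow> 'i \<Rightarrow> complex" where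
  "gram E \<psi> i j = (\<Sum>e\<in>E. \<psi> i e * cnj (\<psi> j e))"

text \<open>The enumeration of \<open>I\<close> is an arbitrary choice; \<open>ent_eigdec\<close>
  shows that for operators with a decomposition the value does not depend on it.\<close>

definition ent :: "'i set \<Rightarrow> ('i \<Rightarrow> 'i \<Rightarrow> complex) \<Rightarrow> real" where
  "ent I \<rho> = vn_entropy (let f = (SOME f. bij_betw f {..<card I} I)
     in Matrix.mat (card I) (card I) (\<lambda>(i, j). \<rho> (f i) (f j)))"

lemma ent_eigdec:
  assumes "finite I" and d: "eigdec I \<rho> K u p"
  shows "ent I \<rho> = - (\<Sum>k\<in>K. p k * log 2 (p k))"
proof -
  define f where "f = (SOME f. bij_betw f {..<card I} I)"
  have f: "bij_betw f {..<card I} I"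
    unfolding f_def by (rule someI_ex[where P = "\<lambda>f. bij_betw f {..<card I} I"])
        (use ex_bij_betw_nat_finite[OF assms(1)] in \<open>simp add: lessThan_atLeast0\<close>)
  have *: "inv_into {..<card I} f i < card I" "f (inv_into {..<card I} f i) = i" if "i \<in> I" for i
    using bij_betw_inv_into[OF f] bij_betw_inv_into_right[OF f] that by (auto simp: bij_betw_def)
  have "mat_represents (card I) (Matrix.mat (card I) (card I) (\<lambda>(i, j). \<rho> (f i) (f j))) I
      (inv_into {..<card I} f) \<rho>"
    using bij_betw_inv_into[OF f] * by (auto simp: mat_represents_def)
  from vn_entropy_eigdec[OF this d] show ?thesis
    by (simp add: ent_def Let_def f_def)
qed

lemma vn_entropy_eq_ent:
  assumes M: "mat_represents n M I enc \<rho>" and h: "hermitian_on I \<rho>"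
  shows "vn_entropy M = ent I \<rho>"
proof -
  have "finite I" using M bij_betw_finite[of enc I] by (auto simp: mat_represents_def)
  from spectral_theorem[OF this h] obtain u p where d: "eigdec I \<rho> {..<card I} u p" by blast
  show ?thesis using vn_entropy_eigdec[OF M d] ent_eigdec[OF \<open>finite I\<close> d] by simp
qed

lemma ent_cong:
  assumes "finite I" "hermitian_on I \<rho>" "\<And>i j. i \<in> I \<Longrightarrow> j \<in> I \<Longrightarrow> \<rho> i j = \<sigma> i j"
  shows "ent I \<rho> = ent I \<sigma>"
proof -
  obtain u p where d: "eigdec I \<rho> {..<card I} u p" using spectral_theorem[OF assms(1,2)] by blast
  then have d': "eigdec I \<sigma> {..<card I} u p" using assms(3) by (auto simp: eigdec_def)
  show ?thesis by (simp add: ent_eigdec[OF assms(1) d] ent_eigdec[OF assms(1) d'])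
qed

lemma eigdec_form:
  assumes "eigdec I \<rho> K u p"
  shows "(\<Sum>i\<in>I. \<Sum>j\<in>I. x i * \<rho> i j * y j)
    = (\<Sum>k\<in>K. of_real (p k) * (\<Sum>i\<in>I. x i * u k i) * (\<Sum>j\<in>I. cnj (u k j) * y j))"
proof -
  have "(\<Sum>i\<in>I. \<Sum>j\<in>I. x i * \<rho> i j * y j)
      = (\<Sum>i\<in>I. \<Sum>j\<in>I. \<Sum>k\<in>K. of_real (p k) * (x i * u k i) * (cnj (u k j) * y j))"
    using assms by (intro sum.cong refl) (simp add: eigdec_def sum_distrib_left sum_distrib_right
        mult_ac)
  also have "\<dots> = (\<Sum>i\<in>I. \<Sum>k\<in>K. \<Sum>j\<in>I. of_real (p k) * (x i * u k i) * (cnj (u k j) * y j))"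
    by (intro sum.cong refl sum.swap)
  also have "\<dots> = (\<Sum>k\<in>K. \<Sum>i\<in>I. \<Sum>j\<in>I. of_real (p k) * (x i * u k i) * (cnj (u k j) * y j))"
    by (rule sum.swap)
  also have "\<dots> = (\<Sum>k\<in>K. of_real (p k) * ((\<Sum>i\<in>I. x i * u k i) * (\<Sum>j\<in>I. cnj (u k j) * y j)))"
    unfolding sum_product unfolding sum_distrib_left by (simp only: mult.assoc)
  finally show ?thesis by (simp only: mult.assoc)
qed

lemma eigdec_eigenvalue:
  assumes d: "eigdec I \<rho> K u p" and k: "k \<in> K" "l \<in> K"
  shows "(\<Sum>i\<in>I. \<Sum>j\<in>I. cnj (u k i) * \<rho> i j * u l j) = (if k = l then of_real (p k) else 0)"
proof -
  have on: "(\<Sum>i\<in>I. cnj (u m i) * u m' i) = (if m = m' then 1 else 0)" if "m \<in> K" "m' \<in> K" for m m'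
    using d that by (simp add: eigdec_def orthonormal_family_def)
  have "(\<Sum>i\<in>I. \<Sum>j\<in>I. cnj (u k i) * \<rho> i j * u l j)
      = (\<Sum>m\<in>K. if m = k then (if k = l then of_real (p k) else 0) else 0)"
    unfolding eigdec_form[OF d] using on k by (intro sum.cong refl) auto
  then show ?thesis using k d by (simp add: eigdec_def)
qed

lemma eigdec_nonneg:
  assumes d: "eigdec I \<rho> K u p" and \<rho>: "psd_on I \<rho>" and k: "k \<in> K"
  shows "p k \<ge> 0"
proof -
  have "0 \<le> Re (\<Sum>i\<in>I. \<Sum>j\<in>I. cnj (u k i) * \<rho> i j * u k j)"
    using \<rho> unfolding psd_on_def by blast
  then show ?thesis unfolding eigdec_eigenvalue[OF d k k] by simp
qed

lemma eigdec_trace: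
  assumes d: "eigdec I \<rho> K u p"
  shows "(\<Sum>i\<in>I. \<rho> i i) = of_real (\<Sum>k\<in>K. p k)"
proof -
  have "(\<Sum>i\<in>I. \<rho> i i) = (\<Sum>i\<in>I. \<Sum>k\<in>K. of_real (p k) * (cnj (u k i) * u k i))"
    using d by (intro sum.cong refl) (simp add: eigdec_def mult_ac)
  also have "\<dots> = (\<Sum>k\<in>K. of_real (p k) * (\<Sum>i\<in>I. cnj (u k i) * u k i))"
    by (subst sum.swap) (simp only: sum_distrib_left)
  also have "\<dots> = (\<Sum>k\<in>K. of_real (p k))"
    using d by (intro sum.cong refl) (simp add: eigdec_def orthonormal_family_def)
  finally show ?thesis by simp
qed

lemma gram_form:
  "(\<Sum>i\<in>I. \<Sum>j\<in>I. x i * gram E \<psi> i j * y j)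
    = (\<Sum>e\<in>E. (\<Sum>i\<in>I. x i * \<psi> i e) * (\<Sum>j\<in>I. cnj (\<psi> j e) * y j))"
proof -
  have "(\<Sum>i\<in>I. \<Sum>j\<in>I. x i * gram E \<psi> i j * y j)
      = (\<Sum>i\<in>I. \<Sum>j\<in>I. \<Sum>e\<in>E. (x i * \<psi> i e) * (cnj (\<psi> j e) * y j))"
    by (intro sum.cong refl) (simp add: gram_def sum_distrib_left sum_distrib_right mult_ac)
  also have "\<dots> = (\<Sum>i\<in>I. \<Sum>e\<in>E. \<Sum>j\<in>I. (x i * \<psi> i e) * (cnj (\<psi> j e) * y j))"
    by (intro sum.cong refl sum.swap)
  also have "\<dots> = (\<Sum>e\<in>E. \<Sum>i\<in>I. \<Sum>j\<in>I. (x i * \<psi> i e) * (cnj (\<psi> j e) * y j))"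
    by (rule sum.swap)
  finally show ?thesis unfolding sum_product .
qed

lemma psd_on_gram [simp, intro]: "psd_on I (gram E \<psi>)"
  unfolding psd_on_def
proof (intro conjI allI)
  show "hermitian_on I (gram E \<psi>)" by (auto simp: hermitian_on_def gram_def mult.commute)
  fix v
  have "(\<Sum>i\<in>I. \<Sum>j\<in>I. cnj (v i) * gram E \<psi> i j * v j)
      = (\<Sum>e\<in>E. of_real ((cmod (\<Sum>i\<in>I. cnj (v i) * \<psi> i e))\<^sup>2))"
    unfolding gram_form complex_norm_square cnj_sum by (simp add: mult.commute)
  then show "0 \<le> Re (\<Sum>i\<in>I. \<Sum>j\<in>I. cnj (v i) * gram E \<psi> i j * v j)"
    by (simp add: sum_nonneg)
qed

lemma psd_on_hermitian: "psd_on I \<rho> \<Longrightarrow> hermitian_on I \<rho>"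
  by (simp add: psd_on_def)

lemma hermitian_on_gram [simp, intro]: "hermitian_on I (gram E \<psi>)"
  using psd_on_gram psd_on_hermitian by blast

lemma psd_on_add: "psd_on I \<rho> \<Longrightarrow> psd_on I \<sigma> \<Longrightarrow> psd_on I (\<lambda>i j. \<rho> i j + \<sigma> i j)"
  unfolding psd_on_def hermitian_on_def by (auto simp: algebra_simps sum.distrib)

lemma psd_on_scale: "psd_on I \<rho> \<Longrightarrow> 0 \<le> w \<Longrightarrow> psd_on I (\<lambda>i j. of_real w * \<rho> i j)"
proof -
  assume \<rho>: "psd_on I \<rho>" and w: "0 \<le> w"
  have "(\<Sum>i\<in>I. \<Sum>j\<in>I. cnj (v i) * (of_real w * \<rho> i j) * v j)
      = of_real w * (\<Sum>i\<in>I. \<Sum>j\<in>I. cnj (v i) * \<rho> i j * v j)" for v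
    by (simp add: sum_distrib_left mult_ac)
  then show ?thesis using \<rho> w by (auto simp: psd_on_def hermitian_on_def)
qed

lemma psd_on_zero: "psd_on I (\<lambda>i j. 0)"
  by (simp add: psd_on_def hermitian_on_def)

lemma psd_on_sum: "(\<And>a. a \<in> A \<Longrightarrow> psd_on I (\<rho> a)) \<Longrightarrow> psd_on I (\<lambda>i j. \<Sum>a\<in>A. \<rho> a i j)"
  by (induction A rule: infinite_finite_induct) (auto simp: psd_on_zero intro!: psd_on_add)

text \<open>The Schmidt decomposition: the two reduced states of a pure state have the same nonzero
  spectrum. The vector \<open>y k\<close> is the image of the eigenvector \<open>u k\<close> under
  \<open>\<psi>\<close>; these images are orthogonal with squared norms \<open>p k\<close>.\<close>

lemma ent_gram_transpose:
  assumes fin: "finite I" "finite E"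
  shows "ent I (gram E \<psi>) = ent E (gram I (\<lambda>e i. \<psi> i e))"
proof -
  let ?n = "card I"
  obtain u p where d: "eigdec I (gram E \<psi>) {..<?n} u p"
    and co: "\<And>i j. i \<in> I \<Longrightarrow> j \<in> I \<Longrightarrow> (\<Sum>k<?n. u k i * cnj (u k j)) = (if i = j then 1 else 0)"
    using spectral_theorem[OF fin(1) hermitian_on_gram] by blast
  define y where "y k e = (\<Sum>i\<in>I. cnj (u k i) * \<psi> i e)" for k e
  have yy: "(\<Sum>e\<in>E. cnj (y k e) * y l e) = (if k = l then of_real (p k) else 0)" if "k < ?n" "l < ?n"
      for k l
  proof -
    have "(\<Sum>e\<in>E. cnj (y k e) * y l e) = (\<Sum>i\<in>I. \<Sum>j\<in>I. cnj (u l i) * gram E \<psi> i j * u k j)"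
      unfolding gram_form y_def cnj_sum by (simp add: mult.commute)
    then show ?thesis using eigdec_eigenvalue[OF d, of l k] that by simp
  qed
  have p0: "p k \<ge> 0" if "k < ?n" for k using eigdec_nonneg[OF d psd_on_gram] that by simp
  have y0: "y k e = 0" if "k < ?n" "p k = 0" "e \<in> E" for k e
  proof -
    have "(\<Sum>e\<in>E. complex_of_real ((cmod (y k e))\<^sup>2)) = 0"
      using yy[of k k] that unfolding complex_norm_square by (simp add: mult.commute)
    then have "(\<Sum>e\<in>E. (cmod (y k e))\<^sup>2) = 0" by (metis of_real_sum of_real_eq_0_iff)
    then show ?thesis using that fin by (simp add: sum_nonneg_eq_0_iff)
  qed
  \<comment> \<open>Eigenvectors with \<open>p k = 0\<close> have image zero and cannot be
    normalised; they are omitted from the decomposition.\<close>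
  let ?K = "{k. k < ?n \<and> p k \<noteq> 0}"
  have "eigdec E (gram I (\<lambda>e i. \<psi> i e)) ?K (\<lambda>k e. y k e / of_real (sqrt (p k))) p"
    unfolding eigdec_def orthonormal_family_def
  proof (intro conjI ballI)
    fix k l assume kl: "k \<in> ?K" "l \<in> ?K"
    have "(\<Sum>e\<in>E. cnj (y k e / of_real (sqrt (p k))) * (y l e / of_real (sqrt (p l))))
        = (\<Sum>e\<in>E. cnj (y k e) * y l e) / of_real (sqrt (p k) * sqrt (p l))"
      by (simp add: sum_divide_distrib)
    also have "\<dots> = (if k = l then 1 else 0)"
      using kl yy p0 by (auto simp: real_sqrt_mult[symmetric] simp del: of_real_mult)
    finally show "(\<Sum>e\<in>E. cnj (y k e / of_real (sqrt (p k))) * (y l e / of_real (sqrt (p l))))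
        = (if k = l then 1 else 0)" .
  next
    fix a b assume ab: "a \<in> E" "b \<in> E"
    have "gram I (\<lambda>e i. \<psi> i e) a b = (\<Sum>i\<in>I. \<Sum>j\<in>I. (if i = j then 1 else 0) * (\<psi> i a * cnj (\<psi> j b)))"
      using fin by (simp add: gram_def if_distrib[of "\<lambda>x. x * _"] cong: if_cong)
    also have "\<dots> = (\<Sum>i\<in>I. \<Sum>j\<in>I. (\<Sum>k<?n. u k j * cnj (u k i)) * (\<psi> i a * cnj (\<psi> j b)))"
      using co by (intro sum.cong refl) auto
    also have "\<dots> = (\<Sum>i\<in>I. \<Sum>j\<in>I. \<Sum>k<?n. (cnj (u k i) * \<psi> i a) * (u k j * cnj (\<psi> j b)))"
      by (simp add: sum_distrib_left sum_distrib_right mult_ac)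
    also have "\<dots> = (\<Sum>i\<in>I. \<Sum>k<?n. \<Sum>j\<in>I. (cnj (u k i) * \<psi> i a) * (u k j * cnj (\<psi> j b)))"
      by (intro sum.cong refl sum.swap)
    also have "\<dots> = (\<Sum>k<?n. \<Sum>i\<in>I. \<Sum>j\<in>I. (cnj (u k i) * \<psi> i a) * (u k j * cnj (\<psi> j b)))"
      by (rule sum.swap)
    also have "\<dots> = (\<Sum>k<?n. y k a * cnj (y k b))"
      unfolding y_def cnj_sum sum_product by simp
    also have "\<dots> = (\<Sum>k\<in>?K. y k a * cnj (y k b))"
      by (rule sum.mono_neutral_right) (use y0 ab in auto)
    also have "\<dots> = (\<Sum>k\<in>?K. of_real (p k) * (y k a / of_real (sqrt (p k)))
        * cnj (y k b / of_real (sqrt (p k))))"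
    proof (intro sum.cong refl)
      fix k assume "k \<in> ?K"
      then have "complex_of_real (sqrt (p k)) * of_real (sqrt (p k)) = of_real (p k)" "p k \<noteq> 0"
        using p0 by (auto simp flip: of_real_mult)
      then show "y k a * cnj (y k b) = of_real (p k) * (y k a / of_real (sqrt (p k)))
          * cnj (y k b / of_real (sqrt (p k)))"
        by (simp add: field_simps)
    qed
    finally show "gram I (\<lambda>e i. \<psi> i e) a b = \<dots>" .
  qed simp
  from ent_eigdec[OF fin(2) this] have
      "ent E (gram I (\<lambda>e i. \<psi> i e)) = - (\<Sum>k\<in>?K. p k * log 2 (p k))" .
  also have "(\<Sum>k\<in>?K. p k * log 2 (p k)) = (\<Sum>k<?n. p k * log 2 (p k))"
    by (rule sum.mono_neutral_left) auto
  finally show ?thesis using ent_eigdec[OF fin(1) d] by simp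
qed

text \<open>The eigenvectors of the blocks, extended by zero, diagonalise \<open>\<rho>\<close> with
  eigenvalues \<open>w k * p k m\<close>, and the logarithm of a product splits. The map
  \<open>h\<close> places the blocks, whose sizes may differ, and \<open>\<rho>\<close> vanishes at
  all positions outside of them.\<close>

lemma ent_block_diagonal:
  fixes h :: "'k \<Rightarrow> 'i \<Rightarrow> 'j"
  assumes fin: "finite A" "\<And>k. k \<in> A \<Longrightarrow> finite (I k)" "finite J"
    and inj: "inj_on (\<lambda>(k, i). h k i) (Sigma A I)"
    and hJ: "\<And>k i. k \<in> A \<Longrightarrow> i \<in> I k \<Longrightarrow> h k i \<in> J"
    and psd: "\<And>k. k \<in> A \<Longrightarrow> psd_on (I k) (\<sigma> k)" and w: "\<And>k. k \<in> A \<Longrightarrow> w k \<ge> 0"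
    and blk: "\<And>k i l j. k \<in> A \<Longrightarrow> i \<in> I k \<Longrightarrow> l \<in> A \<Longrightarrow> j \<in> I l \<Longrightarrow>
      \<rho> (h k i) (h l j) = (if k = l then of_real (w k) * \<sigma> k i j else 0)"
    and out: "\<And>j j'. j \<in> J \<Longrightarrow> j' \<in> J \<Longrightarrow> \<forall>k\<in>A. \<forall>i\<in>I k. j \<noteq> h k i \<Longrightarrow> \<rho> j j' = 0 \<and> \<rho> j' j = 0"
  shows "ent J \<rho> = (\<Sum>k\<in>A. w k * ent (I k) (\<sigma> k) - w k * log 2 (w k) * Re (\<Sum>i\<in>I k. \<sigma> k i i))"
proof -
  have "\<forall>k\<in>A. \<exists>u p. eigdec (I k) (\<sigma> k) {..<card (I k)} u p"
    using spectral_theorem[OF fin(2) psd_on_hermitian[OF psd]] by metis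
  then obtain u p where d: "\<And>k. k \<in> A \<Longrightarrow> eigdec (I k) (\<sigma> k) {..<card (I k)} (u k) (p k)"
    by metis
  \<comment> \<open>Extension by zero of the \<open>m\<close>-th eigenvector of block
    \<open>k\<close>; the description operator recovers the position inside the block, which is
    unique because \<open>h\<close> is injective.\<close>
  define v where "v = (\<lambda>(k, m) j. if \<exists>i\<in>I k. j = h k i then u k m (THE i. i \<in> I k \<and> j = h k i)
      else 0)"
  have hh: "h k i = h l j \<longleftrightarrow> k = l \<and> i = j" if "k \<in> A" "i \<in> I k" "l \<in> A" "j \<in> I l" for k i l j
    using inj that by (auto simp: inj_on_def)
  have v: "v (k, m) (h l i) = (if k = l then u k m i else 0)" if "k \<in> A" "l \<in> A" "i \<in> I l"
      for k m l i
  proof (cases "k = l")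
    case True
    then have "(THE i'. i' \<in> I k \<and> h l i = h k i') = i"
      using that hh by (intro the_equality) auto
    then show ?thesis using True that by (auto simp: v_def)
  qed (use that hh in \<open>auto simp: v_def\<close>)
  have v0: "v (k, m) j = 0" if "\<forall>k\<in>A. \<forall>i\<in>I k. j \<noteq> h k i" "k \<in> A" for k m j
    using that by (auto simp: v_def)
  let ?D = "(\<lambda>(k, i). h k i) ` Sigma A I"
  let ?K = "Sigma A (\<lambda>k. {..<card (I k)})"
  have sumJ: "(\<Sum>j\<in>J. F j) = (\<Sum>k\<in>A. \<Sum>i\<in>I k. F (h k i))"
    if "\<And>j. j \<in> J \<Longrightarrow> \<forall>k\<in>A. \<forall>i\<in>I k. j \<noteq> h k i \<Longrightarrow> F j = 0" for F :: "'j \<Rightarrow> complex"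
  proof -
    have "(\<Sum>j\<in>J. F j) = (\<Sum>j\<in>?D. F j)"
      using fin(3) hJ that by (intro sum.mono_neutral_right) (auto simp: image_def)
    also have "\<dots> = (\<Sum>x\<in>Sigma A I. F (case x of (k, i) \<Rightarrow> h k i))"
      by (subst sum.reindex[OF inj]) simp
    also have "\<dots> = (\<Sum>k\<in>A. \<Sum>i\<in>I k. F (h k i))"
      using fin by (simp add: sum.Sigma split_def)
    finally show ?thesis .
  qed
  have "eigdec J \<rho> ?K v (\<lambda>(k, m). w k * p k m)"
    unfolding eigdec_def orthonormal_family_def
  proof (intro conjI ballI)
    show "finite ?K" using fin by auto
  next
    fix x y assume xy: "x \<in> ?K" "y \<in> ?K"
    obtain k m l m' where x: "x = (k, m)" and y: "y = (l, m')" by (metis surj_pair)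
    have kl: "k \<in> A" "l \<in> A" "m < card (I k)" "m' < card (I l)" using xy x y by auto
    have "(\<Sum>j\<in>J. cnj (v x j) * v y j) = (\<Sum>a\<in>A. \<Sum>i\<in>I a. cnj (v x (h a i)) * v y (h a i))"
      by (rule sumJ) (use v0 kl x y in auto)
    also have "\<dots> = (\<Sum>a\<in>A. if a = k then (if k = l then \<Sum>i\<in>I k. cnj (u k m i) * u k m' i else 0)
        else 0)"
      unfolding x y using kl v by (intro sum.cong refl) auto
    also have "\<dots> = (if k = l then \<Sum>i\<in>I k. cnj (u k m i) * u k m' i else 0)"
      using fin kl by simp
    also have "\<dots> = (if x = y then 1 else 0)"
      using d[OF kl(1)] kl unfolding x y eigdec_def orthonormal_family_def by auto
    finally show "(\<Sum>j\<in>J. cnj (v x j) * v y j) = (if x = y then 1 else 0)" .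
  next
    fix j j' assume j: "j \<in> J" "j' \<in> J"
    have R: "(\<Sum>x\<in>?K. of_real (case x of (k, m) \<Rightarrow> w k * p k m) * v x j * cnj (v x j'))
        = (\<Sum>k\<in>A. \<Sum>m<card (I k). of_real (w k * p k m) * v (k, m) j * cnj (v (k, m) j'))"
      using fin by (simp add: sum.Sigma split_def)
    show "\<rho> j j' = (\<Sum>x\<in>?K. of_real (case x of (k, m) \<Rightarrow> w k * p k m) * v x j * cnj (v x j'))"
    proof (cases "(\<forall>k\<in>A. \<forall>i\<in>I k. j \<noteq> h k i) \<or> (\<forall>k\<in>A. \<forall>i\<in>I k. j' \<noteq> h k i)")
      case True
      then have "\<rho> j j' = 0" using out j by blast
      moreover have "\<forall>k\<in>A. \<forall>m. v (k, m) j * cnj (v (k, m) j') = 0" using True v0 by auto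
      ultimately show ?thesis unfolding R by (simp add: mult.assoc)
    next
      case False
      then obtain l i l' i'
          where L: "l \<in> A" "i \<in> I l" "j = h l i" "l' \<in> A" "i' \<in> I l'" "j' = h l' i'"
        by blast
      have "(\<Sum>k\<in>A. \<Sum>m<card (I k). of_real (w k * p k m) * v (k, m) j * cnj (v (k, m) j'))
          = (\<Sum>k\<in>A. if k = l then (if l = l' then \<Sum>m<card (I l). of_real (w l * p l m) * u l m i *
              cnj (u l m i') else 0) else 0)"
        using L v by (intro sum.cong refl) auto
      also have "\<dots> = (if l = l'
          then of_real (w l) * (\<Sum>m<card (I l). of_real (p l m) * u l m i * cnj (u l m i')) else 0)"
        using fin L by (simp add: sum_distrib_left mult_ac)
      also have "\<dots> = (if l = l' then of_real (w l) * \<sigma> l i i' else 0)"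
        using d[OF L(1)] L by (auto simp: eigdec_def)
      also have "\<dots> = \<rho> j j'" using blk L by simp
      finally show ?thesis unfolding R by simp
    qed
  qed
  from ent_eigdec[OF fin(3) this]
  have "ent J \<rho> = - (\<Sum>k\<in>A. \<Sum>m<card (I k). w k * p k m * log 2 (w k * p k m))"
    using fin by (simp add: sum.Sigma split_def)
  also have "\<dots> = (\<Sum>k\<in>A. - (\<Sum>m<card (I k). w k * p k m * log 2 (w k * p k m)))"
    by (simp add: sum_negf)
  also have "\<dots> = (\<Sum>k\<in>A. w k * ent (I k) (\<sigma> k) - w k * log 2 (w k) * Re (\<Sum>i\<in>I k. \<sigma> k i i))"
  proof (rule sum.cong[OF refl])
    fix k assume k: "k \<in> A"
    have "w k * p k m * log 2 (w k * p k m) = w k * (p k m * log 2 (p k m)) + w k * log 2 (w k)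
        * p k m"
      if "m < card (I k)" for m
    \<comment> \<open>A vanishing factor makes every term zero; otherwise both factors are positive,
      as splitting the logarithm requires.\<close>
    proof (cases "w k = 0 \<or> p k m = 0")
      case False
      then have "w k > 0" "p k m > 0"
        using w[OF k] eigdec_nonneg[OF d[OF k] psd[OF k]] that by (force simp: less_le)+
      then show ?thesis by (simp add: log_mult algebra_simps)
    qed auto
    then have "(\<Sum>m<card (I k). w k * p k m * log 2 (w k * p k m))
        = w k * (\<Sum>m<card (I k). p k m * log 2 (p k m)) + w k * log 2 (w k) * (\<Sum>m<card (I k). p k m)"
      by (simp add: sum.distrib sum_distrib_left)
    also have "\<dots> = - (w k * ent (I k) (\<sigma> k)) + w k * log 2 (w k) * Re (\<Sum>i\<in>I k. \<sigma> k i i)"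
      using ent_eigdec[OF fin(2)[OF k] d[OF k]] eigdec_trace[OF d[OF k]] by simp
    finally show "- (\<Sum>m<card (I k). w k * p k m * log 2 (w k * p k m))
        = w k * ent (I k) (\<sigma> k) - w k * log 2 (w k) * Re (\<Sum>i\<in>I k. \<sigma> k i i)" by simp
  qed
  finally show ?thesis .
qed

subsection \<open>Concavity of the conditional entropy\<close>

definition eigbasis ::
  "'i set \<Rightarrow> ('i \<Rightarrow> 'i \<Rightarrow> complex) \<Rightarrow> 'k set \<Rightarrow> ('k \<Rightarrow> 'i \<Rightarrow> complex) \<Rightarrow> ('k \<Rightarrow> real) \<Rightarrow> bool" where
  "eigbasis I \<rho> K u p \<longleftrightarrow> eigdec I \<rho> K u p \<and>
     (\<forall>i\<in>I. \<forall>j\<in>I. (\<Sum>k\<in>K. u k i * cnj (u k j)) = (if i = j then 1 else 0))"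

lemma eigbasis_exists:
  "finite I \<Longrightarrow> hermitian_on I \<rho> \<Longrightarrow> \<exists>u p. eigbasis I \<rho> {..<card I} u p"
  using spectral_theorem[of I \<rho>] by (simp add: eigbasis_def)

lemma eigbasis_eigdec: "eigbasis I \<rho> K u p \<Longrightarrow> eigdec I \<rho> K u p"
  by (simp add: eigbasis_def)

lemma eigbasis_orthonormal:
  "eigbasis I \<rho> K u p \<Longrightarrow> k \<in> K \<Longrightarrow> l \<in> K \<Longrightarrow> (\<Sum>i\<in>I. cnj (u k i) * u l i) = (if k = l then 1 else 0)"
  by (simp add: eigbasis_def eigdec_def orthonormal_family_def)

text \<open>Completeness says that the identity operator has the same eigenvectors with all
  eigenvalues 1, so this is the formula for its bilinear form.\<close>

lemma eigbasis_parseval: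
  assumes b: "eigbasis I \<rho> K u p" and fin: "finite I"
  shows "(\<Sum>k\<in>K. (\<Sum>i\<in>I. f i * u k i) * (\<Sum>j\<in>I. cnj (u k j) * g j)) = (\<Sum>i\<in>I. f i * g i)"
proof -
  have d: "eigdec I (\<lambda>i j. if i = j then 1 else 0) K u (\<lambda>_. 1)"
    using b by (simp add: eigbasis_def eigdec_def)
  have "(\<Sum>i\<in>I. f i * g i) = (\<Sum>i\<in>I. \<Sum>j\<in>I. f i * (if i = j then 1 else 0) * g j)"
  proof (rule sum.cong[OF refl])
    fix i assume "i \<in> I"
    have "(\<Sum>j\<in>I. f i * (if i = j then 1 else 0) * g j) = (\<Sum>j\<in>I. if j = i then f i * g j else 0)"
      by (intro sum.cong refl) simp
    then show "f i * g i = (\<Sum>j\<in>I. f i * (if i = j then 1 else 0) * g j)"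
      using \<open>i \<in> I\<close> fin by simp
  qed
  then show ?thesis unfolding eigdec_form[OF d] by simp
qed

lemma eigbasis_parseval_norm:
  assumes b: "eigbasis I \<rho> K u p" and fin: "finite I"
  shows "(\<Sum>k\<in>K. (cmod (\<Sum>i\<in>I. f i * u k i))\<^sup>2) = (\<Sum>i\<in>I. (cmod (f i))\<^sup>2)"
proof -
  have "complex_of_real (\<Sum>k\<in>K. (cmod (\<Sum>i\<in>I. f i * u k i))\<^sup>2)
      = (\<Sum>k\<in>K. (\<Sum>i\<in>I. f i * u k i) * (\<Sum>j\<in>I. cnj (u k j) * cnj (f j)))"
    unfolding of_real_sum complex_norm_square cnj_sum by (simp add: mult.commute)
  also have "\<dots> = complex_of_real (\<Sum>i\<in>I. (cmod (f i))\<^sup>2)"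
    unfolding eigbasis_parseval[OF b fin] of_real_sum complex_norm_square ..
  finally show ?thesis by (simp only: of_real_eq_iff)
qed

section \<open>A variational formula for a quantum chi-square divergence\<close>

definition overlap :: "'i set \<Rightarrow> ('i \<Rightarrow> complex) \<Rightarrow> ('i \<Rightarrow> complex) \<Rightarrow> complex" where
  "overlap I x y = (\<Sum>i\<in>I. cnj (x i) * y i)"

text \<open>The supremum of this functional over \<open>X\<close> is \<open>chi_div\<close> below.  As the functional is linear in \<open>(P, Q)\<close>,
  \<open>chi_div\<close> is convex.\<close>

definition var_functional ::
  "'i set \<Rightarrow> real \<Rightarrow> ('i \<Rightarrow> 'i \<Rightarrow> complex) \<Rightarrow> ('i \<Rightarrow> 'i \<Rightarrow> complex) \<Rightarrow> ('i \<Rightarrow> 'i \<Rightarrow> complex) \<Rightarrow> real" where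
  "var_functional I s X P Q =
     2 * Re (\<Sum>i\<in>I. \<Sum>j\<in>I. cnj (X i j) * (Q i j - P i j))
     - (1 - s) * Re (\<Sum>j\<in>I. \<Sum>i\<in>I. \<Sum>i'\<in>I. cnj (X i j) * P i i' * X i' j)
     - s * Re (\<Sum>i\<in>I. \<Sum>j\<in>I. \<Sum>j'\<in>I. X i j * Q j j' * cnj (X i j'))"

lemma var_functional_add:
  "var_functional I s X (\<lambda>i j. P i j + P' i j) (\<lambda>i j. Q i j + Q' i j)
     = var_functional I s X P Q + var_functional I s X P' Q'"
  by (simp add: var_functional_def algebra_simps sum.distrib sum_subtractf)

definition mat_coeff :: "'i set \<Rightarrow> ('i \<Rightarrow> 'i \<Rightarrow> complex) \<Rightarrow> ('i \<Rightarrow> complex) \<Rightarrow> ('i \<Rightarrow> complex)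
    \<Rightarrow> complex" where
  "mat_coeff I X y z = (\<Sum>i\<in>I. \<Sum>j\<in>I. cnj (y i) * X i j * z j)"

text \<open>\<open>P\<close> acts on the row index of \<open>X\<close> and \<open>Q\<close> on its
  column index. These two actions commute even if \<open>P\<close> and \<open>Q\<close> do not, so
  in the coefficients of \<open>X\<close> between \<open>u k\<close> and \<open>v l\<close> the
  functional decouples into one scalar quadratic for each pair \<open>(k, l)\<close>.\<close>

lemma var_functional_eigbasis:
  assumes fin: "finite I" and P: "eigbasis I P K u p" and Q: "eigbasis I Q L v q"
  shows "var_functional I s X P Q = (\<Sum>k\<in>K. \<Sum>l\<in>L.
     2 * (q l - p k) * Re (cnj (mat_coeff I X (u k) (v l)) * overlap I (u k) (v l))
     - ((1 - s) * p k + s * q l) * (cmod (mat_coeff I X (u k) (v l)))\<^sup>2)"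
proof -
  define x where "x k l = mat_coeff I X (u k) (v l)" for k l
  define a where "a l i = (\<Sum>j\<in>I. X i j * v l j)" for l i
  define b where "b k j = (\<Sum>i\<in>I. cnj (u k i) * X i j)" for k j
  have xa: "x k l = (\<Sum>i\<in>I. cnj (u k i) * a l i)" for k l
    by (simp add: x_def mat_coeff_def a_def sum_distrib_left mult.assoc)
  have xb: "x k l = (\<Sum>j\<in>I. b k j * v l j)" for k l
    unfolding x_def mat_coeff_def b_def sum_distrib_right by (rule sum.swap)
  have dP: "P i j = (\<Sum>k\<in>K. of_real (p k) * u k i * cnj (u k j))" if "i \<in> I" "j \<in> I" for i j
    using P that by (simp add: eigbasis_def eigdec_def)
  have dQ: "Q i j = (\<Sum>l\<in>L. of_real (q l) * v l i * cnj (v l j))" if "i \<in> I" "j \<in> I" for i j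
    using Q that by (simp add: eigbasis_def eigdec_def)
  have tQ: "(\<Sum>i\<in>I. \<Sum>j\<in>I. cnj (X i j) * Q i j)
      = (\<Sum>k\<in>K. \<Sum>l\<in>L. of_real (q l) * (cnj (x k l) * overlap I (u k) (v l)))"
  proof -
    have "(\<Sum>i\<in>I. \<Sum>j\<in>I. cnj (X i j) * Q i j)
        = (\<Sum>i\<in>I. \<Sum>j\<in>I. \<Sum>l\<in>L. of_real (q l) * (cnj (X i j * v l j) * v l i))"
      by (intro sum.cong refl) (simp add: dQ sum_distrib_left mult_ac)
    also have "\<dots> = (\<Sum>i\<in>I. \<Sum>l\<in>L. \<Sum>j\<in>I. of_real (q l) * (cnj (X i j * v l j) * v l i))"
      by (intro sum.cong refl sum.swap)
    also have "\<dots> = (\<Sum>l\<in>L. \<Sum>i\<in>I. \<Sum>j\<in>I. of_real (q l) * (cnj (X i j * v l j) * v l i))"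
      by (rule sum.swap)
    also have "\<dots> = (\<Sum>l\<in>L. of_real (q l) * (\<Sum>i\<in>I. cnj (a l i) * v l i))"
      by (simp add: a_def sum_distrib_left sum_distrib_right)
    also have "\<dots> = (\<Sum>l\<in>L. of_real (q l) * (\<Sum>k\<in>K. cnj (x k l) * overlap I (u k) (v l)))"
    proof (intro sum.cong refl arg_cong[of _ _ "(*) _"])
      fix l
      have "cnj (x k l) = (\<Sum>i\<in>I. cnj (a l i) * u k i)" for k
        by (simp add: xa mult.commute)
      then show "(\<Sum>i\<in>I. cnj (a l i) * v l i) = (\<Sum>k\<in>K. cnj (x k l) * overlap I (u k) (v l))"
        using eigbasis_parseval[OF P fin, of "\<lambda>i. cnj (a l i)" "v l"] by (simp add: overlap_def)
    qed
    also have "\<dots> = (\<Sum>l\<in>L. \<Sum>k\<in>K. of_real (q l) * (cnj (x k l) * overlap I (u k) (v l)))"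
      by (simp add: sum_distrib_left)
    also have "\<dots> = (\<Sum>k\<in>K. \<Sum>l\<in>L. of_real (q l) * (cnj (x k l) * overlap I (u k) (v l)))"
      by (rule sum.swap)
    finally show ?thesis .
  qed
  have tP: "(\<Sum>i\<in>I. \<Sum>j\<in>I. cnj (X i j) * P i j)
      = (\<Sum>k\<in>K. \<Sum>l\<in>L. of_real (p k) * (cnj (x k l) * overlap I (u k) (v l)))"
  proof -
    have "(\<Sum>i\<in>I. \<Sum>j\<in>I. cnj (X i j) * P i j)
        = (\<Sum>i\<in>I. \<Sum>j\<in>I. \<Sum>k\<in>K. of_real (p k) * (cnj (u k j) * cnj (cnj (u k i) * X i j)))"
      by (intro sum.cong refl) (simp add: dP sum_distrib_left mult_ac)
    also have "\<dots> = (\<Sum>i\<in>I. \<Sum>k\<in>K. \<Sum>j\<in>I. of_real (p k) * (cnj (u k j) * cnj (cnj (u k i) * X i j)))"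
      by (intro sum.cong refl sum.swap)
    also have "\<dots> = (\<Sum>k\<in>K. \<Sum>i\<in>I. \<Sum>j\<in>I. of_real (p k) * (cnj (u k j) * cnj (cnj (u k i) * X i j)))"
      by (rule sum.swap)
    also have "\<dots> = (\<Sum>k\<in>K. \<Sum>j\<in>I. \<Sum>i\<in>I. of_real (p k) * (cnj (u k j) * cnj (cnj (u k i) * X i j)))"
      by (intro sum.cong refl sum.swap)
    also have "\<dots> = (\<Sum>k\<in>K. of_real (p k) * (\<Sum>j\<in>I. cnj (u k j) * cnj (b k j)))"
      by (simp add: b_def sum_distrib_left)
    also have "\<dots> = (\<Sum>k\<in>K. of_real (p k) * (\<Sum>l\<in>L. cnj (x k l) * overlap I (u k) (v l)))"
    proof (intro sum.cong refl arg_cong[of _ _ "(*) _"])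
      fix k
      have "cnj (x k l) = (\<Sum>j\<in>I. cnj (v l j) * cnj (b k j))" for l
        by (simp add: xb mult.commute)
      then show "(\<Sum>j\<in>I. cnj (u k j) * cnj (b k j)) = (\<Sum>l\<in>L. cnj (x k l) * overlap I (u k) (v l))"
        using eigbasis_parseval[OF Q fin, of "\<lambda>j. cnj (u k j)" "\<lambda>j. cnj (b k j)"]
        by (simp add: overlap_def mult.commute)
    qed
    finally show ?thesis by (simp add: sum_distrib_left)
  qed
  have sP: "(\<Sum>j\<in>I. \<Sum>i\<in>I. \<Sum>i'\<in>I. cnj (X i j) * P i i' * X i' j)
      = of_real (\<Sum>k\<in>K. \<Sum>l\<in>L. p k * (cmod (x k l))\<^sup>2)"
  proof -
    have "(\<Sum>j\<in>I. \<Sum>i\<in>I. \<Sum>i'\<in>I. cnj (X i j) * P i i' * X i' j)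
        = (\<Sum>j\<in>I. \<Sum>k\<in>K. of_real (p k * (cmod (b k j))\<^sup>2))"
    proof (rule sum.cong[OF refl])
      fix j
      show "(\<Sum>i\<in>I. \<Sum>i'\<in>I. cnj (X i j) * P i i' * X i' j) = (\<Sum>k\<in>K. of_real (p k * (cmod (b k j))\<^sup>2))"
        unfolding eigdec_form[OF eigbasis_eigdec[OF P]] b_def of_real_mult complex_norm_square
            cnj_sum
        by (intro sum.cong refl) (simp add: mult_ac)
    qed
    also have "\<dots> = of_real (\<Sum>k\<in>K. p k * (\<Sum>j\<in>I. (cmod (b k j))\<^sup>2))"
      by (subst sum.swap) (simp add: sum_distrib_left)
    also have "\<dots> = of_real (\<Sum>k\<in>K. p k * (\<Sum>l\<in>L. (cmod (x k l))\<^sup>2))"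
      using eigbasis_parseval_norm[OF Q fin, of "b _"] by (simp add: xb)
    finally show ?thesis by (simp add: sum_distrib_left)
  qed
  have sQ: "(\<Sum>i\<in>I. \<Sum>j\<in>I. \<Sum>j'\<in>I. X i j * Q j j' * cnj (X i j'))
      = of_real (\<Sum>k\<in>K. \<Sum>l\<in>L. q l * (cmod (x k l))\<^sup>2)"
  proof -
    have "(\<Sum>i\<in>I. \<Sum>j\<in>I. \<Sum>j'\<in>I. X i j * Q j j' * cnj (X i j'))
        = (\<Sum>i\<in>I. \<Sum>l\<in>L. of_real (q l * (cmod (a l i))\<^sup>2))"
    proof (rule sum.cong[OF refl])
      fix i
      show "(\<Sum>j\<in>I. \<Sum>j'\<in>I. X i j * Q j j' * cnj (X i j')) = (\<Sum>l\<in>L. of_real (q l * (cmod (a l i))\<^sup>2))"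
        unfolding eigdec_form[OF eigbasis_eigdec[OF Q]] a_def of_real_mult complex_norm_square
            cnj_sum
        by (intro sum.cong refl) (simp add: mult_ac)
    qed
    also have "\<dots> = of_real (\<Sum>l\<in>L. q l * (\<Sum>i\<in>I. (cmod (cnj (a l i)))\<^sup>2))"
      by (subst sum.swap) (simp add: sum_distrib_left)
    also have "\<dots> = of_real (\<Sum>l\<in>L. q l * (\<Sum>k\<in>K. (cmod (cnj (x k l)))\<^sup>2))"
    proof -
      have "cnj (x k l) = (\<Sum>i\<in>I. cnj (a l i) * u k i)" for k l
        by (simp add: xa mult.commute)
      then show ?thesis using eigbasis_parseval_norm[OF P fin, of "\<lambda>i. cnj (a _ i)"] by simp
    qed
    also have "\<dots> = of_real (\<Sum>l\<in>L. \<Sum>k\<in>K. q l * (cmod (x k l))\<^sup>2)"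
      by (simp add: sum_distrib_left)
    finally show ?thesis by (subst sum.swap)
  qed
  define y where "y k l = cnj (x k l) * overlap I (u k) (v l)" for k l
  have "(\<Sum>i\<in>I. \<Sum>j\<in>I. cnj (X i j) * (Q i j - P i j)) = (\<Sum>k\<in>K. \<Sum>l\<in>L. of_real (q l - p k) * y k l)"
    using tQ tP by (simp add: y_def right_diff_distrib left_diff_distrib sum_subtractf)
  then have e: "Re (\<Sum>i\<in>I. \<Sum>j\<in>I. cnj (X i j) * (Q i j - P i j))
      = (\<Sum>k\<in>K. \<Sum>l\<in>L. (q l - p k) * Re (y k l))"
    by simp
  show ?thesis
    unfolding var_functional_def e sP sQ x_def[symmetric] y_def[symmetric] Re_complex_of_real
    by (simp add: sum_subtractf sum.distrib sum_distrib_left algebra_simps)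
qed

text \<open>For commuting operators this is the chi-square distance of \<open>p\<close> and
  \<open>q\<close> relative to the mixture \<open>(1 - s) * p + s * q\<close>. If the denominator is
  zero, division by zero drops the term.\<close>

definition chi_div ::
  "'i set \<Rightarrow> 'k set \<Rightarrow> ('k \<Rightarrow> 'i \<Rightarrow> complex) \<Rightarrow> ('k \<Rightarrow> real) \<Rightarrow>
    'l set \<Rightarrow> ('l \<Rightarrow> 'i \<Rightarrow> complex) \<Rightarrow> ('l \<Rightarrow> real) \<Rightarrow> real \<Rightarrow> real" where
  "chi_div I K u p L v q s = (\<Sum>k\<in>K. \<Sum>l\<in>L.
     (cmod (overlap I (u k) (v l)))\<^sup>2 * ((q l - p k)\<^sup>2 / ((1 - s) * p k + s * q l)))"

text \<open>Completing the square for each pair \<open>(k, l)\<close>. If the denominator vanishes,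
  both eigenvalues do, and so does the linear term.\<close>

lemma var_functional_le:
  assumes fin: "finite I" and P: "eigbasis I P K u p" and Q: "eigbasis I Q L v q"
    and p: "\<And>k. k \<in> K \<Longrightarrow> p k \<ge> 0" and q: "\<And>l. l \<in> L \<Longrightarrow> q l \<ge> 0" and s: "0 < s" "s < 1"
  shows "var_functional I s X P Q \<le> chi_div I K u p L v q s"
  unfolding var_functional_eigbasis[OF fin P Q] chi_div_def
proof (intro sum_mono)
  fix k l assume kl: "k \<in> K" "l \<in> L"
  define x where "x = mat_coeff I X (u k) (v l)"
  define z where "z = overlap I (u k) (v l)"
  define D where "D = (1 - s) * p k + s * q l"
  have D0: "D \<ge> 0" unfolding D_def using p q kl s by simp
  have "2 * (q l - p k) * Re (cnj x * z) \<le> 2 * (\<bar>q l - p k\<bar> * cmod z) * cmod x"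
  proof -
    have "(q l - p k) * Re (cnj x * z) \<le> \<bar>q l - p k\<bar> * \<bar>Re (cnj x * z)\<bar>"
      by (metis abs_ge_self abs_mult)
    also have "\<dots> \<le> \<bar>q l - p k\<bar> * (cmod z * cmod x)"
      using abs_Re_le_cmod[of "cnj x * z"]
          by (intro mult_left_mono) (auto simp: norm_mult mult.commute)
    finally have h: "(q l - p k) * Re (cnj x * z) \<le> \<bar>q l - p k\<bar> * (cmod z * cmod x)" .
    show ?thesis unfolding mult.assoc by (rule mult_left_mono[OF h]) simp
  qed
  moreover have "2 * (\<bar>q l - p k\<bar> * cmod z) * cmod x - D * (cmod x)\<^sup>2
      \<le> (cmod z)\<^sup>2 * ((q l - p k)\<^sup>2 / D)"
  proof (cases "D = 0")
    case True
    have "(1 - s) * p k \<ge> 0" "s * q l \<ge> 0" using p q kl s by auto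
    then have "p k = 0" "q l = 0" using True s unfolding D_def
      by (metis add_nonneg_eq_0_iff less_irrefl mult_eq_0_iff right_minus_eq)+
    then show ?thesis using True by simp
  next
    case False
    then have D: "D > 0" using D0 by simp
    have "0 \<le> (\<bar>q l - p k\<bar> * cmod z - D * cmod x)\<^sup>2 / D" using D by simp
    also have "\<dots> = (cmod z)\<^sup>2 * ((q l - p k)\<^sup>2 / D) - 2 * (\<bar>q l - p k\<bar> * cmod z) * cmod x + D
        * (cmod x)\<^sup>2"
      using D by (simp add: power2_diff power_mult_distrib divide_simps) (simp add: power2_eq_square
          algebra_simps)
    finally show ?thesis by simp
  qed
  ultimately show "2 * (q l - p k) * Re (cnj (mat_coeff I X (u k) (v l)) * overlap I (u k) (v l))
      - ((1 - s) * p k + s * q l) * (cmod (mat_coeff I X (u k) (v l)))\<^sup>2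
      \<le> (cmod (overlap I (u k) (v l)))\<^sup>2 * ((q l - p k)\<^sup>2 / ((1 - s) * p k + s * q l))"
    unfolding x_def[symmetric] z_def[symmetric] D_def[symmetric] by linarith
qed

text \<open>The maximiser of each scalar quadratic is \<open>(q l - p k) / D k l\<close> times the
  overlap, and \<open>X\<close> is assembled from these coefficients. Where
  \<open>D k l = 0\<close>, the coefficient is zero and both sides contribute nothing.\<close>

lemma var_functional_attained:
  assumes fin: "finite I" and P: "eigbasis I P K u p" and Q: "eigbasis I Q L v q"
  shows "\<exists>X. var_functional I s X P Q = chi_div I K u p L v q s"
proof -
  define D where "D k l = (1 - s) * p k + s * q l" for k l
  define c where "c k l = of_real ((q l - p k) / D k l) * overlap I (u k) (v l)" for k l
  define X where "X i j = (\<Sum>k\<in>K. \<Sum>l\<in>L. c k l * u k i * cnj (v l j))" for i j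
  have fK: "finite K" "finite L" using P Q by (auto simp: eigbasis_def eigdec_def)
  have ou: "(\<Sum>i\<in>I. cnj (u k i) * u k' i) = (if k = k' then 1 else 0)" if "k \<in> K" "k' \<in> K" for k k'
    using P that by (simp add: eigbasis_def eigdec_def orthonormal_family_def)
  have ov: "(\<Sum>j\<in>I. cnj (v l j) * v l' j) = (if l = l' then 1 else 0)" if "l \<in> L" "l' \<in> L" for l l'
    using Q that by (simp add: eigbasis_def eigdec_def orthonormal_family_def)
  have x: "mat_coeff I X (u k) (v l) = c k l" if kl: "k \<in> K" "l \<in> L" for k l
  proof -
    have "mat_coeff I X (u k) (v l)
        = (\<Sum>i\<in>I. \<Sum>j\<in>I. \<Sum>k'\<in>K. \<Sum>l'\<in>L. c k' l' * ((cnj (u k i) * u k' i) * (cnj (v l' j) * v l j)))"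
      by (simp add: mat_coeff_def X_def sum_distrib_left sum_distrib_right mult_ac)
    also have "\<dots> = (\<Sum>i\<in>I. \<Sum>k'\<in>K. \<Sum>j\<in>I. \<Sum>l'\<in>L. c k' l'
        * ((cnj (u k i) * u k' i) * (cnj (v l' j) * v l j)))"
      by (intro sum.cong refl sum.swap)
    also have "\<dots> = (\<Sum>k'\<in>K. \<Sum>i\<in>I. \<Sum>j\<in>I. \<Sum>l'\<in>L. c k' l'
        * ((cnj (u k i) * u k' i) * (cnj (v l' j) * v l j)))"
      by (rule sum.swap)
    also have "\<dots> = (\<Sum>k'\<in>K. \<Sum>i\<in>I. \<Sum>l'\<in>L. \<Sum>j\<in>I. c k' l'
        * ((cnj (u k i) * u k' i) * (cnj (v l' j) * v l j)))"
      by (intro sum.cong refl sum.swap)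
    also have "\<dots> = (\<Sum>k'\<in>K. \<Sum>l'\<in>L. \<Sum>i\<in>I. \<Sum>j\<in>I. c k' l'
        * ((cnj (u k i) * u k' i) * (cnj (v l' j) * v l j)))"
      by (intro sum.cong refl sum.swap)
    also have "\<dots> = (\<Sum>k'\<in>K. \<Sum>l'\<in>L. c k' l' * ((\<Sum>i\<in>I. cnj (u k i) * u k' i) *
        (\<Sum>j\<in>I. cnj (v l' j) * v l j)))"
      unfolding sum_product unfolding sum_distrib_left ..
    also have "\<dots> = (\<Sum>k'\<in>K. if k' = k then \<Sum>l'\<in>L. if l' = l then c k l else 0 else 0)"
      using ou ov kl by (intro sum.cong refl) (auto intro!: sum.cong)
    also have "\<dots> = c k l" using kl fK by simp
    finally show ?thesis .
  qed
  have "var_functional I s X P Q = chi_div I K u p L v q s"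
    unfolding var_functional_eigbasis[OF fin P Q] chi_div_def
  proof (intro sum.cong refl)
    fix k l assume kl: "k \<in> K" "l \<in> L"
    define z where "z = overlap I (u k) (v l)"
    have cz: "cnj z * z = of_real ((cmod z)\<^sup>2)" unfolding complex_norm_square by (rule mult.commute)
    have r1: "Re (cnj (c k l) * z) = (q l - p k) / D k l * (cmod z)\<^sup>2"
    proof -
      have "cnj (c k l) * z = of_real ((q l - p k) / D k l) * (cnj z * z)"
        by (simp add: c_def z_def)
      then show ?thesis unfolding cz by (simp flip: of_real_mult)
    qed
    have r2: "(cmod (c k l))\<^sup>2 = ((q l - p k) / D k l)\<^sup>2 * (cmod z)\<^sup>2"
      unfolding c_def z_def norm_mult norm_of_real power_mult_distrib power2_abs ..
    show "2 * (q l - p k) * Re (cnj (mat_coeff I X (u k) (v l)) * overlap I (u k) (v l))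
      - ((1 - s) * p k + s * q l) * (cmod (mat_coeff I X (u k) (v l)))\<^sup>2
      = (cmod (overlap I (u k) (v l)))\<^sup>2 * ((q l - p k)\<^sup>2 / ((1 - s) * p k + s * q l))"
      unfolding x[OF kl] z_def[symmetric] D_def[symmetric] r1 r2
      by (cases "D k l = 0") (simp_all add: field_simps power2_eq_square)
  qed
  then show ?thesis by blast
qed

section \<open>Relative entropy as an integral of chi-square divergences\<close>

text \<open>The integral is the remainder of the first-order Taylor expansion of
  \<open>x * ln x\<close> at \<open>q\<close>, evaluated at \<open>p\<close>, with the parameter
  running from \<open>p\<close> to \<open>q\<close>. The interval is open because for
  \<open>p = 0\<close> the integrand is the constant \<open>q\<close> except at
  \<open>s = 0\<close>.\<close>

lemma relative_entropy_integral:
  fixes p q :: real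
  assumes "p \<ge> 0" "q \<ge> 0" and supp: "q = 0 \<Longrightarrow> p = 0"
  shows "((\<lambda>s. s * ((q - p)\<^sup>2 / ((1 - s) * p + s * q))) has_integral (p * ln p - p * ln q + q
      - p)) {0<..<1}"
proof (cases "p = 0")
  case True
  have "((\<lambda>s::real. q) has_integral q) {0..1}" using has_integral_const_real[of q 0 1] by simp
  then have "((\<lambda>s::real. q) has_integral q) {0<..<1}" by (simp add: has_integral_Icc_iff_Ioo)
  then have "((\<lambda>s. s * ((q - p)\<^sup>2 / ((1 - s) * p + s * q))) has_integral q) {0<..<1}"
    by (rule has_integral_eq[rotated]) (simp add: True power2_eq_square)
  moreover have "p * ln p - p * ln q + q - p = q" using True by simp
  ultimately show ?thesis by (simp only:)
next
  case False
  then have p: "p > 0" and q: "q > 0" using assms by (auto simp: less_le)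
  define F where "F s = s * (q - p) - p * ln (p + s * (q - p))" for s
  have pos: "p + s * (q - p) > 0" if "s \<in> {0..1}" for s
  proof -
    have "p + s * (q - p) = (1 - s) * p + s * q" by (simp add: algebra_simps)
    moreover have "(1 - s) * p + s * q > 0"
    proof (cases "s = 0")
      case False
      then show ?thesis using that p q by (intro add_nonneg_pos) auto
    qed (use p in simp)
    ultimately show ?thesis by simp
  qed
  have "((\<lambda>s. s * ((q - p)\<^sup>2 / ((1 - s) * p + s * q))) has_integral (F 1 - F 0)) {0..1}"
  proof (rule fundamental_theorem_of_calculus)
    fix s :: real assume s: "s \<in> {0..1}"
    have "(F has_real_derivative ((q - p) - p * ((q - p) / (p + s * (q - p)))))
        (at s within {0..1})"
      unfolding F_def using pos[OF s] by (auto intro!: derivative_eq_intros)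
    moreover have "(q - p) - p * ((q - p) / (p + s * (q - p)))
        = s * ((q - p)\<^sup>2 / ((1 - s) * p + s * q))"
    proof -
      have e: "(1 - s) * p + s * q = p + s * (q - p)" by (simp add: algebra_simps)
      show ?thesis unfolding e using pos[OF s]
          by (simp add: divide_simps) (simp add: power2_eq_square algebra_simps)
    qed
    ultimately show "(F has_vector_derivative s * ((q - p)\<^sup>2 / ((1 - s) * p + s * q)))
        (at s within {0..1})"
      by (simp add: has_real_derivative_iff_has_vector_derivative)
  qed simp
  then show ?thesis by (simp add: F_def has_integral_Icc_iff_Ioo algebra_simps)
qed

text \<open>The trace of P ln P - P ln Q + Q - P, written in eigenbases of both operators.\<close>

definition rel_ent_sum ::
  "'i set \<Rightarrow> 'k set \<Rightarrow> ('k \<Rightarrow> 'i \<Rightarrow> complex) \<Rightarrow> ('k \<Rightarrow> real) \<Rightarrow>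
    'l set \<Rightarrow> ('l \<Rightarrow> 'i \<Rightarrow> complex) \<Rightarrow> ('l \<Rightarrow> real) \<Rightarrow> real" where
  "rel_ent_sum I K u p L v q = (\<Sum>k\<in>K. \<Sum>l\<in>L.
     (cmod (overlap I (u k) (v l)))\<^sup>2 * (p k * ln (p k) - p k * ln (q l) + q l - p k))"

text \<open>The condition on \<open>q l = 0\<close> is the inclusion of the support of the first
  operator in that of the second. Without it the relative entropy is infinite, whereas
  \<open>ln 0 = 0\<close> would yield a finite value.\<close>

lemma rel_ent_sum_integral:
  assumes "finite K" "finite L"
    and p: "\<And>k. k \<in> K \<Longrightarrow> p k \<ge> 0" and q: "\<And>l. l \<in> L \<Longrightarrow> q l \<ge> 0"
    and supp: "\<And>k l. k \<in> K \<Longrightarrow> l \<in> L \<Longrightarrow> q l = 0 \<Longrightarrow> p k = 0 \<or> overlap I (u k) (v l) = 0"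
  shows "((\<lambda>s. s * chi_div I K u p L v q s) has_integral rel_ent_sum I K u p L v q) {0<..<1}"
proof -
  have *: "(\<lambda>s. s * chi_div I K u p L v q s) = (\<lambda>s. \<Sum>k\<in>K. \<Sum>l\<in>L.
      (cmod (overlap I (u k) (v l)))\<^sup>2 * (s * ((q l - p k)\<^sup>2 / ((1 - s) * p k + s * q l))))"
    by (simp add: chi_div_def sum_distrib_left mult.left_commute)
  show ?thesis unfolding * rel_ent_sum_def
  proof (intro has_integral_sum assms(1,2))
    fix k l assume kl: "k \<in> K" "l \<in> L"
    show "((\<lambda>s. (cmod (overlap I (u k) (v l)))\<^sup>2
        * (s * ((q l - p k)\<^sup>2 / ((1 - s) * p k + s * q l)))) has_integral
        (cmod (overlap I (u k) (v l)))\<^sup>2 * (p k * ln (p k) - p k * ln (q l) + q l - p k)) {0<..<1}"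
    proof (cases "overlap I (u k) (v l) = 0")
      case False
      then show ?thesis
        using supp[OF kl] p[OF kl(1)] q[OF kl(2)]
        by (intro has_integral_mult_right relative_entropy_integral) auto
    qed simp
  qed
qed

text \<open>For each \<open>s\<close> the functional that is optimal for the sum splits linearly
  into its values at the two summands, and each of these is at most the corresponding divergence.
  The inequality is then integrated over \<open>s\<close>.\<close>

lemma rel_ent_sum_superadditive:
  assumes fin: "finite I"
    and P: "eigbasis I P K u p" and Q: "eigbasis I Q L v q"
    and P': "eigbasis I P' K' u' p'" and Q': "eigbasis I Q' L' v' q'"
    and R: "eigbasis I (\<lambda>i j. P i j + P' i j) K'' u'' p''"
    and S: "eigbasis I (\<lambda>i j. Q i j + Q' i j) L'' v'' q''"
    and psd: "psd_on I P" "psd_on I Q" "psd_on I P'" "psd_on I Q'"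
    and supp: "\<And>k l. k \<in> K \<Longrightarrow> l \<in> L \<Longrightarrow> q l = 0 \<Longrightarrow> p k = 0 \<or> overlap I (u k) (v l) = 0"
      "\<And>k l. k \<in> K' \<Longrightarrow> l \<in> L' \<Longrightarrow> q' l = 0 \<Longrightarrow> p' k = 0 \<or> overlap I (u' k) (v' l) = 0"
      "\<And>k l. k \<in> K'' \<Longrightarrow> l \<in> L'' \<Longrightarrow> q'' l = 0 \<Longrightarrow> p'' k = 0 \<or> overlap I (u'' k) (v'' l) = 0"
  shows "rel_ent_sum I K'' u'' p'' L'' v'' q'' \<le> rel_ent_sum I K u p L v q
      + rel_ent_sum I K' u' p' L' v' q'"
proof -
  note nn = eigdec_nonneg[OF eigbasis_eigdec]
  have psd'': "psd_on I (\<lambda>i j. P i j + P' i j)" "psd_on I (\<lambda>i j. Q i j + Q' i j)"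
    using psd by (auto intro: psd_on_add)
  have f: "finite K" "finite L" "finite K'" "finite L'" "finite K''" "finite L''"
    using P Q P' Q' R S by (auto simp: eigbasis_def eigdec_def)
  show ?thesis
  proof (rule has_integral_le)
    show "((\<lambda>s. s * chi_div I K'' u'' p'' L'' v'' q'' s) has_integral rel_ent_sum I K'' u'' p'' L''
        v'' q'') {0<..<1}"
      by (rule rel_ent_sum_integral[OF f(5,6) nn[OF R psd''(1)] nn[OF S psd''(2)] supp(3)])
    show "((\<lambda>s. s * chi_div I K u p L v q s + s * chi_div I K' u' p' L' v' q' s) has_integral
        rel_ent_sum I K u p L v q + rel_ent_sum I K' u' p' L' v' q') {0<..<1}"
      by (intro has_integral_add rel_ent_sum_integral[OF f(1,2) nn[OF P psd(1)] nn[OF Q psd(2)]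
          supp(1)]
          rel_ent_sum_integral[OF f(3,4) nn[OF P' psd(3)] nn[OF Q' psd(4)] supp(2)])
  next
    fix s :: real assume s: "s \<in> {0<..<1}"
    obtain X where X: "var_functional I s X (\<lambda>i j. P i j + P' i j) (\<lambda>i j. Q i j + Q' i j)
        = chi_div I K'' u'' p'' L'' v'' q'' s"
      using var_functional_attained[OF fin R S] by blast
    have "chi_div I K'' u'' p'' L'' v'' q'' s = var_functional I s X P Q
        + var_functional I s X P' Q'"
      unfolding X[symmetric] by (rule var_functional_add)
    also have "\<dots> \<le> chi_div I K u p L v q s + chi_div I K' u' p' L' v' q' s"
      using s by (intro add_mono var_functional_le[OF fin P Q nn[OF P psd(1)] nn[OF Q psd(2)]]
          var_functional_le[OF fin P' Q' nn[OF P' psd(3)] nn[OF Q' psd(4)]]) auto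
    finally have "chi_div I K'' u'' p'' L'' v'' q'' s \<le> chi_div I K u p L v q s
        + chi_div I K' u' p' L' v' q' s" .
    then show "s * chi_div I K'' u'' p'' L'' v'' q'' s
        \<le> s * chi_div I K u p L v q s + s * chi_div I K' u' p' L' v' q' s"
      using s mult_left_mono[of _ _ s] by (simp add: distrib_left[symmetric])
  qed
qed

section \<open>Conditional entropy as a relative entropy\<close>

definition trace_fst :: "'c set \<Rightarrow> ('c \<times> 'b \<Rightarrow> 'c \<times> 'b \<Rightarrow> complex) \<Rightarrow> 'b \<Rightarrow> 'b \<Rightarrow> complex" where
  "trace_fst C \<rho> b b' = (\<Sum>c\<in>C. \<rho> (c, b) (c, b'))"

definition cond_ent :: "'c set \<Rightarrow> 'b set \<Rightarrow> ('c \<times> 'b \<Rightarrow> 'c \<times> 'b \<Rightarrow> complex) \<Rightarrow> real" where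
  "cond_ent C B \<rho> = ent (C \<times> B) \<rho> - ent B (trace_fst C \<rho>)"

lemma psd_on_trace_fst:
  assumes "finite C" "finite B" "psd_on (C \<times> B) \<rho>"
  shows "psd_on B (trace_fst C \<rho>)"
  unfolding trace_fst_def
proof (rule psd_on_sum)
  fix c assume c: "c \<in> C"
  have "0 \<le> Re (\<Sum>i\<in>B. \<Sum>j\<in>B. cnj (v i) * \<rho> (c, i) (c, j) * v j)" for v
  proof -
    \<comment> \<open>Testing with a vector supported on the single value \<open>c\<close> isolates
      one diagonal block, and the partial trace is the sum of these blocks.\<close>
    define w where "w = (\<lambda>(c', b). if c' = c then v b else 0)"
    have "(\<Sum>x\<in>C \<times> B. \<Sum>y\<in>C \<times> B. cnj (w x) * \<rho> x y * w y)
        = (\<Sum>c1\<in>C. \<Sum>i\<in>B. \<Sum>c2\<in>C. \<Sum>j\<in>B. cnj (w (c1, i)) * \<rho> (c1, i) (c2, j) * w (c2, j))"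
      by (simp add: sum.cartesian_product')
    also have "\<dots> = (\<Sum>c1\<in>C. if c1 = c then (\<Sum>i\<in>B. \<Sum>c2\<in>C. if c2 = c
        then \<Sum>j\<in>B. cnj (v i) * \<rho> (c, i) (c, j) * v j else 0) else 0)"
      by (intro sum.cong refl) (auto simp: w_def intro!: sum.cong)
    also have "\<dots> = (\<Sum>i\<in>B. \<Sum>j\<in>B. cnj (v i) * \<rho> (c, i) (c, j) * v j)"
      using c assms by simp
    finally show ?thesis
      using assms(3)[unfolded psd_on_def, THEN conjunct2, rule_format, of w] by (simp only:)
  qed
  then show "psd_on B (\<lambda>b b'. \<rho> (c, b) (c, b'))"
    using assms(3) c by (auto simp: psd_on_def hermitian_on_def)
qed

text \<open>The identity on the first register tensored with \<open>\<sigma>\<close>. With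
  \<open>\<sigma>\<close> the marginal of a state, it is the reference operator for the conditional
  entropy.\<close>

definition lift_snd :: "('b \<Rightarrow> 'b \<Rightarrow> complex) \<Rightarrow> 'c \<times> 'b \<Rightarrow> 'c \<times> 'b \<Rightarrow> complex" where
  "lift_snd \<sigma> = (\<lambda>(c, b) (c', b'). if c = c' then \<sigma> b b' else 0)"

lemma psd_on_lift_snd:
  assumes "finite C" "finite B" "psd_on B \<sigma>"
  shows "psd_on (C \<times> B) (lift_snd \<sigma>)"
  unfolding psd_on_def
proof (intro conjI allI)
  show "hermitian_on (C \<times> B) (lift_snd \<sigma>)"
    using assms by (auto simp: psd_on_def hermitian_on_def lift_snd_def)
  fix v :: "_ \<Rightarrow> complex"
  have "(\<Sum>x\<in>C \<times> B. \<Sum>y\<in>C \<times> B. cnj (v x) * lift_snd \<sigma> x y * v y)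
      = (\<Sum>c\<in>C. \<Sum>b\<in>B. \<Sum>c'\<in>C. \<Sum>b'\<in>B. cnj (v (c, b)) * lift_snd \<sigma> (c, b) (c', b') * v (c', b'))"
    by (simp add: sum.cartesian_product')
  also have "\<dots> = (\<Sum>c\<in>C. \<Sum>b\<in>B. \<Sum>c'\<in>C. if c' = c then \<Sum>b'\<in>B. cnj (v (c, b)) * \<sigma> b b' * v (c, b')
      else 0)"
    by (intro sum.cong refl) (auto simp: lift_snd_def intro!: sum.cong)
  also have "\<dots> = (\<Sum>c\<in>C. \<Sum>b\<in>B. \<Sum>b'\<in>B. cnj (v (c, b)) * \<sigma> b b' * v (c, b'))"
    using assms by simp
  finally have e: "(\<Sum>x\<in>C \<times> B. \<Sum>y\<in>C \<times> B. cnj (v x) * lift_snd \<sigma> x y * v y)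
      = (\<Sum>c\<in>C. \<Sum>b\<in>B. \<Sum>b'\<in>B. cnj (v (c, b)) * \<sigma> b b' * v (c, b'))" .
  have "0 \<le> Re (\<Sum>b\<in>B. \<Sum>b'\<in>B. cnj (v (c, b)) * \<sigma> b b' * v (c, b'))" for c
    using assms(3)[unfolded psd_on_def, THEN conjunct2, rule_format, of "\<lambda>b. v (c, b)"] .
  then show "0 \<le> Re (\<Sum>x\<in>C \<times> B. \<Sum>y\<in>C \<times> B. cnj (v x) * lift_snd \<sigma> x y * v y)"
    unfolding e by (subst Re_sum) (rule sum_nonneg)
qed

definition lift_basis :: "'c \<times> 'l \<Rightarrow> ('l \<Rightarrow> 'b \<Rightarrow> complex) \<Rightarrow> 'c \<times> 'b \<Rightarrow> complex" where
  "lift_basis = (\<lambda>(c, l) v (c', b). if c = c' then v l b else 0)"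

lemma sum_lift_basis:
  fixes f :: "'c \<times> 'b \<Rightarrow> complex"
  assumes "finite C" "c \<in> C"
  shows "(\<Sum>x\<in>C \<times> B. f x * lift_basis (c, l) v x) = (\<Sum>b\<in>B. f (c, b) * v l b)"
    and "(\<Sum>x\<in>C \<times> B. f x * cnj (lift_basis (c, l) v x)) = (\<Sum>b\<in>B. f (c, b) * cnj (v l b))"
proof -
  have "(\<Sum>x\<in>C \<times> B. f x * lift_basis (c, l) v x)
      = (\<Sum>c'\<in>C. \<Sum>b\<in>B. f (c', b) * lift_basis (c, l) v (c', b))"
    by (simp add: sum.cartesian_product')
  also have "\<dots> = (\<Sum>c'\<in>C. if c' = c then \<Sum>b\<in>B. f (c, b) * v l b else 0)"
    by (intro sum.cong refl) (auto simp: lift_basis_def)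
  finally show "(\<Sum>x\<in>C \<times> B. f x * lift_basis (c, l) v x) = (\<Sum>b\<in>B. f (c, b) * v l b)"
    using assms by simp
  have "(\<Sum>x\<in>C \<times> B. f x * cnj (lift_basis (c, l) v x))
      = (\<Sum>c'\<in>C. \<Sum>b\<in>B. f (c', b) * cnj (lift_basis (c, l) v (c', b)))"
    by (simp add: sum.cartesian_product')
  also have "\<dots> = (\<Sum>c'\<in>C. if c' = c then \<Sum>b\<in>B. f (c, b) * cnj (v l b) else 0)"
    by (intro sum.cong refl) (auto simp: lift_basis_def)
  finally show "(\<Sum>x\<in>C \<times> B. f x * cnj (lift_basis (c, l) v x)) = (\<Sum>b\<in>B. f (c, b) * cnj (v l b))"
    using assms by simp
qed

lemma eigbasis_lift_snd:
  assumes fin: "finite C" "finite B" and b: "eigbasis B \<sigma> L v q"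
  shows "eigbasis (C \<times> B) (lift_snd \<sigma>) (C \<times> L) (\<lambda>x. lift_basis x v) (\<lambda>(c, l). q l)"
proof -
  have fL: "finite L" using b by (simp add: eigbasis_def eigdec_def)
  have on: "(\<Sum>b\<in>B. cnj (v l b) * v l' b) = (if l = l' then 1 else 0)" if "l \<in> L" "l' \<in> L" for l l'
    using b that by (simp add: eigbasis_def eigdec_def orthonormal_family_def)
  have co: "(\<Sum>l\<in>L. v l b * cnj (v l b')) = (if b = b' then 1 else 0)" if "b \<in> B" "b' \<in> B" for b b'
    using b that by (simp add: eigbasis_def)
  have de: "\<sigma> b b' = (\<Sum>l\<in>L. of_real (q l) * v l b * cnj (v l b'))" if "b \<in> B" "b' \<in> B" for b b'
    using b that by (simp add: eigbasis_def eigdec_def)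
  have S: "(\<Sum>x\<in>C \<times> L. g x * lift_basis x v (c, b) * cnj (lift_basis x v (c', b')))
      = (if c = c' then \<Sum>l\<in>L. g (c, l) * v l b * cnj (v l b') else 0)" if "c \<in> C" for g c c' b b'
  proof -
    have "(\<Sum>x\<in>C \<times> L. g x * lift_basis x v (c, b) * cnj (lift_basis x v (c', b')))
        = (\<Sum>d\<in>C. \<Sum>l\<in>L. g (d, l) * lift_basis (d, l) v (c, b) * cnj (lift_basis (d, l) v (c', b')))"
      by (simp add: sum.cartesian_product')
    also have "\<dots> = (\<Sum>d\<in>C. if d = c then (if c = c' then \<Sum>l\<in>L. g (c, l) * v l b * cnj (v l b')
        else 0) else 0)"
      by (intro sum.cong refl) (auto simp: lift_basis_def)
    finally show ?thesis using that fin by simp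
  qed
  show ?thesis
    unfolding eigbasis_def eigdec_def orthonormal_family_def
  proof (intro conjI ballI)
    show "finite (C \<times> L)" using fin fL by simp
  next
    fix x y assume xy: "x \<in> C \<times> L" "y \<in> C \<times> L"
    obtain c l c' l' where e: "x = (c, l)" "y = (c', l')" by (metis surj_pair)
    have "(\<Sum>z\<in>C \<times> B. cnj (lift_basis x v z) * lift_basis y v z)
        = (\<Sum>b\<in>B. cnj (lift_basis x v (c', b)) * v l' b)"
      using xy e fin by (simp add: sum_lift_basis(1))
    also have "\<dots> = (if c = c' then \<Sum>b\<in>B. cnj (v l b) * v l' b else 0)"
      by (simp add: e lift_basis_def)
    also have "\<dots> = (if x = y then 1 else 0)"
      using on xy unfolding e by auto
    finally show "(\<Sum>z\<in>C \<times> B. cnj (lift_basis x v z) * lift_basis y v z) = (if x = y then 1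
        else 0)" .
  next
    fix x y assume xy: "x \<in> C \<times> B" "y \<in> C \<times> B"
    obtain c b c' b' where e: "x = (c, b)" "y = (c', b')" by (metis surj_pair)
    show "lift_snd \<sigma> x y = (\<Sum>k\<in>C \<times> L. of_real (case k of (c, l) \<Rightarrow> q l) * lift_basis k v x
        * cnj (lift_basis k v y))"
      using xy de unfolding e by (subst S) (auto simp: lift_snd_def)
    show "(\<Sum>k\<in>C \<times> L. lift_basis k v x * cnj (lift_basis k v y)) = (if x = y then 1 else 0)"
      using xy co S[of c "\<lambda>_. 1"] unfolding e by auto
  qed
qed

text \<open>The conditional entropy is minus the relative entropy with respect to
  \<open>lift_snd\<close> of the marginal. The factor \<open>ln 2\<close> converts from bits, and
  the trace term arises because lifting multiplies the trace by \<open>card C\<close>. The second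
  claim is the support condition, which always holds for a state and its own lifted
  marginal.\<close>

lemma cond_ent_eq_rel_ent:
  assumes fin: "finite C" "finite B" and \<rho>: "psd_on (C \<times> B) \<rho>"
    and P: "eigbasis (C \<times> B) \<rho> K u p" and Q: "eigbasis B (trace_fst C \<rho>) L v q"
  shows "rel_ent_sum (C \<times> B) K u p (C \<times> L) (\<lambda>x. lift_basis x v) (\<lambda>(c, l). q l)
      = - ln 2 * cond_ent C B \<rho> + (real (card C) - 1) * Re (\<Sum>i\<in>C \<times> B. \<rho> i i)"
    and "\<And>k x. k \<in> K \<Longrightarrow> x \<in> C \<times> L \<Longrightarrow> (case x of (c, l) \<Rightarrow> q l) = 0 \<Longrightarrow>
      p k = 0 \<or> overlap (C \<times> B) (u k) (lift_basis x v) = 0"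
proof -
  define z where "z k x = (cmod (overlap (C \<times> B) (u k) (lift_basis x v)))\<^sup>2" for k x
  have fI: "finite (C \<times> B)" using fin by simp
  have fKL: "finite K" "finite L" using P Q by (auto simp: eigbasis_def eigdec_def)
  note QL = eigbasis_lift_snd[OF fin Q]
  have p0: "p k \<ge> 0" if "k \<in> K" for k using eigdec_nonneg[OF eigbasis_eigdec[OF P] \<rho> that] .
  have nu: "(\<Sum>i\<in>C \<times> B. (cmod (u k i))\<^sup>2) = 1" if "k \<in> K" for k
  proof -
    have "complex_of_real (\<Sum>i\<in>C \<times> B. (cmod (u k i))\<^sup>2) = (\<Sum>i\<in>C \<times> B. cnj (u k i) * u k i)"
      unfolding of_real_sum complex_norm_square by (simp add: mult.commute)
    also have "\<dots> = of_real 1"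
      by (subst eigbasis_orthonormal[OF P that that]) simp
    finally show ?thesis by (simp only: of_real_eq_iff)
  qed
  have nv: "(\<Sum>i\<in>C \<times> B. (cmod (lift_basis x v i))\<^sup>2) = 1" if "x \<in> C \<times> L" for x
  proof -
    have "complex_of_real (\<Sum>i\<in>C \<times> B. (cmod (lift_basis x v i))\<^sup>2)
        = (\<Sum>i\<in>C \<times> B. cnj (lift_basis x v i) * lift_basis x v i)"
      unfolding of_real_sum complex_norm_square by (simp add: mult.commute)
    also have "\<dots> = of_real 1"
      by (subst eigbasis_orthonormal[OF QL that that]) simp
    finally show ?thesis by (simp only: of_real_eq_iff)
  qed
  have za: "(\<Sum>x\<in>C \<times> L. z k x) = 1" if "k \<in> K" for k
    using eigbasis_parseval_norm[OF QL fI, of "\<lambda>i. cnj (u k i)"] nu[OF that]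
        by (simp add: z_def overlap_def)
  have zb: "(\<Sum>k\<in>K. z k x) = 1" if "x \<in> C \<times> L" for x
  proof -
    have "z k x = (cmod (\<Sum>i\<in>C \<times> B. cnj (lift_basis x v i) * u k i))\<^sup>2" for k
    proof -
      have "(\<Sum>i\<in>C \<times> B. cnj (lift_basis x v i) * u k i)
          = cnj (overlap (C \<times> B) (u k) (lift_basis x v))"
        by (simp add: overlap_def cnj_sum mult.commute)
      then show ?thesis by (simp add: z_def)
    qed
    then show ?thesis
      using eigbasis_parseval_norm[OF P fI, of "\<lambda>i. cnj (lift_basis x v i)"] nv[OF that] by simp
  qed
  \<comment> \<open>Both sides are the expectation of the projector on \<open>v l\<close>, on the
    left taken in the joint state and on the right in the marginal.\<close>
  have zq: "(\<Sum>c\<in>C. \<Sum>k\<in>K. p k * z k (c, l)) = q l" if l: "l \<in> L" for l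
  proof -
    have *: "complex_of_real (\<Sum>k\<in>K. p k * z k (c, l)) = (\<Sum>b\<in>B. \<Sum>b'\<in>B. cnj (v l b) * \<rho> (c, b) (c, b')
        * v l b')"
      if c: "c \<in> C" for c
    proof -
      have "complex_of_real (\<Sum>k\<in>K. p k * z k (c, l))
          = (\<Sum>k\<in>K. of_real (p k) * (\<Sum>i\<in>C \<times> B. cnj (lift_basis (c, l) v i) * u k i)
              * (\<Sum>j\<in>C \<times> B. cnj (u k j) * lift_basis (c, l) v j))"
        unfolding z_def of_real_sum of_real_mult complex_norm_square overlap_def cnj_sum
        by (intro sum.cong refl) (simp add: mult_ac)
      also have "\<dots> = (\<Sum>i\<in>C \<times> B. \<Sum>j\<in>C \<times> B. cnj (lift_basis (c, l) v i) * \<rho> i j * lift_basis (c,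
          l) v j)"
        unfolding eigdec_form[OF eigbasis_eigdec[OF P]] ..
      also have "\<dots> = (\<Sum>i\<in>C \<times> B. (\<Sum>b'\<in>B. \<rho> i (c, b') * v l b') * cnj (lift_basis (c, l) v i))"
        using c fin by (intro sum.cong refl, subst sum_lift_basis(1))
          (simp_all add: sum_distrib_left sum_distrib_right mult_ac)
      also have "\<dots> = (\<Sum>b\<in>B. \<Sum>b'\<in>B. cnj (v l b) * \<rho> (c, b) (c, b') * v l b')"
        using c fin by (subst sum_lift_basis(2)) (simp_all add: sum_distrib_left sum_distrib_right
            mult_ac)
      finally show ?thesis .
    qed
    have "complex_of_real (\<Sum>c\<in>C. \<Sum>k\<in>K. p k * z k (c, l))
        = (\<Sum>c\<in>C. \<Sum>b\<in>B. \<Sum>b'\<in>B. cnj (v l b) * \<rho> (c, b) (c, b') * v l b')"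
      unfolding of_real_sum[of _ C] using * by (intro sum.cong refl) blast
    also have "\<dots> = (\<Sum>b\<in>B. \<Sum>c\<in>C. \<Sum>b'\<in>B. cnj (v l b) * \<rho> (c, b) (c, b') * v l b')"
      by (rule sum.swap)
    also have "\<dots> = (\<Sum>b\<in>B. \<Sum>b'\<in>B. cnj (v l b) * trace_fst C \<rho> b b' * v l b')"
      unfolding trace_fst_def sum_distrib_left sum_distrib_right by (intro sum.cong refl sum.swap)
    also have "\<dots> = of_real (q l)"
      using eigdec_eigenvalue[OF eigbasis_eigdec[OF Q] l l] by simp
    finally show ?thesis by (simp only: of_real_eq_iff)
  qed
  show "p k = 0 \<or> overlap (C \<times> B) (u k) (lift_basis x v) = 0"
    if kx: "k \<in> K" "x \<in> C \<times> L" "(case x of (c, l) \<Rightarrow> q l) = 0" for k x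
  proof -
    obtain c l where x: "x = (c, l)" "c \<in> C" "l \<in> L" using kx by auto
    have zp: "0 \<le> p k * z k y" if "k \<in> K" for k y using p0[OF that] by (simp add: z_def)
    \<comment> \<open>A vanishing \<open>q l\<close> is a sum of nonnegative terms, each of which
      must vanish.\<close>
    have "(\<Sum>c\<in>C. \<Sum>k\<in>K. p k * z k (c, l)) = 0" using zq x kx by simp
    then have "(\<Sum>k\<in>K. p k * z k (c, l)) = 0"
      using fin x zp by (subst (asm) sum_nonneg_eq_0_iff) (auto intro!: sum_nonneg)
    then have "p k * z k (c, l) = 0"
      using fKL kx zp by (subst (asm) sum_nonneg_eq_0_iff) auto
    then show ?thesis using x by (simp add: z_def)
  qed
  have eP: "ent (C \<times> B) \<rho> = - (\<Sum>k\<in>K. p k * log 2 (p k))"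
    by (rule ent_eigdec[OF fI eigbasis_eigdec[OF P]])
  have eQ: "ent B (trace_fst C \<rho>) = - (\<Sum>l\<in>L. q l * log 2 (q l))"
    by (rule ent_eigdec[OF fin(2) eigbasis_eigdec[OF Q]])
  have tP: "(\<Sum>k\<in>K. p k) = Re (\<Sum>i\<in>C \<times> B. \<rho> i i)"
    using eigdec_trace[OF eigbasis_eigdec[OF P]] by simp
  have tQ: "(\<Sum>l\<in>L. q l) = Re (\<Sum>i\<in>C \<times> B. \<rho> i i)"
  proof -
    have "complex_of_real (\<Sum>l\<in>L. q l) = (\<Sum>b\<in>B. \<Sum>c\<in>C. \<rho> (c, b) (c, b))"
      using eigdec_trace[OF eigbasis_eigdec[OF Q]] by (simp add: trace_fst_def)
    also have "\<dots> = (\<Sum>i\<in>C \<times> B. \<rho> i i)"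
      by (subst sum.swap) (simp add: sum.cartesian_product')
    finally show ?thesis by (metis Re_complex_of_real)
  qed
  have "rel_ent_sum (C \<times> B) K u p (C \<times> L) (\<lambda>x. lift_basis x v) (\<lambda>(c, l). q l)
      = (\<Sum>k\<in>K. \<Sum>x\<in>C \<times> L. p k * ln (p k) * z k x) - (\<Sum>k\<in>K. \<Sum>x\<in>C \<times> L. p k * z k x * ln (q (snd x)))
        + (\<Sum>k\<in>K. \<Sum>x\<in>C \<times> L. q (snd x) * z k x) - (\<Sum>k\<in>K. \<Sum>x\<in>C \<times> L. p k * z k x)"
    unfolding rel_ent_sum_def z_def[symmetric] sum_subtractf[symmetric] sum.distrib[symmetric]
    by (intro sum.cong refl) (simp add: split_def algebra_simps)
  also have "(\<Sum>k\<in>K. \<Sum>x\<in>C \<times> L. p k * ln (p k) * z k x) = (\<Sum>k\<in>K. p k * ln (p k))"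
    unfolding sum_distrib_left[symmetric] by (intro sum.cong refl) (simp add: za)
  also have "(\<Sum>k\<in>K. \<Sum>x\<in>C \<times> L. p k * z k x) = (\<Sum>k\<in>K. p k)"
    unfolding sum_distrib_left[symmetric] by (intro sum.cong refl) (simp add: za)
  also have "(\<Sum>k\<in>K. \<Sum>x\<in>C \<times> L. q (snd x) * z k x) = (\<Sum>x\<in>C \<times> L. q (snd x))"
    by (subst sum.swap) (simp add: sum_distrib_left[symmetric] zb)
  also have "(\<Sum>x\<in>C \<times> L. q (snd x)) = real (card C) * (\<Sum>l\<in>L. q l)"
    by (simp add: sum.cartesian_product')
  also have "(\<Sum>k\<in>K. \<Sum>x\<in>C \<times> L. p k * z k x * ln (q (snd x))) = (\<Sum>l\<in>L. q l * ln (q l))"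
  proof -
    have "(\<Sum>k\<in>K. \<Sum>x\<in>C \<times> L. p k * z k x * ln (q (snd x)))
        = (\<Sum>c\<in>C. \<Sum>l\<in>L. \<Sum>k\<in>K. p k * z k (c, l) * ln (q l))"
      by (subst sum.swap) (simp add: sum.cartesian_product')
    also have "\<dots> = (\<Sum>l\<in>L. \<Sum>c\<in>C. \<Sum>k\<in>K. p k * z k (c, l) * ln (q l))"
      by (rule sum.swap)
    also have "\<dots> = (\<Sum>l\<in>L. q l * ln (q l))"
      unfolding sum_distrib_right[symmetric] by (intro sum.cong refl) (simp add: zq)
    finally show ?thesis .
  qed
  finally show "rel_ent_sum (C \<times> B) K u p (C \<times> L) (\<lambda>x. lift_basis x v) (\<lambda>(c, l). q l)
      = - ln 2 * cond_ent C B \<rho> + (real (card C) - 1) * Re (\<Sum>i\<in>C \<times> B. \<rho> i i)"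
    unfolding tP tQ cond_ent_def eP eQ
    by (simp add: log_def sum_divide_distrib[symmetric] algebra_simps)
qed

text \<open>Strong subadditivity, as concavity of the conditional entropy of unnormalised states.\<close>

theorem cond_ent_superadditive:
  assumes fin: "finite C" "finite B" and psd: "psd_on (C \<times> B) \<rho>" "psd_on (C \<times> B) \<rho>'"
  shows "cond_ent C B \<rho> + cond_ent C B \<rho>' \<le> cond_ent C B (\<lambda>i j. \<rho> i j + \<rho>' i j)"
proof -
  let ?\<rho> = "\<lambda>i j. \<rho> i j + \<rho>' i j"
  have psd'': "psd_on (C \<times> B) ?\<rho>" using psd by (rule psd_on_add)
  have ex: "\<exists>u p v q. eigbasis (C \<times> B) \<sigma> {..<card (C \<times> B)} u p
      \<and> eigbasis B (trace_fst C \<sigma>) {..<card B} v q"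
    if "psd_on (C \<times> B) \<sigma>" for \<sigma>
    using eigbasis_exists[of "C \<times> B" \<sigma>] eigbasis_exists[of B "trace_fst C \<sigma>"] that fin
      psd_on_hermitian[OF psd_on_trace_fst[OF fin that]] psd_on_hermitian[OF that] by blast
  obtain u p v q where a: "eigbasis (C \<times> B) \<rho> {..<card (C \<times> B)} u p"
      "eigbasis B (trace_fst C \<rho>) {..<card B} v q"
    using ex[OF psd(1)] by blast
  obtain u' p' v' q' where b: "eigbasis (C \<times> B) \<rho>' {..<card (C \<times> B)} u' p'"
      "eigbasis B (trace_fst C \<rho>') {..<card B} v' q'"
    using ex[OF psd(2)] by blast
  obtain u'' p'' v'' q''
      where c: "eigbasis (C \<times> B) ?\<rho> {..<card (C \<times> B)} u'' p''"
      "eigbasis B (trace_fst C ?\<rho>) {..<card B} v'' q''"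
    using ex[OF psd''] by blast
  \<comment> \<open>Marginal and lift are linear, so the reference operator of the sum is the sum of
    the reference operators; this makes the joint inequality for pairs \<open>(P, Q)\<close>
    applicable.\<close>
  have l: "lift_snd (trace_fst C ?\<rho>)
      = (\<lambda>i j. lift_snd (trace_fst C \<rho>) i j + lift_snd (trace_fst C \<rho>') i j :: complex)"
    by (auto simp: lift_snd_def trace_fst_def sum.distrib fun_eq_iff)
  note A = cond_ent_eq_rel_ent[OF fin psd(1) a]
  note B = cond_ent_eq_rel_ent[OF fin psd(2) b]
  note C = cond_ent_eq_rel_ent[OF fin psd'' c]
  have "- ln 2 * cond_ent C B ?\<rho> + (real (card C) - 1) * Re (\<Sum>i\<in>C \<times> B. ?\<rho> i i)
      \<le> (- ln 2 * cond_ent C B \<rho> + (real (card C) - 1) * Re (\<Sum>i\<in>C \<times> B. \<rho> i i))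
        + (- ln 2 * cond_ent C B \<rho>' + (real (card C) - 1) * Re (\<Sum>i\<in>C \<times> B. \<rho>' i i))"
    unfolding A(1)[symmetric] B(1)[symmetric] C(1)[symmetric]
    by (rule rel_ent_sum_superadditive[OF _ a(1) eigbasis_lift_snd[OF fin a(2)] b(1)
        eigbasis_lift_snd[OF fin b(2)]
          c(1) eigbasis_lift_snd[OF fin c(2), unfolded l] psd(1) psd_on_lift_snd[OF fin
              psd_on_trace_fst[OF fin psd(1)]]
          psd(2) psd_on_lift_snd[OF fin psd_on_trace_fst[OF fin psd(2)]] A(2) B(2) C(2)])
              (use fin in auto)
  \<comment> \<open>The trace terms are additive and cancel from the inequality.\<close>
  moreover have "Re (\<Sum>i\<in>C \<times> B. ?\<rho> i i) = Re (\<Sum>i\<in>C \<times> B. \<rho> i i) + Re (\<Sum>i\<in>C \<times> B. \<rho>' i i)"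
    by (simp add: sum.distrib)
  ultimately have "ln 2 * (cond_ent C B \<rho> + cond_ent C B \<rho>') \<le> ln 2 * cond_ent C B ?\<rho>"
    by (simp only: distrib_left)
  then show ?thesis by simp
qed

subsection \<open>Conditional mutual information of pure states\<close>

lemma enc_less: "i < m \<Longrightarrow> j < n \<Longrightarrow> i * n + j < m * (n :: nat)"
proof -
  assume "i < m" "j < n"
  then have "i * n + j < Suc i * n" by simp
  also have "\<dots> \<le> m * n" using \<open>i < m\<close> by (intro mult_le_mono1) simp
  finally show ?thesis .
qed

lemma enc_inject: "j < n \<Longrightarrow> j' < n \<Longrightarrow> i * n + j = i' * n + j' \<longleftrightarrow> i = i' \<and> j = (j' :: nat)"
  by (metis add_diff_cancel_left' div_mult_self3 div_less mod_less mod_mult_self3 add.right_neutral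
      less_nat_zero_code)

lemma bij_betw_enc:
  fixes m n :: nat
  assumes f: "bij_betw f I {..<m}" and g: "bij_betw g J {..<n}"
  shows "bij_betw (\<lambda>(i, j). f i * n + g j) (I \<times> J) {..<m * n}"
proof -
  have fi: "f i < m" if "i \<in> I" for i using f that by (auto simp: bij_betw_def)
  have gj: "g j < n" if "j \<in> J" for j using g that by (auto simp: bij_betw_def)
  have "inj_on (\<lambda>(i, j). f i * n + g j) (I \<times> J)"
    using f g gj by (auto simp: inj_on_def bij_betw_def enc_inject)
  moreover have "k \<in> (\<lambda>(i, j). f i * n + g j) ` (I \<times> J)" if k: "k < m * n" for k
  proof -
    have "n > 0" using k by (cases n) auto
    then have "k div n \<in> f ` I" "k mod n \<in> g ` J"
      using k f g by (auto simp: bij_betw_def less_mult_imp_div_less)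
    then obtain i j where "i \<in> I" "k div n = f i" "j \<in> J" "k mod n = g j" by auto
    then have "k = (\<lambda>(i, j). f i * n + g j) (i, j)" "(i, j) \<in> I \<times> J"
      using div_mult_mod_eq[of k n] by auto
    then show ?thesis by (rule image_eqI)
  qed
  ultimately show ?thesis
    using fi gj by (auto simp: bij_betw_def enc_less)
qed

lemma bij_betw_id_nat: "bij_betw (\<lambda>i. i) {..<n} {..<n :: nat}"
  by (simp add: bij_betw_def)

lemma sum_enc:
  fixes m n :: nat and f :: "nat \<Rightarrow> 'a :: comm_monoid_add"
  shows "(\<Sum>k<m * n. f k) = (\<Sum>i<m. \<Sum>j<n. f (i * n + j))"
proof -
  have "(\<Sum>k<m * n. f k) = (\<Sum>x\<in>{..<m} \<times> {..<n}. f (case x of (i, j) \<Rightarrow> i * n + j))"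
    using sum.reindex_bij_betw[OF bij_betw_enc[OF bij_betw_id_nat bij_betw_id_nat, where m = m and n
        = n], of f] by simp
  then show ?thesis by (simp add: sum.cartesian_product')
qed

lemma ptrace_enc:
  assumes "i1 < d1" "j1 < d1" "i3 < d3" "j3 < d3"
  shows "ptrace d1 d2 d3 \<rho> $$ (i1 * d3 + i3, j1 * d3 + j3)
    = (\<Sum>k<d2. \<rho> $$ ((i1 * d2 + k) * d3 + i3, (j1 * d2 + k) * d3 + j3))"
  using assms by (simp add: ptrace_def enc_less)

lemma ptrace_carrier [simp]: "ptrace d1 d2 d3 \<rho> \<in> carrier_mat (d1 * d3) (d1 * d3)"
  by (simp add: ptrace_def)

lemma kron_carrier [intro]:
  "A \<in> carrier_mat m n \<Longrightarrow> B \<in> carrier_mat m' n' \<Longrightarrow> kron A B \<in> carrier_mat (m * m') (n * n')"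
  by (simp add: kron_def)

lemma kron_enc:
  assumes "A \<in> carrier_mat m n" "B \<in> carrier_mat m' n'" "i < m" "j < n" "i' < m'" "j' < n'"
  shows "kron A B $$ (i * m' + i', j * n' + j') = A $$ (i, j) * B $$ (i', j')"
  using assms by (simp add: kron_def enc_less)

section \<open>Marginals of a pure state of reference, Alice, message and Bob\<close>

definition state_CB :: "'z set \<Rightarrow> nat \<Rightarrow> ('z \<Rightarrow> nat \<Rightarrow> nat \<Rightarrow> nat \<Rightarrow> complex) \<Rightarrow> nat \<times> nat \<Rightarrow> nat \<times> nat
    \<Rightarrow> complex" where
  "state_CB Z dA \<psi> = (\<lambda>(c, b) (c', b'). \<Sum>z\<in>Z. \<Sum>a<dA. \<psi> z a c b * cnj (\<psi> z a c' b'))"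

text \<open>The message comes first, although the joint register is ordered with Alice first, so
  that \<open>trace_fst\<close> removes it here just as in \<open>state_CB\<close>.\<close>

definition state_CA :: "'z set \<Rightarrow> nat \<Rightarrow> ('z \<Rightarrow> nat \<Rightarrow> nat \<Rightarrow> nat \<Rightarrow> complex) \<Rightarrow> nat \<times> nat \<Rightarrow> nat \<times> nat
    \<Rightarrow> complex" where
  "state_CA Z dB \<psi> = (\<lambda>(c, a) (c', a'). \<Sum>z\<in>Z. \<Sum>b<dB. \<psi> z a c b * cnj (\<psi> z a' c' b))"

text \<open>The reference is indexed by an abstract set \<open>Z\<close> with enumeration
  \<open>rz\<close>, since it will be the set of input pairs. Purity is expressed entrywise, and
  \<open>\<psi>\<close> need not have norm 1.\<close>

locale tripartite_state =
  fixes Z :: "'z set" and rz :: "'z \<Rightarrow> nat" and r dA dC dB :: nat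
    and \<psi> :: "'z \<Rightarrow> nat \<Rightarrow> nat \<Rightarrow> nat \<Rightarrow> complex" and \<rho> :: "complex mat"
  assumes rz: "bij_betw rz Z {..<r}"
    and \<rho>: "\<And>z a c b z' a' c' b'. z \<in> Z \<Longrightarrow> a < dA \<Longrightarrow> c < dC \<Longrightarrow> b < dB \<Longrightarrow>
      z' \<in> Z \<Longrightarrow> a' < dA \<Longrightarrow> c' < dC \<Longrightarrow> b' < dB \<Longrightarrow>
      \<rho> $$ (((rz z * dA + a) * dC + c) * dB + b, ((rz z' * dA + a') * dC + c') * dB + b')
        = \<psi> z a c b * cnj (\<psi> z' a' c' b')"
    and \<rho>_carrier: "\<rho> \<in> carrier_mat (r * dA * dC * dB) (r * dA * dC * dB)"
begin

lemma fin: "finite Z" using rz bij_betw_finite by blast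

lemma rz_less: "z \<in> Z \<Longrightarrow> rz z < r" using rz by (auto simp: bij_betw_def)

lemma sum_rz: "(\<Sum>k<r. f k) = (\<Sum>z\<in>Z. f (rz z))" for f :: "nat \<Rightarrow> complex"
  using sum.reindex_bij_betw[OF rz, of f] by simp

lemma ent_B:
  assumes M: "M \<in> carrier_mat dB dB"
    and Me: "\<And>b b'. b < dB \<Longrightarrow> b' < dB
        \<Longrightarrow> M $$ (b, b') = (\<Sum>z\<in>Z. \<Sum>a<dA. \<Sum>c<dC. \<psi> z a c b * cnj (\<psi> z a c b'))"
  shows "vn_entropy M = ent {..<dB} (trace_fst {..<dC} (state_CB Z dA \<psi>))"
proof (rule vn_entropy_eq_ent)
  have t: "trace_fst {..<dC} (state_CB Z dA \<psi>) b b'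
      = (\<Sum>z\<in>Z. \<Sum>a<dA. \<Sum>c<dC. \<psi> z a c b * cnj (\<psi> z a c b'))" for b b'
    unfolding trace_fst_def state_CB_def
    by (simp, subst sum.swap, intro sum.cong refl sum.swap)
  show "mat_represents dB M {..<dB} (\<lambda>i. i) (trace_fst {..<dC} (state_CB Z dA \<psi>))"
    using M Me by (auto simp: mat_represents_def bij_betw_id_nat t)
  show "hermitian_on {..<dB} (trace_fst {..<dC} (state_CB Z dA \<psi>))"
    unfolding hermitian_on_def t by (simp add: mult.commute)
qed

lemma ent_A:
  assumes M: "M \<in> carrier_mat dA dA"
    and Me: "\<And>a a'. a < dA \<Longrightarrow> a' < dA
        \<Longrightarrow> M $$ (a, a') = (\<Sum>z\<in>Z. \<Sum>c<dC. \<Sum>b<dB. \<psi> z a c b * cnj (\<psi> z a' c b))"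
  shows "vn_entropy M = ent {..<dA} (trace_fst {..<dC} (state_CA Z dB \<psi>))"
proof (rule vn_entropy_eq_ent)
  have t: "trace_fst {..<dC} (state_CA Z dB \<psi>) a a'
      = (\<Sum>z\<in>Z. \<Sum>c<dC. \<Sum>b<dB. \<psi> z a c b * cnj (\<psi> z a' c b))" for a a'
    unfolding trace_fst_def state_CA_def by (simp, rule sum.swap)
  show "mat_represents dA M {..<dA} (\<lambda>i. i) (trace_fst {..<dC} (state_CA Z dB \<psi>))"
    using M Me by (auto simp: mat_represents_def bij_betw_id_nat t)
  show "hermitian_on {..<dA} (trace_fst {..<dC} (state_CA Z dB \<psi>))"
    unfolding hermitian_on_def t by (simp add: mult.commute)
qed

lemma ent_CB:
  assumes M: "M \<in> carrier_mat (dC * dB) (dC * dB)"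
    and Me: "\<And>c b c' b'. c < dC \<Longrightarrow> b < dB \<Longrightarrow> c' < dC \<Longrightarrow> b' < dB \<Longrightarrow>
      M $$ (c * dB + b, c' * dB + b') = (\<Sum>z\<in>Z. \<Sum>a<dA. \<psi> z a c b * cnj (\<psi> z a c' b'))"
  shows "vn_entropy M = ent ({..<dC} \<times> {..<dB}) (state_CB Z dA \<psi>)"
proof (rule vn_entropy_eq_ent)
  show "mat_represents (dC * dB) M ({..<dC} \<times> {..<dB}) (\<lambda>(i, j). i * dB + j) (state_CB Z dA \<psi>)"
    using M Me by (auto simp: mat_represents_def state_CB_def intro!: bij_betw_enc bij_betw_id_nat)
  show "hermitian_on ({..<dC} \<times> {..<dB}) (state_CB Z dA \<psi>)"
    by (auto simp: hermitian_on_def state_CB_def mult.commute)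
qed

lemma ent_CA:
  assumes M: "M \<in> carrier_mat (dA * dC) (dA * dC)"
    and Me: "\<And>a c a' c'. a < dA \<Longrightarrow> c < dC \<Longrightarrow> a' < dA \<Longrightarrow> c' < dC \<Longrightarrow>
      M $$ (a * dC + c, a' * dC + c') = (\<Sum>z\<in>Z. \<Sum>b<dB. \<psi> z a c b * cnj (\<psi> z a' c' b))"
  shows "vn_entropy M = ent ({..<dC} \<times> {..<dA}) (state_CA Z dB \<psi>)"
proof (rule vn_entropy_eq_ent)
  have "bij_betw ((\<lambda>(i, j). i * dC + j) \<circ> prod.swap) ({..<dC} \<times> {..<dA}) {..<dA * dC}"
  proof (rule bij_betw_trans)
    show "bij_betw prod.swap ({..<dC} \<times> {..<dA}) ({..<dA} \<times> {..<dC})"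
      by (rule bij_betw_byWitness[where f' = prod.swap]) auto
  qed (intro bij_betw_enc bij_betw_id_nat)
  then show "mat_represents (dA * dC) M ({..<dC} \<times> {..<dA}) (\<lambda>(c, a). a * dC + c) (state_CA Z dB \<psi>)"
    using M Me by (auto simp: mat_represents_def state_CA_def comp_def split_def)
  show "hermitian_on ({..<dC} \<times> {..<dA}) (state_CA Z dB \<psi>)"
    by (auto simp: hermitian_on_def state_CA_def mult.commute)
qed

text \<open>Complementary registers of a pure state have equal entropy. Here and in the lemmas that
  follow, this trades a register containing the reference for the remaining ones: RB for CA, RA for
  CB, RCB for A and RAC for B.\<close>

lemma ent_RB:
  assumes M: "M \<in> carrier_mat (r * dB) (r * dB)"
    and Me: "\<And>z b z' b'. z \<in> Z \<Longrightarrow> b < dB \<Longrightarrow> z' \<in> Z \<Longrightarrow> b' < dB \<Longrightarrow>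
      M $$ (rz z * dB + b, rz z' * dB + b') = (\<Sum>c<dC. \<Sum>a<dA. \<psi> z a c b * cnj (\<psi> z' a c b'))"
  shows "vn_entropy M = ent ({..<dC} \<times> {..<dA}) (state_CA Z dB \<psi>)"
proof -
  let ?\<phi> = "\<lambda>(z, b) (c, a). \<psi> z a c b"
  have "vn_entropy M = ent (Z \<times> {..<dB}) (gram ({..<dC} \<times> {..<dA}) ?\<phi>)"
  proof (rule vn_entropy_eq_ent)
    show "mat_represents (r * dB) M (Z \<times> {..<dB}) (\<lambda>(i, j). rz i * dB
        + j) (gram ({..<dC} \<times> {..<dA}) ?\<phi>)"
      using M Me rz by (auto simp: mat_represents_def gram_def sum.cartesian_product'
          intro!: bij_betw_enc bij_betw_id_nat)
  qed simp
  also have "\<dots> = ent ({..<dC} \<times> {..<dA}) (gram (Z \<times> {..<dB}) (\<lambda>e i. ?\<phi> i e))"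
    using fin by (intro ent_gram_transpose) auto
  also have "\<dots> = ent ({..<dC} \<times> {..<dA}) (state_CA Z dB \<psi>)"
    by (rule ent_cong) (auto simp: gram_def state_CA_def sum.cartesian_product')
  finally show ?thesis .
qed

lemma ent_RA:
  assumes M: "M \<in> carrier_mat (r * dA) (r * dA)"
    and Me: "\<And>z a z' a'. z \<in> Z \<Longrightarrow> a < dA \<Longrightarrow> z' \<in> Z \<Longrightarrow> a' < dA \<Longrightarrow>
      M $$ (rz z * dA + a, rz z' * dA + a') = (\<Sum>c<dC. \<Sum>b<dB. \<psi> z a c b * cnj (\<psi> z' a' c b))"
  shows "vn_entropy M = ent ({..<dC} \<times> {..<dB}) (state_CB Z dA \<psi>)"
proof -
  let ?\<phi> = "\<lambda>(z, a) (c, b). \<psi> z a c b"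
  have "vn_entropy M = ent (Z \<times> {..<dA}) (gram ({..<dC} \<times> {..<dB}) ?\<phi>)"
  proof (rule vn_entropy_eq_ent)
    show "mat_represents (r * dA) M (Z \<times> {..<dA}) (\<lambda>(i, j). rz i * dA
        + j) (gram ({..<dC} \<times> {..<dB}) ?\<phi>)"
      using M Me rz by (auto simp: mat_represents_def gram_def sum.cartesian_product'
          intro!: bij_betw_enc bij_betw_id_nat)
  qed simp
  also have "\<dots> = ent ({..<dC} \<times> {..<dB}) (gram (Z \<times> {..<dA}) (\<lambda>e i. ?\<phi> i e))"
    using fin by (intro ent_gram_transpose) auto
  also have "\<dots> = ent ({..<dC} \<times> {..<dB}) (state_CB Z dA \<psi>)"
    by (rule ent_cong) (auto simp: gram_def state_CB_def sum.cartesian_product')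
  finally show ?thesis .
qed

lemma ent_RCB:
  assumes M: "M \<in> carrier_mat (r * (dC * dB)) (r * (dC * dB))"
    and Me: "\<And>z c b z' c' b'. z \<in> Z \<Longrightarrow> c < dC \<Longrightarrow> b < dB \<Longrightarrow> z' \<in> Z \<Longrightarrow> c' < dC \<Longrightarrow> b' < dB \<Longrightarrow>
      M $$ (rz z * (dC * dB) + (c * dB + b), rz z' * (dC * dB) + (c' * dB + b')) =
          (\<Sum>a<dA. \<psi> z a c b * cnj (\<psi> z' a c' b'))"
  shows "vn_entropy M = ent {..<dA} (trace_fst {..<dC} (state_CA Z dB \<psi>))"
proof -
  let ?\<phi> = "\<lambda>(z, c, b) a. \<psi> z a c b"
  have "vn_entropy M = ent (Z \<times> ({..<dC} \<times> {..<dB})) (gram {..<dA} ?\<phi>)"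
  proof (rule vn_entropy_eq_ent)
    have "bij_betw (\<lambda>(z, cb). rz z * (dC * dB) + (case cb of (c, b)
        \<Rightarrow> c * dB + b)) (Z \<times> ({..<dC} \<times> {..<dB})) {..<r * (dC * dB)}"
      using rz by (intro bij_betw_enc bij_betw_id_nat)
    then show "mat_represents (r * (dC * dB)) M (Z \<times> ({..<dC} \<times> {..<dB})) (\<lambda>(z, c, b). rz z
        * (dC * dB) + (c * dB + b)) (gram {..<dA} ?\<phi>)"
      using M Me by (auto simp: mat_represents_def gram_def split_def)
  qed simp
  also have "\<dots> = ent {..<dA} (gram (Z \<times> ({..<dC} \<times> {..<dB})) (\<lambda>e i. ?\<phi> i e))"
    using fin by (intro ent_gram_transpose) auto
  also have "\<dots> = ent {..<dA} (trace_fst {..<dC} (state_CA Z dB \<psi>))"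
  proof (rule ent_cong)
    fix i j
    show "gram (Z \<times> ({..<dC} \<times> {..<dB})) (\<lambda>e i. ?\<phi> i e) i j
        = trace_fst {..<dC} (state_CA Z dB \<psi>) i j"
      unfolding gram_def state_CA_def trace_fst_def
      by (simp add: sum.cartesian_product', rule sum.swap)
  qed auto
  finally show ?thesis .
qed

lemma ent_RAC:
  assumes M: "M \<in> carrier_mat (r * dA * dC) (r * dA * dC)"
    and Me: "\<And>z a c z' a' c'. z \<in> Z \<Longrightarrow> a < dA \<Longrightarrow> c < dC \<Longrightarrow> z' \<in> Z \<Longrightarrow> a' < dA \<Longrightarrow> c' < dC \<Longrightarrow>
      M $$ ((rz z * dA + a) * dC + c, (rz z' * dA + a') * dC + c') = (\<Sum>b<dB. \<psi> z a c b * cnj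
          (\<psi> z' a' c' b))"
  shows "vn_entropy M = ent {..<dB} (trace_fst {..<dC} (state_CB Z dA \<psi>))"
proof -
  let ?\<phi> = "\<lambda>((z, a), c) b. \<psi> z a c b"
  have "vn_entropy M = ent ((Z \<times> {..<dA}) \<times> {..<dC}) (gram {..<dB} ?\<phi>)"
  proof (rule vn_entropy_eq_ent)
    have "bij_betw (\<lambda>(za, c). (case za of (z, a) \<Rightarrow> rz z * dA + a) * dC
        + c) ((Z \<times> {..<dA}) \<times> {..<dC}) {..<r * dA * dC}"
      using rz by (intro bij_betw_enc bij_betw_id_nat)
    then show "mat_represents (r * dA * dC) M ((Z \<times> {..<dA}) \<times> {..<dC}) (\<lambda>((z, a), c). (rz z * dA
        + a) * dC + c) (gram {..<dB} ?\<phi>)"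
      using M Me by (auto simp: mat_represents_def gram_def split_def)
  qed simp
  also have "\<dots> = ent {..<dB} (gram ((Z \<times> {..<dA}) \<times> {..<dC}) (\<lambda>e i. ?\<phi> i e))"
    using fin by (intro ent_gram_transpose) auto
  also have "\<dots> = ent {..<dB} (trace_fst {..<dC} (state_CB Z dA \<psi>))"
  proof (rule ent_cong)
    fix i j
    have "gram ((Z \<times> {..<dA}) \<times> {..<dC}) (\<lambda>e i. ?\<phi> i e) i j
        = (\<Sum>z\<in>Z. \<Sum>a<dA. \<Sum>c<dC. \<psi> z a c i * cnj (\<psi> z a c j))"
      unfolding gram_def by (simp add: sum.cartesian_product')
    also have "\<dots> = trace_fst {..<dC} (state_CB Z dA \<psi>) i j"
      unfolding state_CB_def trace_fst_def
      by (simp, subst (2) sum.swap, intro sum.cong refl sum.swap)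
    finally show "gram ((Z \<times> {..<dA}) \<times> {..<dC}) (\<lambda>e i. ?\<phi> i e) i j
        = trace_fst {..<dC} (state_CB Z dA \<psi>) i j" .
  qed auto
  finally show ?thesis .
qed

text \<open>In S(RB) + S(CB) - S(B) - S(RCB) the terms with the reference become S(CA) and S(A) by
  purity.\<close>

lemma cmi_last_eq:
  "cmi_last r dC dB (ptrace r dA (dC * dB) \<rho>)
    = cond_ent {..<dC} {..<dB} (state_CB Z dA \<psi>) + cond_ent {..<dC} {..<dA} (state_CA Z dB \<psi>)"
proof -
  define \<sigma> where "\<sigma> = ptrace r dA (dC * dB) \<rho>"
  have \<sigma>: "\<sigma> $$ (rz z * (dC * dB) + (c * dB + b), rz z' * (dC * dB) + (c' * dB + b'))
      = (\<Sum>a<dA. \<psi> z a c b * cnj (\<psi> z' a c' b'))"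
    if h: "z \<in> Z" "c < dC" "b < dB" "z' \<in> Z" "c' < dC" "b' < dB" for z c b z' c' b'
  proof -
    have "\<sigma> $$ (rz z * (dC * dB) + (c * dB + b), rz z' * (dC * dB) + (c' * dB + b'))
        = (\<Sum>a<dA. \<rho> $$ ((rz z * dA + a) * (dC * dB) + (c * dB + b), (rz z' * dA + a) * (dC * dB) +
            (c' * dB + b')))"
      unfolding \<sigma>_def using h by (intro ptrace_enc rz_less enc_less) auto
    also have "\<dots> = (\<Sum>a<dA. \<psi> z a c b * cnj (\<psi> z' a c' b'))"
      using \<rho> h by (intro sum.cong refl) (simp add: distrib_right mult.assoc add.assoc)
    finally show ?thesis .
  qed
  \<comment> \<open>The same entries under the other bracketing of the flattened index, needed when
    the message is the factor traced out.\<close>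
  have \<sigma>': "\<sigma> $$ ((rz z * dC + c) * dB + b, (rz z' * dC + c') * dB + b')
      = (\<Sum>a<dA. \<psi> z a c b * cnj (\<psi> z' a c' b'))"
    if h: "z \<in> Z" "c < dC" "b < dB" "z' \<in> Z" "c' < dC" "b' < dB" for z c b z' c' b'
    using \<sigma>[OF h] by (simp add: distrib_right mult.assoc add.assoc)
  have "vn_entropy \<sigma> = ent {..<dA} (trace_fst {..<dC} (state_CA Z dB \<psi>))"
    by (rule ent_RCB) (use \<sigma> in \<open>auto simp: \<sigma>_def\<close>)
  moreover have "vn_entropy (ptrace r dC dB \<sigma>) = ent ({..<dC} \<times> {..<dA}) (state_CA Z dB \<psi>)"
  proof (rule ent_RB[OF ptrace_carrier])
    fix z b z' b' assume h: "z \<in> Z" "b < dB" "z' \<in> Z" "b' < dB"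
    show "ptrace r dC dB \<sigma> $$ (rz z * dB + b, rz z' * dB + b')
        = (\<Sum>c<dC. \<Sum>a<dA. \<psi> z a c b * cnj (\<psi> z' a c b'))"
      using h \<sigma>' by (simp add: ptrace_enc rz_less)
  qed
  moreover have "vn_entropy (ptrace 1 r (dC * dB) \<sigma>) = ent ({..<dC} \<times> {..<dB}) (state_CB Z dA \<psi>)"
  proof (rule ent_CB)
    show "ptrace 1 r (dC * dB) \<sigma> \<in> carrier_mat (dC * dB) (dC * dB)"
      using ptrace_carrier[of 1 r "dC * dB" \<sigma>] by simp
    fix c b c' b' assume h: "c < dC" "b < dB" "c' < dC" "b' < dB"
    have "ptrace 1 r (dC * dB) \<sigma> $$ (0 * (dC * dB) + (c * dB + b), 0 * (dC * dB) + (c' * dB + b'))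
        = (\<Sum>k<r. \<sigma> $$ ((0 * r + k) * (dC * dB) + (c * dB + b), (0 * r + k) * (dC * dB) +
            (c' * dB + b')))"
      using h by (intro ptrace_enc enc_less) auto
    then show "ptrace 1 r (dC * dB) \<sigma> $$ (c * dB + b, c' * dB + b')
        = (\<Sum>z\<in>Z. \<Sum>a<dA. \<psi> z a c b * cnj (\<psi> z a c' b'))"
      using h \<sigma> by (simp add: sum_rz)
  qed
  moreover have "vn_entropy (ptrace 1 (r * dC) dB \<sigma>)
      = ent {..<dB} (trace_fst {..<dC} (state_CB Z dA \<psi>))"
  proof (rule ent_B)
    show "ptrace 1 (r * dC) dB \<sigma> \<in> carrier_mat dB dB"
      using ptrace_carrier[of 1 "r * dC" dB \<sigma>] by simp
    fix b b' assume h: "b < dB" "b' < dB"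
    have "ptrace 1 (r * dC) dB \<sigma> $$ (0 * dB + b, 0 * dB + b')
        = (\<Sum>k<r * dC. \<sigma> $$ ((0 * (r * dC) + k) * dB + b, (0 * (r * dC) + k) * dB + b'))"
      using h by (intro ptrace_enc) auto
    then have "ptrace 1 (r * dC) dB \<sigma> $$ (b, b')
        = (\<Sum>z\<in>Z. \<Sum>c<dC. \<Sum>a<dA. \<psi> z a c b * cnj (\<psi> z a c b'))"
      using h \<sigma>' by (simp add: sum_enc sum_rz)
    also have "\<dots> = (\<Sum>z\<in>Z. \<Sum>a<dA. \<Sum>c<dC. \<psi> z a c b * cnj (\<psi> z a c b'))"
      by (intro sum.cong refl sum.swap)
    finally show "ptrace 1 (r * dC) dB \<sigma> $$ (b, b') = \<dots>" .
  qed
  ultimately show ?thesis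
    unfolding cmi_last_def cond_ent_def \<sigma>_def[symmetric] by simp
qed

text \<open>Now S(RA) becomes S(CB) and S(RAC) becomes S(B), which gives the same value as for the
  rounds of the other party. Odd and even rounds need no distinction from here on.\<close>

lemma cmi_mid_eq:
  "cmi_mid r dA dC (ptrace (r * dA * dC) dB 1 \<rho>)
    = cond_ent {..<dC} {..<dB} (state_CB Z dA \<psi>) + cond_ent {..<dC} {..<dA} (state_CA Z dB \<psi>)"
proof -
  define \<sigma> where "\<sigma> = ptrace (r * dA * dC) dB 1 \<rho>"
  have \<sigma>: "\<sigma> $$ ((rz z * dA + a) * dC + c, (rz z' * dA + a') * dC + c')
      = (\<Sum>b<dB. \<psi> z a c b * cnj (\<psi> z' a' c' b))"
    if h: "z \<in> Z" "a < dA" "c < dC" "z' \<in> Z" "a' < dA" "c' < dC" for z a c z' a' c'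
  proof -
    have "ptrace (r * dA * dC) dB 1 \<rho> $$ (((rz z * dA + a) * dC + c) * 1
        + 0, ((rz z' * dA + a') * dC + c') * 1 + 0)
        = (\<Sum>b<dB. \<rho> $$ ((((rz z * dA + a) * dC + c) * dB + b) * 1 + 0,
            (((rz z' * dA + a') * dC + c') * dB + b) * 1 + 0))"
      using h by (intro ptrace_enc enc_less rz_less) auto
    then show ?thesis using \<rho> h by (simp add: \<sigma>_def)
  qed
  have \<sigma>': "\<sigma> $$ (rz z * (dA * dC) + (a * dC + c), rz z' * (dA * dC) + (a' * dC + c'))
      = (\<Sum>b<dB. \<psi> z a c b * cnj (\<psi> z' a' c' b))"
    if h: "z \<in> Z" "a < dA" "c < dC" "z' \<in> Z" "a' < dA" "c' < dC" for z a c z' a' c'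
    using \<sigma>[OF h] by (simp add: distrib_right mult.assoc add.assoc)
  have \<tau>: "ptrace (r * dA) dC 1 \<sigma> $$ (rz z * dA + a, rz z' * dA + a')
      = (\<Sum>c<dC. \<Sum>b<dB. \<psi> z a c b * cnj (\<psi> z' a' c b))"
    if h: "z \<in> Z" "a < dA" "z' \<in> Z" "a' < dA" for z a z' a'
  proof -
    have "ptrace (r * dA) dC 1 \<sigma> $$ ((rz z * dA + a) * 1 + 0, (rz z' * dA + a') * 1 + 0)
        = (\<Sum>c<dC. \<sigma> $$ (((rz z * dA + a) * dC + c) * 1 + 0, ((rz z' * dA + a') * dC + c) * 1 + 0))"
      using h by (intro ptrace_enc enc_less rz_less) auto
    then show ?thesis using h \<sigma> by simp
  qed
  have "vn_entropy \<sigma> = ent {..<dB} (trace_fst {..<dC} (state_CB Z dA \<psi>))"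
  proof (rule ent_RAC)
    show "\<sigma> \<in> carrier_mat (r * dA * dC) (r * dA * dC)"
      using ptrace_carrier[of "r * dA * dC" dB 1 \<rho>] by (simp add: \<sigma>_def)
  qed (use \<sigma> in auto)
  moreover have "vn_entropy (ptrace (r * dA) dC 1 \<sigma>) = ent ({..<dC} \<times> {..<dB}) (state_CB Z dA \<psi>)"
  proof (rule ent_RA)
    show "ptrace (r * dA) dC 1 \<sigma> \<in> carrier_mat (r * dA) (r * dA)"
      using ptrace_carrier[of "r * dA" dC 1 \<sigma>] by simp
  qed (use \<tau> in auto)
  moreover have "vn_entropy (ptrace 1 r (dA * dC) \<sigma>) = ent ({..<dC} \<times> {..<dA}) (state_CA Z dB \<psi>)"
  proof (rule ent_CA)
    show "ptrace 1 r (dA * dC) \<sigma> \<in> carrier_mat (dA * dC) (dA * dC)"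
      using ptrace_carrier[of 1 r "dA * dC" \<sigma>] by simp
    fix a c a' c' assume h: "a < dA" "c < dC" "a' < dA" "c' < dC"
    have "ptrace 1 r (dA * dC) \<sigma> $$ (0 * (dA * dC) + (a * dC + c), 0 * (dA * dC) + (a' * dC + c'))
        = (\<Sum>k<r. \<sigma> $$ ((0 * r + k) * (dA * dC) + (a * dC + c), (0 * r + k) * (dA * dC) +
            (a' * dC + c')))"
      using h by (intro ptrace_enc enc_less) auto
    then show "ptrace 1 r (dA * dC) \<sigma> $$ (a * dC + c, a' * dC + c')
        = (\<Sum>z\<in>Z. \<Sum>b<dB. \<psi> z a c b * cnj (\<psi> z a' c' b))"
      using h \<sigma>' by (simp add: sum_rz)
  qed
  moreover have "vn_entropy (ptrace 1 r dA (ptrace (r * dA) dC 1 \<sigma>))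
      = ent {..<dA} (trace_fst {..<dC} (state_CA Z dB \<psi>))"
  proof (rule ent_A)
    show "ptrace 1 r dA (ptrace (r * dA) dC 1 \<sigma>) \<in> carrier_mat dA dA"
      using ptrace_carrier[of 1 r dA] by simp
    fix a a' assume h: "a < dA" "a' < dA"
    have "ptrace 1 r dA (ptrace (r * dA) dC 1 \<sigma>) $$ (0 * dA + a, 0 * dA + a')
        = (\<Sum>k<r. ptrace (r * dA) dC 1 \<sigma> $$ ((0 * r + k) * dA + a, (0 * r + k) * dA + a'))"
      using h by (intro ptrace_enc) auto
    then show "ptrace 1 r dA (ptrace (r * dA) dC 1 \<sigma>) $$ (a, a')
        = (\<Sum>z\<in>Z. \<Sum>c<dC. \<Sum>b<dB. \<psi> z a c b * cnj (\<psi> z a' c b))"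
      using h \<tau> by (simp add: sum_rz)
  qed
  ultimately show ?thesis
    unfolding cmi_mid_def cond_ent_def \<sigma>_def[symmetric] by simp
qed

end

subsection \<open>Information cost as a function of the input weights\<close>

lemma mat_adjoint_carrier: "A \<in> carrier_mat m n \<Longrightarrow> mat_adjoint A \<in> carrier_mat n m"
  for A :: "complex mat"
  by (auto simp: mat_adjoint_def)

lemma mat_adjoint_index:
  "A \<in> carrier_mat m n \<Longrightarrow> i < n \<Longrightarrow> j < m \<Longrightarrow> mat_adjoint A $$ (i, j) = cnj (A $$ (j, i))"
  for A :: "complex mat"
  by (simp add: mat_adjoint_def mat_of_rows_def)

lemma isometry_carrier: "isometry m n V \<Longrightarrow> V \<in> carrier_mat n m"
  by (simp add: isometry_def)

lemma mult_mat_index: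
  "A \<in> carrier_mat m n \<Longrightarrow> B \<in> carrier_mat n l \<Longrightarrow> i < m \<Longrightarrow> j < l \<Longrightarrow>
    (A * B) $$ (i, j) = (\<Sum>k<n. A $$ (i, k) * B $$ (k, j))"
  by (simp add: scalar_prod_def lessThan_atLeast0)

abbreviation dim_ACB :: "('x, 'y, 'za, 'zb) protocol \<Rightarrow> nat \<Rightarrow> nat" where
  "dim_ACB P i \<equiv> dim_A P i * dim_C P i * dim_B P i"

lemma initial_state_carrier:
  fixes P :: "('x::finite, 'y::finite, 'za::finite, 'zb::finite) protocol"
  assumes "valid_protocol P"
  shows "initial_state P x y \<in> carrier_mat (dim_ACB P 0) 1"
proof -
  have "kron (kron (basis_ket x) (1\<^sub>m (dim_TA P))) (kron (basis_ket y) (1\<^sub>m (dim_TB P)))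
      \<in> carrier_mat (CARD('x) * dim_TA P * (CARD('y) * dim_TB P)) (1 * dim_TA P * (1 * dim_TB P))"
    by (intro kron_carrier) (auto simp: basis_ket_def)
  moreover have "shared P \<in> carrier_mat (dim_TA P * dim_TB P) 1"
    using assms by (auto simp: valid_protocol_def intro: isometry_carrier)
  ultimately show ?thesis
    using assms by (simp add: initial_state_def valid_protocol_def)
qed

lemma round_iso_carrier:
  fixes P :: "('x::finite, 'y::finite, 'za::finite, 'zb::finite) protocol"
  assumes "valid_protocol P" "i < rounds P"
  shows "odd (Suc i) \<Longrightarrow> dim_B P (Suc i) = dim_B P i \<and>
      isometry (dim_A P i * dim_C P i) (dim_A P (Suc i) * dim_C P (Suc i)) (round_iso P (Suc i))"
    and "even (Suc i) \<Longrightarrow> dim_A P (Suc i) = dim_A P i \<and>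
      isometry (dim_C P i * dim_B P i) (dim_C P (Suc i) * dim_B P (Suc i)) (round_iso P (Suc i))"
  using assms by (auto simp: valid_protocol_def dest!: bspec[of _ _ "Suc i"])

lemma run_carrier:
  fixes P :: "('x::finite, 'y::finite, 'za::finite, 'zb::finite) protocol"
  assumes v: "valid_protocol P"
  shows "i \<le> rounds P \<Longrightarrow> run P i \<in> carrier_mat (dim_ACB P i) (dim_ACB P 0)"
proof (induction i)
  case (Suc i)
  then have IH: "run P i \<in> carrier_mat (dim_ACB P i) (dim_ACB P 0)" and i: "i < rounds P" by auto
  show ?case
  proof (cases "odd (Suc i)")
    case True
    note r = round_iso_carrier(1)[OF v i True]
    have "kron (round_iso P (Suc i)) (1\<^sub>m (dim_B P i))
        \<in> carrier_mat (dim_ACB P (Suc i)) (dim_ACB P i)"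
      using r by (simp add: kron_carrier isometry_carrier)
    then show ?thesis using True IH by simp
  next
    case False
    note r = round_iso_carrier(2)[OF v i] 
    have "kron (1\<^sub>m (dim_A P i)) (round_iso P (Suc i))
        \<in> carrier_mat (dim_A P i * (dim_C P (Suc i) * dim_B P (Suc i)))
            (dim_A P i * (dim_C P i * dim_B P i))"
      using r False by (intro kron_carrier) (auto intro: isometry_carrier)
    then show ?thesis using False IH r by (simp add: mult.assoc)
  qed
qed simp

definition input_run :: "('x::finite, 'y::finite, 'za::finite, 'zb::finite) protocol \<Rightarrow> nat \<Rightarrow> 'x \<times> 'y
    \<Rightarrow> complex mat" where
  "input_run P i z = run P i * initial_state P (fst z) (snd z)"

lemma input_run_carrier:
  assumes v: "valid_protocol P" and "i \<le> rounds P"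
  shows "input_run P i z \<in> carrier_mat (dim_ACB P i) 1"
  unfolding input_run_def using run_carrier[OF assms] initial_state_carrier[OF v] by simp

definition amp :: "('x::finite, 'y::finite, 'za::finite, 'zb::finite) protocol \<Rightarrow> nat \<Rightarrow> 'x \<times> 'y \<Rightarrow> nat
    \<Rightarrow> nat \<Rightarrow> nat \<Rightarrow> complex" where
  "amp P i z a c b = input_run P i z $$ ((a * dim_C P i + c) * dim_B P i + b, 0)"

definition wstate_CB :: "('x::finite, 'y::finite, 'za::finite, 'zb::finite) protocol \<Rightarrow> nat
    \<Rightarrow> ('x \<times> 'y \<Rightarrow> real) \<Rightarrow>
    nat \<times> nat \<Rightarrow> nat \<times> nat \<Rightarrow> complex" where
  "wstate_CB P i w = (\<lambda>(c, b) (c', b').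
     \<Sum>z\<in>UNIV. of_real (w z) * (\<Sum>a<dim_A P i. amp P i z a c b * cnj (amp P i z a c' b')))"

definition wstate_CA :: "('x::finite, 'y::finite, 'za::finite, 'zb::finite) protocol \<Rightarrow> nat
    \<Rightarrow> ('x \<times> 'y \<Rightarrow> real) \<Rightarrow>
    nat \<times> nat \<Rightarrow> nat \<times> nat \<Rightarrow> complex" where
  "wstate_CA P i w = (\<lambda>(c, a) (c', a').
     \<Sum>z\<in>UNIV. of_real (w z) * (\<Sum>b<dim_B P i. amp P i z a c b * cnj (amp P i z a' c' b)))"

text \<open>Since the state on \<open>R \<otimes> A \<otimes> C \<otimes> B\<close> is pure, \<open>I(C;R|B)\<close> and \<open>I(C;R|A)\<close> are both equal to
  \<open>S(CB) - S(B) + S(CA) - S(A)\<close>, in which \<open>R\<close> does not occur.  The expression makes sense for arbitrary nonnegative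
  weights on the inputs; it is homogeneous in them, so that concavity becomes superadditivity.\<close>

definition round_info :: "('x::finite, 'y::finite, 'za::finite, 'zb::finite) protocol \<Rightarrow> nat
    \<Rightarrow> ('x \<times> 'y \<Rightarrow> real) \<Rightarrow> real" where
  "round_info P i w = 1/2 *
     (cond_ent {..<dim_C P i} {..<dim_B P i} (wstate_CB P i w) + cond_ent {..<dim_C P i}
         {..<dim_A P i} (wstate_CA P i w))"

definition QIC_weight :: "('x::finite, 'y::finite, 'za::finite, 'zb::finite) protocol
    \<Rightarrow> ('x \<times> 'y \<Rightarrow> real) \<Rightarrow> real" where
  "QIC_weight P w = (\<Sum>i\<in>{1..rounds P}. round_info P i w)"

definition enc_input :: "'x::finite \<times> 'y::finite \<Rightarrow> nat" where
  "enc_input = (\<lambda>(x, y). to_nat_on (UNIV :: 'x set) x * CARD('y) + to_nat_on (UNIV :: 'y set) y)"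

lemma bij_betw_enc_input:
    "bij_betw (enc_input :: 'x::finite \<times> 'y::finite \<Rightarrow> nat) UNIV {..<CARD('x) * CARD('y)}"
proof -
  have "bij_betw (\<lambda>(i, j). to_nat_on (UNIV :: 'x set) i * CARD('y) + to_nat_on (UNIV :: 'y set) j)
      (UNIV \<times> UNIV) {..<CARD('x) * CARD('y)}"
    by (intro bij_betw_enc to_nat_on_finite) auto
  then show ?thesis by (simp add: enc_input_def)
qed

lemma enc_input_less: "enc_input (z :: 'x::finite \<times> 'y::finite) < CARD('x) * CARD('y)"
  using bij_betw_enc_input by (auto simp: bij_betw_def)

lemma to_nat_on_less: "to_nat_on (UNIV :: 'a::finite set) x < CARD('a)"
  using to_nat_on_finite[of "UNIV :: 'a set"] by (auto simp: bij_betw_def)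

lemma to_nat_on_eq_iff: "to_nat_on (UNIV :: 'a::finite set) x = to_nat_on UNIV y \<longleftrightarrow> x = y"
  using to_nat_on_finite[of "UNIV :: 'a set"] by (auto simp: bij_betw_def inj_on_def)

lemma kron_basis_ket:
  fixes z z' :: "'x::finite \<times> 'y::finite"
  shows "kron (basis_ket (fst z')) (basis_ket (snd z')) $$ (enc_input z, 0) = (if z = z' then 1
      else 0)"
proof -
  have "kron (basis_ket (fst z')) (basis_ket (snd z')) $$ (enc_input z, 0 * 1 + 0)
      = basis_ket (fst z') $$ (to_nat_on (UNIV :: 'x set) (fst z), 0) * basis_ket (snd z') $$
          (to_nat_on (UNIV :: 'y set) (snd z), 0)"
    unfolding enc_input_def split_def
    by (rule kron_enc) (auto simp: basis_ket_def to_nat_on_less)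
  then show ?thesis
    by (auto simp: basis_ket_def to_nat_on_less to_nat_on_eq_iff prod_eq_iff)
qed

lemma purified_input_index:
  fixes P :: "('x::finite, 'y::finite, 'za::finite, 'zb::finite) protocol"
  assumes v: "valid_protocol P" and j: "j < dim_ACB P 0"
  shows "purified_input P \<mu> $$ (enc_input z * dim_ACB P 0 + j, 0)
    = of_real (sqrt (pmf \<mu> z)) * initial_state P (fst z) (snd z) $$ (j, 0)"
proof -
  let ?D = "dim_ACB P 0"
  have k: "kron (kron (basis_ket x) (basis_ket y)) (initial_state P x y) $$ (enc_input z * ?D + j,
      0)
      = (if (x, y) = z then initial_state P x y $$ (j, 0) else 0)" for x y
  proof -
    have "kron (kron (basis_ket x) (basis_ket y)) (initial_state P x y) $$ (enc_input z * ?D + j,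
        0 * 1 + 0)
        = kron (basis_ket x) (basis_ket y) $$ (enc_input z, 0) * initial_state P x y $$ (j, 0)"
    proof (rule kron_enc)
      show "kron (basis_ket x) (basis_ket y) \<in> carrier_mat (CARD('x) * CARD('y)) (1 * 1)"
        by (intro kron_carrier) (auto simp: basis_ket_def)
    qed (use initial_state_carrier[OF v] j enc_input_less[of z] in auto)
    then show ?thesis using kron_basis_ket[of "(x, y)" z] by auto
  qed
  have "enc_input z * ?D + j < CARD('x) * CARD('y) * ?D" using enc_less[OF enc_input_less j] .
  then have "purified_input P \<mu> $$ (enc_input z * ?D + j, 0)
      = (\<Sum>x\<in>UNIV. \<Sum>y\<in>UNIV. of_real (sqrt (pmf \<mu> (x, y))) * (if (x, y) = z then initial_state P x y
          $$ (j, 0) else 0))"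
    by (simp add: purified_input_def k)
  also have "\<dots> = (\<Sum>z'\<in>UNIV. of_real (sqrt (pmf \<mu> z')) * (if z' = z
      then initial_state P (fst z') (snd z') $$ (j, 0) else 0))"
    by (subst sum.cartesian_product) (simp add: split_def)
  also have "\<dots> = (\<Sum>z'\<in>UNIV. if z' = z
      then of_real (sqrt (pmf \<mu> z)) * initial_state P (fst z) (snd z) $$ (j, 0) else 0)"
    by (intro sum.cong refl) auto
  finally show ?thesis by simp
qed

text \<open>The rounds act as the identity on the reference, so the branch labelled \<open>z\<close>
  evolves like the run on the classical input \<open>z\<close>, with its amplitude kept.\<close>

lemma purified_run_index:
  fixes P :: "('x::finite, 'y::finite, 'za::finite, 'zb::finite) protocol"
  assumes v: "valid_protocol P" and i: "i \<le> rounds P" and j: "j < dim_ACB P i"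
  defines "R \<equiv> CARD('x) * CARD('y)"
  shows "(kron (1\<^sub>m R) (run P i) * purified_input P \<mu>) $$ (enc_input z * dim_ACB P i + j, 0)
    = of_real (sqrt (pmf \<mu> z)) * input_run P i z $$ (j, 0)"
proof -
  let ?D = "dim_ACB P 0"
  note rc = run_carrier[OF v i]
  have z: "enc_input z < R" unfolding R_def by (rule enc_input_less)
  have K: "kron (1\<^sub>m R) (run P i) \<in> carrier_mat (R * dim_ACB P i) (R * ?D)"
    using rc by (intro kron_carrier) auto
  have pc: "purified_input P \<mu> \<in> carrier_mat (R * ?D) 1" by (simp add: purified_input_def R_def)
  have "(kron (1\<^sub>m R) (run P i) * purified_input P \<mu>) $$ (enc_input z * dim_ACB P i + j, 0)
      = (\<Sum>k<R * ?D. kron (1\<^sub>m R) (run P i) $$ (enc_input z * dim_ACB P i + j, k) * purified_input P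
          \<mu> $$ (k, 0))"
    by (rule mult_mat_index[OF K pc enc_less[OF z j]]) simp
  also have "\<dots> = (\<Sum>r<R. \<Sum>l<?D. kron (1\<^sub>m R) (run P i) $$ (enc_input z * dim_ACB P i + j, r * ?D + l)
      * purified_input P \<mu> $$ (r * ?D + l, 0))"
    by (rule sum_enc)
  also have "\<dots> = (\<Sum>r<R. if r = enc_input z
      then \<Sum>l<?D. run P i $$ (j, l) * purified_input P \<mu> $$ (enc_input z * ?D + l, 0) else 0)"
  proof (rule sum.cong[OF refl])
    fix r assume "r \<in> {..<R}"
    then have "kron (1\<^sub>m R) (run P i) $$ (enc_input z * dim_ACB P i + j, r * ?D + l)
        = 1\<^sub>m R $$ (enc_input z, r) * run P i $$ (j, l)"
      if "l < ?D" for l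
      using rc z j that by (intro kron_enc[where m = R and n = R]) auto
    then show "(\<Sum>l<?D. kron (1\<^sub>m R) (run P i) $$ (enc_input z * dim_ACB P i + j, r * ?D + l)
        * purified_input P \<mu> $$ (r * ?D + l, 0))
        = (if r = enc_input z then \<Sum>l<?D. run P i $$ (j, l) * purified_input P \<mu> $$
            (enc_input z * ?D + l, 0) else 0)"
      using z \<open>r \<in> {..<R}\<close> by auto
  qed
  also have "\<dots> = (\<Sum>l<?D. run P i $$ (j, l) * (of_real (sqrt (pmf \<mu> z))
      * initial_state P (fst z) (snd z) $$ (l, 0)))"
    using z purified_input_index[OF v, of _ \<mu> z] by simp
  also have "\<dots> = of_real (sqrt (pmf \<mu> z)) * input_run P i z $$ (j, 0)"
  proof -
    have "input_run P i z $$ (j, 0)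
        = (\<Sum>l<?D. run P i $$ (j, l) * initial_state P (fst z) (snd z) $$ (l, 0))"
      unfolding input_run_def by (rule mult_mat_index[OF rc initial_state_carrier[OF v] j]) simp
    then show ?thesis by (simp add: sum_distrib_left mult_ac)
  qed
  finally show ?thesis .
qed

text \<open>Tracing out the reference keeps only terms with equal labels, in which the two square
  roots combine to the probability of the input.\<close>

lemma QIC_protocol_eq_weight:
  fixes P :: "('x::finite, 'y::finite, 'za::finite, 'zb::finite) protocol"
  assumes v: "valid_protocol P"
  shows "QIC_protocol P \<mu> = QIC_weight P (pmf \<mu>)"
proof -
  let ?R = "CARD('x) * CARD('y)"
  define \<psi> where "\<psi> i z a c b = of_real (sqrt (pmf \<mu> z)) * amp P i z a c b" for i z a c b
  have T: "tripartite_state UNIV enc_input ?R (dim_A P i) (dim_C P i) (dim_B P i) (\<psi> i)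
      (round_state P \<mu> i)"
    if i: "i \<le> rounds P" for i
  proof
    show "bij_betw (enc_input :: 'x \<times> 'y \<Rightarrow> nat) UNIV {..<?R}" by (rule bij_betw_enc_input)
    define V where "V = kron (1\<^sub>m ?R) (run P i) * purified_input P \<mu>"
    have Vc: "V \<in> carrier_mat (?R * dim_ACB P i) 1"
    proof -
      have "kron (1\<^sub>m ?R) (run P i) \<in> carrier_mat (?R * dim_ACB P i) (?R * dim_ACB P 0)"
        using run_carrier[OF v i] by (intro kron_carrier) auto
      then show ?thesis by (simp add: V_def purified_input_def)
    qed
    note Va = mat_adjoint_carrier[OF Vc]
    have rs: "round_state P \<mu> i = V * mat_adjoint V" by (simp add: round_state_def V_def Let_def)
    then show "round_state P \<mu> i \<in> carrier_mat (?R * dim_A P i * dim_C P i * dim_B P i) (?R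
        * dim_A P i * dim_C P i * dim_B P i)"
      using Vc Va by (simp add: mult.assoc)
    fix z z' :: "'x \<times> 'y" and a c b a' c' b'
    assume h: "a < dim_A P i" "c < dim_C P i" "b < dim_B P i" "a' < dim_A P i" "c' < dim_C P i"
        "b' < dim_B P i"
    define j where "j = (a * dim_C P i + c) * dim_B P i + b"
    define j' where "j' = (a' * dim_C P i + c') * dim_B P i + b'"
    have j: "j < dim_ACB P i" "j' < dim_ACB P i" unfolding j_def j'_def using h
        by (auto intro!: enc_less)
    have e: "((enc_input z * dim_A P i + a) * dim_C P i + c) * dim_B P i + b
        = enc_input z * dim_ACB P i + j"
      "((enc_input z' * dim_A P i + a') * dim_C P i + c') * dim_B P i + b'
          = enc_input z' * dim_ACB P i + j'"
      by (simp_all add: j_def j'_def algebra_simps)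
    have ez: "enc_input z * dim_ACB P i + j < ?R * dim_ACB P i"
        "enc_input z' * dim_ACB P i + j' < ?R * dim_ACB P i"
      using j enc_less[OF enc_input_less] by blast+
    have V: "V $$ (enc_input z * dim_ACB P i + j, 0) = \<psi> i z a c b"
        "V $$ (enc_input z' * dim_ACB P i + j', 0) = \<psi> i z' a' c' b'"
      using purified_run_index[OF v i j(1), where \<mu> = \<mu> and z = z] purified_run_index[OF v i j(2),
          where \<mu> = \<mu> and z = z']
      unfolding V_def \<psi>_def amp_def j_def j'_def by (simp_all only:)
    show "round_state P \<mu> i $$ (((enc_input z * dim_A P i + a) * dim_C P i + c) * dim_B P i + b,
        ((enc_input z' * dim_A P i + a') * dim_C P i + c') * dim_B P i + b') = \<psi> i z a c b * cnj
            (\<psi> i z' a' c' b')"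
      unfolding rs e mult_mat_index[OF Vc Va ez]
      by (simp add: V mat_adjoint_index[OF Vc _ ez(2)])
  qed
  have CB: "state_CB UNIV (dim_A P i) (\<psi> i) = wstate_CB P i (pmf \<mu>)" for i
    unfolding state_CB_def wstate_CB_def \<psi>_def
    by (intro ext) (auto simp: sum_distrib_left mult_ac simp flip: of_real_mult intro!: sum.cong)
  have CA: "state_CA UNIV (dim_B P i) (\<psi> i) = wstate_CA P i (pmf \<mu>)" for i
    unfolding state_CA_def wstate_CA_def \<psi>_def
    by (intro ext) (auto simp: sum_distrib_left mult_ac simp flip: of_real_mult intro!: sum.cong)
  have odd: "1/2 * cmi_last ?R (dim_C P i) (dim_B P i) (ptrace ?R (dim_A P i) (dim_C P i
      * dim_B P i) (round_state P \<mu> i))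
      = round_info P i (pmf \<mu>)" if "i \<le> rounds P" for i
    using tripartite_state.cmi_last_eq[OF T[OF that]] by (simp add: round_info_def CB CA)
  have even: "1/2 * cmi_mid ?R (dim_A P i) (dim_C P i) (ptrace (?R * dim_A P i
      * dim_C P i) (dim_B P i) 1 (round_state P \<mu> i))
      = round_info P i (pmf \<mu>)" if "i \<le> rounds P" for i
    using tripartite_state.cmi_mid_eq[OF T[OF that]] by (simp add: round_info_def CB CA)
  have "QIC_protocol P \<mu> = (\<Sum>i | i \<in> {1..rounds P} \<and> odd i. round_info P i (pmf \<mu>))
      + (\<Sum>i | i \<in> {1..rounds P} \<and> even i. round_info P i (pmf \<mu>))"
    unfolding QIC_protocol_def Let_def
    by (intro arg_cong2[of _ _ _ _ "(+)"] sum.cong refl odd even) auto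
  also have "\<dots> = (\<Sum>i\<in>{i. i \<in> {1..rounds P} \<and> odd i} \<union> {i. i \<in> {1..rounds P}
      \<and> even i}. round_info P i (pmf \<mu>))"
    by (rule sum.union_disjoint[symmetric]) auto
  also have "{i. i \<in> {1..rounds P} \<and> odd i} \<union> {i. i \<in> {1..rounds P} \<and> even i} = {1..rounds P}"
      by auto
  finally show ?thesis by (simp add: QIC_weight_def)
qed

section \<open>The information cost is superadditive, homogeneous and monotone in the
  weights\<close>

lemma psd_on_wstate_CB:
  assumes "\<And>z. w z \<ge> 0"
  shows "psd_on I (wstate_CB P i w)"
proof -
  have "wstate_CB P i w
      = (\<lambda>x y. \<Sum>z\<in>UNIV. of_real (w z) * gram {..<dim_A P i} (\<lambda>(c, b) a. amp P i z a c b) x y)"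
    by (intro ext) (auto simp: wstate_CB_def gram_def)
  then show ?thesis using assms by (auto intro!: psd_on_sum psd_on_scale)
qed

lemma psd_on_wstate_CA:
  assumes "\<And>z. w z \<ge> 0"
  shows "psd_on I (wstate_CA P i w)"
proof -
  have "wstate_CA P i w
      = (\<lambda>x y. \<Sum>z\<in>UNIV. of_real (w z) * gram {..<dim_B P i} (\<lambda>(c, a) b. amp P i z a c b) x y)"
    by (intro ext) (auto simp: wstate_CA_def gram_def)
  then show ?thesis using assms by (auto intro!: psd_on_sum psd_on_scale)
qed

lemma trace_trace_fst: "(\<Sum>b\<in>B. trace_fst C \<rho> b b) = (\<Sum>i\<in>C \<times> B. \<rho> i i)"
  by (simp add: trace_fst_def sum.cartesian_product' sum.swap[of _ B])

text \<open>The label \<open>k\<close> can be read off from the conditioning register. The joint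
  state and its marginal then have the same block traces, so the terms with
  \<open>log 2 (w k)\<close> cancel and the conditional entropy is exactly affine. The first
  register carries no label, and its used part \<open>C k\<close> may depend on the block.\<close>

lemma cond_ent_block_diagonal:
  assumes A: "finite A" and fC: "\<And>k. k \<in> A \<Longrightarrow> finite (C k)" "finite C'"
      and fB: "\<And>k. k \<in> A \<Longrightarrow> finite (B k)" "finite B'"
    and inj: "inj_on (\<lambda>(k, b). h k b) (Sigma A B)"
    and hB: "\<And>k b. k \<in> A \<Longrightarrow> b \<in> B k \<Longrightarrow> h k b \<in> B'" and CC: "\<And>k. k \<in> A \<Longrightarrow> C k \<subseteq> C'"
    and psd: "\<And>k. k \<in> A \<Longrightarrow> psd_on (C k \<times> B k) (\<sigma> k)" and w: "\<And>k. k \<in> A \<Longrightarrow> w k \<ge> 0"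
    and blk: "\<And>k c b l c' b'. k \<in> A \<Longrightarrow> c \<in> C k \<Longrightarrow> b \<in> B k \<Longrightarrow> l \<in> A \<Longrightarrow> c' \<in> C l \<Longrightarrow> b' \<in> B l \<Longrightarrow>
      \<rho> (c, h k b) (c', h l b') = (if k = l then of_real (w k) * \<sigma> k (c, b) (c', b') else 0)"
    and out: "\<And>c b c' b'. c \<in> C' \<Longrightarrow> b \<in> B' \<Longrightarrow> c' \<in> C' \<Longrightarrow> b' \<in> B' \<Longrightarrow>
      \<forall>k\<in>A. c \<in> C k \<longrightarrow> (\<forall>b0\<in>B k. b \<noteq> h k b0) \<Longrightarrow> \<rho> (c, b) (c', b') = 0 \<and> \<rho> (c', b') (c, b) = 0"
  shows "cond_ent C' B' \<rho> = (\<Sum>k\<in>A. w k * cond_ent (C k) (B k) (\<sigma> k))"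
proof -
  have hh: "h k b = h l b' \<longleftrightarrow> k = l \<and> b = b'" if "k \<in> A" "b \<in> B k" "l \<in> A" "b' \<in> B l" for k b l b'
    using inj that by (auto simp: inj_on_def)
  have 1: "ent (C' \<times> B') \<rho> = (\<Sum>k\<in>A. w k * ent (C k \<times> B k) (\<sigma> k) - w k * log 2 (w k) * Re
      (\<Sum>i\<in>C k \<times> B k. \<sigma> k i i))"
  proof (rule ent_block_diagonal[where h = "\<lambda>k (c, b). (c, h k b)"])
    show "inj_on (\<lambda>(k, i). case i of (c, b) \<Rightarrow> (c, h k b)) (SIGMA k:A. C k \<times> B k)"
      using hh by (auto simp: inj_on_def)
    fix j j' assume j: "j \<in> C' \<times> B'" "j' \<in> C' \<times> B'"
        "\<forall>k\<in>A. \<forall>i\<in>C k \<times> B k. j \<noteq> (case i of (c, b) \<Rightarrow> (c, h k b))"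
    obtain c b c' b' where e: "j = (c, b)" "j' = (c', b')" by (metis surj_pair)
    have "\<forall>k\<in>A. c \<in> C k \<longrightarrow> (\<forall>b0\<in>B k. b \<noteq> h k b0)" using j(3) unfolding e by auto
    then show "\<rho> j j' = 0 \<and> \<rho> j' j = 0" using out j unfolding e by auto
  next
    fix k i assume "k \<in> A" "i \<in> C k \<times> B k"
    then show "(case i of (c, b) \<Rightarrow> (c, h k b)) \<in> C' \<times> B'" using hB CC[of k] by auto
  qed (use A fC fB psd w blk in auto)
  have t0: "trace_fst C' \<rho> (h k b) (h l b') = (if k = l
      then of_real (w k) * trace_fst (C k) (\<sigma> k) b b' else 0)"
    if k: "k \<in> A" "b \<in> B k" "l \<in> A" "b' \<in> B l" for k b l b'
  proof -
    have "trace_fst C' \<rho> (h k b) (h l b') = (\<Sum>c\<in>C k. \<rho> (c, h k b) (c, h l b'))"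
      unfolding trace_fst_def
    proof (rule sum.mono_neutral_right)
      \<comment> \<open>\<open>h k b\<close> determines \<open>k\<close>, so with \<open>c\<close>
        outside \<open>C k\<close> the position belongs to no block.\<close>
      show "\<forall>c\<in>C' - C k. \<rho> (c, h k b) (c, h l b') = 0"
      proof
        fix c assume c: "c \<in> C' - C k"
        then have "\<forall>k'\<in>A. c \<in> C k' \<longrightarrow> (\<forall>b0\<in>B k'. h k b \<noteq> h k' b0)" using hh[OF k(1,2)] by auto
        then show "\<rho> (c, h k b) (c, h l b') = 0" using out[of c "h k b" c "h l b'"] c hB k by auto
      qed
    qed (use fC CC k in auto)
    also have "\<dots> = (if k = l then of_real (w k) * trace_fst (C k) (\<sigma> k) b b' else 0)"
    proof (cases "k = l")
      case True
      then show ?thesis using blk k by (simp add: trace_fst_def sum_distrib_left)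
    next
      case False
      have "\<rho> (c, h k b) (c, h l b') = 0" if c: "c \<in> C k" for c
      proof (cases "c \<in> C l")
        case True
        then show ?thesis using blk[OF k(1) c k(2) k(3) True k(4)] False by simp
      next
        case F: False
        then have "\<forall>k'\<in>A. c \<in> C k' \<longrightarrow> (\<forall>b0\<in>B k'. h l b' \<noteq> h k' b0)" using hh[OF k(3,4)] by auto
        moreover have "c \<in> C'" using CC[OF k(1)] c by auto
        ultimately show ?thesis using out[of c "h l b'" c "h k b"] hB k by auto
      qed
      then show ?thesis using False by simp
    qed
    finally show ?thesis .
  qed
  have 2: "ent B' (trace_fst C' \<rho>) = (\<Sum>k\<in>A. w k * ent (B k) (trace_fst (C k) (\<sigma> k))
      - w k * log 2 (w k) * Re (\<Sum>i\<in>B k. trace_fst (C k) (\<sigma> k) i i))"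
  proof (rule ent_block_diagonal[OF A _ fB(2) inj hB _ w t0])
    fix j j' assume j: "j \<in> B'" "j' \<in> B'" "\<forall>k\<in>A. \<forall>i\<in>B k. j \<noteq> h k i"
    then show "trace_fst C' \<rho> j j' = 0 \<and> trace_fst C' \<rho> j' j = 0"
      unfolding trace_fst_def using out by (auto intro!: sum.neutral)
  qed (use fB psd_on_trace_fst[OF fC(1) fB(1) psd] in auto)
  show ?thesis
    unfolding cond_ent_def 1 2 trace_trace_fst sum_subtractf[symmetric]
    by (intro sum.cong refl) (simp add: algebra_simps)
qed

text \<open>The case of a single block with weight \<open>t\<close>.\<close>

lemma cond_ent_scale:
  assumes "finite C" "finite B" "psd_on (C \<times> B) \<sigma>" "t \<ge> 0"
  shows "cond_ent C B (\<lambda>i j. of_real t * \<sigma> i j) = t * cond_ent C B \<sigma>"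
proof -
  have "cond_ent C B (\<lambda>i j. of_real t * \<sigma> i j) = (\<Sum>k\<in>{()}. t * cond_ent C B \<sigma>)"
    by (rule cond_ent_block_diagonal[where h = "\<lambda>_ b. b"]) (use assms in \<open>auto simp: inj_on_def\<close>)
  then show ?thesis by simp
qed

lemma QIC_weight_add:
  assumes "\<And>z. w z \<ge> 0" "\<And>z. w' z \<ge> 0"
  shows "QIC_weight P w + QIC_weight P w' \<le> QIC_weight P (\<lambda>z. w z + w' z)"
proof -
  have "wstate_CB P i (\<lambda>z. w z + w' z) = (\<lambda>x y. wstate_CB P i w x y + wstate_CB P i w' x y)"
    "wstate_CA P i (\<lambda>z. w z + w' z) = (\<lambda>x y. wstate_CA P i w x y + wstate_CA P i w' x y)" for i
    by (auto simp: wstate_CB_def wstate_CA_def fun_eq_iff distrib_right sum.distrib)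
  note e = this
  have "round_info P i w + round_info P i w' \<le> round_info P i (\<lambda>z. w z + w' z)" for i
    unfolding round_info_def e
    using cond_ent_superadditive[OF _ _ psd_on_wstate_CB psd_on_wstate_CB,
        of "{..<dim_C P i}" "{..<dim_B P i}" w w' P i P i]
      cond_ent_superadditive[OF _ _ psd_on_wstate_CA psd_on_wstate_CA,
          of "{..<dim_C P i}" "{..<dim_A P i}" w w' P i P i] assms
    by (simp add: field_simps)
  then show ?thesis unfolding QIC_weight_def sum.distrib[symmetric] by (intro sum_mono) auto
qed

lemma QIC_weight_scale:
  assumes "\<And>z. w z \<ge> 0" "t \<ge> 0"
  shows "QIC_weight P (\<lambda>z. t * w z) = t * QIC_weight P w"
proof -
  have "wstate_CB P i (\<lambda>z. t * w z) = (\<lambda>x y. of_real t * wstate_CB P i w x y)"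
    "wstate_CA P i (\<lambda>z. t * w z) = (\<lambda>x y. of_real t * wstate_CA P i w x y)" for i
    by (auto simp: wstate_CB_def wstate_CA_def fun_eq_iff sum_distrib_left mult.assoc)
  then have "round_info P i (\<lambda>z. t * w z) = t * round_info P i w" for i
    unfolding round_info_def using assms
    by (simp add: cond_ent_scale psd_on_wstate_CB psd_on_wstate_CA algebra_simps)
  then show ?thesis by (simp add: QIC_weight_def sum_distrib_left)
qed

text \<open>For a fixed input the state of the registers A, C and B is itself pure. Hence S(CB) =
  S(A) and S(CA) = S(B), and all four entropies cancel.\<close>

lemma QIC_weight_point: "QIC_weight P (\<lambda>z. if z = z0 then 1 else 0) = 0"
proof -
  let ?w = "\<lambda>z. if z = z0 then 1 else 0 :: real"
  have "round_info P i ?w = 0" for i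
  proof -
    let ?A = "{..<dim_A P i}" and ?C = "{..<dim_C P i}" and ?B = "{..<dim_B P i}"
    let ?f = "\<lambda>a c b. amp P i z0 a c b"
    have CB: "wstate_CB P i ?w = gram ?A (\<lambda>(c, b) a. ?f a c b)"
      and CA: "wstate_CA P i ?w = gram ?B (\<lambda>(c, a) b. ?f a c b)"
      by (auto simp: wstate_CB_def wstate_CA_def gram_def fun_eq_iff if_distrib[of
          of_real] if_distrib[of "\<lambda>x. x * _"] cong: if_cong)
    have "ent (?C \<times> ?B) (wstate_CB P i ?w) = ent ?A (gram (?C \<times> ?B) (\<lambda>a (c, b). ?f a c b))"
      unfolding CB by (subst ent_gram_transpose) (auto intro!: ent_cong simp: gram_def)
    also have "\<dots> = ent ?A (trace_fst ?C (wstate_CA P i ?w))"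
      unfolding CA by (rule ent_cong) (auto simp: gram_def trace_fst_def sum.cartesian_product')
    finally have 1: "ent (?C \<times> ?B) (wstate_CB P i ?w) = ent ?A (trace_fst ?C (wstate_CA P i ?w))" .
    have "ent (?C \<times> ?A) (wstate_CA P i ?w) = ent ?B (gram (?C \<times> ?A) (\<lambda>b (c, a). ?f a c b))"
      unfolding CA by (subst ent_gram_transpose) (auto intro!: ent_cong simp: gram_def)
    also have "\<dots> = ent ?B (trace_fst ?C (wstate_CB P i ?w))"
      unfolding CB by (rule ent_cong) (auto simp: gram_def trace_fst_def sum.cartesian_product')
    finally show ?thesis using 1 by (simp add: round_info_def cond_ent_def)
  qed
  then show ?thesis by (simp add: QIC_weight_def)
qed

text \<open>Any weight is a nonnegative combination of point masses, where the cost vanishes;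
  superadditivity bounds the cost of the combination below by 0.\<close>

lemma QIC_weight_nonneg:
  fixes w :: "'x::finite \<times> 'y::finite \<Rightarrow> real"
  assumes w: "\<And>z. w z \<ge> 0"
  shows "QIC_weight P w \<ge> 0"
proof -
  have "QIC_weight P (\<lambda>z. if z \<in> S then w z else 0) \<ge> 0" if "finite S" for S :: "('x \<times> 'y) set"
    using that
  proof (induction S)
    case empty
    have "QIC_weight P (\<lambda>z. 0 * 0 :: real) = 0 * QIC_weight P (\<lambda>z. 0)"
      by (rule QIC_weight_scale) auto
    then show ?case by simp
  next
    case (insert a S)
    have "QIC_weight P (\<lambda>z. w a * (if z = a then 1 else 0)) = w a * QIC_weight P (\<lambda>z. if z = a
        then 1 else 0)"
      by (rule QIC_weight_scale) (use w in auto)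
    then have 0: "QIC_weight P (\<lambda>z. w a * (if z = a then 1 else 0)) = 0"
        by (simp add: QIC_weight_point)
    have "QIC_weight P (\<lambda>z. if z \<in> S then w z else 0) + QIC_weight P (\<lambda>z. w a * (if z = a then 1
        else 0))
        \<le> QIC_weight P (\<lambda>z. (if z \<in> S then w z else 0) + w a * (if z = a then 1 else 0))"
      by (rule QIC_weight_add) (use w in auto)
    also have "(\<lambda>z. (if z \<in> S then w z else 0) + w a * (if z = a then 1 else 0))
        = (\<lambda>z. if z \<in> insert a S then w z else 0)"
      using insert.hyps by auto
    finally show ?case using insert.IH 0 by simp
  qed
  from this[of UNIV] show ?thesis by simp
qed

text \<open>Superadditivity splits off the difference of the weights, whose cost is
  nonnegative.\<close>

lemma QIC_weight_mono:
  assumes "\<And>z. w z \<ge> 0" "\<And>z. w z \<le> w' z"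
  shows "QIC_weight P w \<le> QIC_weight P w'"
proof -
  have "QIC_weight P w + QIC_weight P (\<lambda>z. w' z - w z) \<le> QIC_weight P (\<lambda>z. w z + (w' z - w z))"
    by (rule QIC_weight_add) (use assms in auto)
  moreover have "QIC_weight P (\<lambda>z. w' z - w z) \<ge> 0" by (rule QIC_weight_nonneg) (use assms in simp)
  ultimately show ?thesis by simp
qed

subsection \<open>Block isometries\<close>

lemma isometry_iff:
  "isometry m n V \<longleftrightarrow> V \<in> carrier_mat n m \<and>
    (\<forall>i<m. \<forall>j<m. (\<Sum>k<n. cnj (V $$ (k, i)) * V $$ (k, j)) = (if i = j then 1 else 0))"
proof (cases "V \<in> carrier_mat n m")
  case V: True
  note Va = mat_adjoint_carrier[OF V]
  have e: "(mat_adjoint V * V) $$ (i, j) = (\<Sum>k<n. cnj (V $$ (k, i)) * V $$ (k, j))"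
      if "i < m" "j < m" for i j
    unfolding mult_mat_index[OF Va V that] using that by (simp add: mat_adjoint_index[OF V])
  have "mat_adjoint V * V = 1\<^sub>m m \<longleftrightarrow> (\<forall>i<m. \<forall>j<m. (mat_adjoint V * V) $$ (i, j) = (if i = j then 1
      else 0))"
    using Va V by (auto simp: mat_eq_iff)
  then show ?thesis using V e by (simp add: isometry_def)
qed (simp add: isometry_def)

lemma isometry_one: "isometry m m (1\<^sub>m m)"
proof -
  have "(\<Sum>k<m. cnj (1\<^sub>m m $$ (k, i)) * 1\<^sub>m m $$ (k, j)) = (if i = j then 1 else (0 :: complex))"
    if "i < m" "j < m" for i j
  proof -
    have "(\<Sum>k<m. cnj (1\<^sub>m m $$ (k, i)) * 1\<^sub>m m $$ (k, j)) = (\<Sum>k<m. if k = i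
        then (if i = j then 1 else (0 :: complex)) else 0)"
      using that by (intro sum.cong refl) auto
    then show ?thesis using that by simp
  qed
  then show ?thesis by (simp add: isometry_iff)
qed

lemma kron_one: "kron (1\<^sub>m a) (1\<^sub>m b) = 1\<^sub>m (a * b)"
proof (rule eq_matI)
  fix i j assume "i < dim_row (1\<^sub>m (a * b) :: complex mat)"
      "j < dim_col (1\<^sub>m (a * b) :: complex mat)"
  then have ij: "i < a * b" "j < a * b" by auto
  then have b: "b > 0" by (cases b) auto
  have "i = j \<longleftrightarrow> i div b = j div b \<and> i mod b = j mod b"
    by (metis div_mult_mod_eq)
  then show "kron (1\<^sub>m a) (1\<^sub>m b) $$ (i, j) = 1\<^sub>m (a * b) $$ (i, j)"
    using ij b by (auto simp: kron_def less_mult_imp_div_less)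
qed (auto simp: kron_def)

section \<open>Kronecker products applied to vectors\<close>

lemma kron_apply:
  assumes A: "A \<in> carrier_mat m n" and B: "B \<in> carrier_mat m' n'"
      and v: "v \<in> carrier_mat (n * n') 1"
    and ij: "i < m" "j < m'"
  shows "(kron A B * v) $$ (i * m' + j, 0)
      = (\<Sum>k<n. \<Sum>l<n'. A $$ (i, k) * B $$ (j, l) * v $$ (k * n' + l, 0))"
proof -
  have "(kron A B * v) $$ (i * m' + j, 0) = (\<Sum>k<n * n'. kron A B $$ (i * m' + j, k) * v $$ (k, 0))"
    by (rule mult_mat_index[OF kron_carrier[OF A B] v enc_less[OF ij]]) simp
  also have "\<dots> = (\<Sum>k<n. \<Sum>l<n'. kron A B $$ (i * m' + j, k * n' + l) * v $$ (k * n' + l, 0))"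
    by (rule sum_enc)
  also have "\<dots> = (\<Sum>k<n. \<Sum>l<n'. A $$ (i, k) * B $$ (j, l) * v $$ (k * n' + l, 0))"
    using kron_enc[OF A B ij(1) _ ij(2)] by (intro sum.cong refl) auto
  finally show ?thesis .
qed

lemma kron_apply_left:
  assumes A: "A \<in> carrier_mat m n" and v: "v \<in> carrier_mat (n * l) 1" and ij: "i < m" "j < l"
  shows "(kron A (1\<^sub>m l) * v) $$ (i * l + j, 0) = (\<Sum>k<n. A $$ (i, k) * v $$ (k * l + j, 0))"
proof -
  have "(\<Sum>l'<l. A $$ (i, k) * 1\<^sub>m l $$ (j, l') * v $$ (k * l + l', 0))
      = A $$ (i, k) * v $$ (k * l + j, 0)" for k
  proof -
    have "(\<Sum>l'<l. A $$ (i, k) * 1\<^sub>m l $$ (j, l') * v $$ (k * l + l', 0)) = (\<Sum>l'<l. if l' = j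
        then A $$ (i, k) * v $$ (k * l + j, 0) else 0)"
      using ij by (intro sum.cong refl) auto
    then show ?thesis using ij by simp
  qed
  then show ?thesis using kron_apply[OF A one_carrier_mat v ij] by simp
qed

lemma kron_apply_right:
  assumes B: "B \<in> carrier_mat m' n'" and v: "v \<in> carrier_mat (l * n') 1" and ij: "i < l" "j < m'"
  shows "(kron (1\<^sub>m l) B * v) $$ (i * m' + j, 0) = (\<Sum>k<n'. B $$ (j, k) * v $$ (i * n' + k, 0))"
proof -
  have "(\<Sum>k<l. \<Sum>l'<n'. 1\<^sub>m l $$ (i, k) * B $$ (j, l') * v $$ (k * n' + l', 0))
      = (\<Sum>k<l. if k = i then \<Sum>l'<n'. B $$ (j, l') * v $$ (i * n' + l', 0) else 0)"
    using ij by (intro sum.cong refl) auto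
  then show ?thesis using ij kron_apply[OF one_carrier_mat B v ij] by simp
qed

lemma kron_apply_both:
  assumes A: "A \<in> carrier_mat m n" and B: "B \<in> carrier_mat m' n'"
      and v: "v \<in> carrier_mat (n * n') 1"
    and ij: "i < m" "j < m'"
  shows "(kron A B * v) $$ (i * m' + j, 0)
      = (\<Sum>k<n. A $$ (i, k) * (\<Sum>l<n'. B $$ (j, l) * v $$ (k * n' + l, 0)))"
  using kron_apply[OF assms] by (simp add: sum_distrib_left mult.assoc)

section \<open>Placing blocks of different sizes in a common space\<close>

text \<open>Injectivity on pairs expresses at once that each block is embedded injectively and that
  different blocks are disjoint.\<close>

definition embeds :: "nat \<Rightarrow> (nat \<Rightarrow> nat) \<Rightarrow> nat \<Rightarrow> (nat \<Rightarrow> nat \<Rightarrow> nat) \<Rightarrow> bool" where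
  "embeds n m M f \<longleftrightarrow> inj_on (\<lambda>(k, i). f k i) (Sigma {..<n} (\<lambda>k. {..<m k}))
      \<and> (\<forall>k<n. \<forall>i<m k. f k i < M)"

lemma embeds_less: "embeds n m M f \<Longrightarrow> k < n \<Longrightarrow> i < m k \<Longrightarrow> f k i < M"
  by (simp add: embeds_def)

lemma embeds_eq_iff:
  "embeds n m M f \<Longrightarrow> k < n \<Longrightarrow> i < m k \<Longrightarrow> k' < n \<Longrightarrow> i' < m k' \<Longrightarrow> f k i = f k' i' \<longleftrightarrow> k = k' \<and> i = i'"
  unfolding embeds_def inj_on_def by auto

lemma embedsI:
  assumes "\<And>k i k' i'. k < n \<Longrightarrow> i < m k \<Longrightarrow> k' < n \<Longrightarrow> i' < m k' \<Longrightarrow> f k i = f k' i' \<Longrightarrow> k = k' \<and> i = i'"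
    and "\<And>k i. k < n \<Longrightarrow> i < m k \<Longrightarrow> f k i < M"
  shows "embeds n m M f"
  unfolding embeds_def inj_on_def using assms by auto

lemma sum_embeds:
  fixes F :: "nat \<Rightarrow> 'a :: comm_monoid_add"
  assumes e: "embeds n m M f" and "\<And>x. x < M \<Longrightarrow> \<forall>k<n. \<forall>i<m k. x \<noteq> f k i \<Longrightarrow> F x = 0"
  shows "(\<Sum>x<M. F x) = (\<Sum>k<n. \<Sum>i<m k. F (f k i))"
proof -
  let ?S = "Sigma {..<n} (\<lambda>k. {..<m k})"
  have "(\<Sum>x<M. F x) = (\<Sum>x\<in>(\<lambda>(k, i). f k i) ` ?S. F x)"
    using assms by (intro sum.mono_neutral_right) (auto simp: image_def embeds_def)
  also have "\<dots> = (\<Sum>x\<in>?S. F (case x of (k, i) \<Rightarrow> f k i))"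
    using e by (subst sum.reindex) (auto simp: embeds_def)
  also have "\<dots> = (\<Sum>k<n. \<Sum>i<m k. F (f k i))"
    by (simp add: sum.Sigma split_def)
  finally show ?thesis .
qed

lemma embeds_interleave:
  assumes "n * (\<Sum>k<n. m k) \<le> M"
  shows "embeds n m M (\<lambda>k i. n * i + k)"
proof (rule embedsI)
  fix k i k' i' assume h: "k < n" "i < m k" "k' < n" "i' < m k'"
  {
    assume "n * i + k = n * i' + k'"
    then show "k = k' \<and> i = i'" using enc_inject[of k n k' i i'] h by (simp add: mult.commute)
  }
  have "m k \<le> (\<Sum>k<n. m k)" using h by (intro member_le_sum) auto
  then have "i < (\<Sum>k<n. m k)" using h by simp
  then have "i * n + k < (\<Sum>k<n. m k) * n" using h by (intro enc_less) auto
  then show "n * i + k < M" using assms by (simp add: mult.commute)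
qed

text \<open>For a composite register whose left factor carries the label. The right factor of size
  \<open>t k\<close> becomes an initial segment of the one of size \<open>T\<close>. In
  \<open>emb_inner\<close> the right factor carries the label instead.\<close>

definition emb_outer :: "(nat \<Rightarrow> nat) \<Rightarrow> nat \<Rightarrow> (nat \<Rightarrow> nat \<Rightarrow> nat) \<Rightarrow> nat \<Rightarrow> nat \<Rightarrow> nat" where
  "emb_outer t T f k i = f k (i div t k) * T + i mod t k"

definition emb_inner :: "(nat \<Rightarrow> nat) \<Rightarrow> nat \<Rightarrow> (nat \<Rightarrow> nat \<Rightarrow> nat) \<Rightarrow> nat \<Rightarrow> nat \<Rightarrow> nat" where
  "emb_inner t T f k i = (i div t k) * T + f k (i mod t k)"

lemma div_mod_less: "i < m * t \<Longrightarrow> i div t < m \<and> i mod t < (t :: nat)"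
  by (cases "t = 0") (auto simp: less_mult_imp_div_less)

lemma embeds_outer:
  assumes f: "embeds n m M f" and t: "\<And>k. k < n \<Longrightarrow> t k \<le> T"
  shows "embeds n (\<lambda>k. m k * t k) (M * T) (emb_outer t T f)"
proof (rule embedsI)
  fix k i k' i' assume h: "k < n" "i < m k * t k" "k' < n" "i' < m k' * t k'"
  note d = div_mod_less[OF h(2)] div_mod_less[OF h(4)]
  have T: "i mod t k < T" "i' mod t k' < T" using d t h by (meson less_le_trans)+
  {
    assume "emb_outer t T f k i = emb_outer t T f k' i'"
    then have "f k (i div t k) = f k' (i' div t k')" "i mod t k = i' mod t k'"
      using T by (auto simp: emb_outer_def enc_inject)
    then show "k = k' \<and> i = i'"
      using embeds_eq_iff[OF f h(1) _ h(3)] d by (metis div_mult_mod_eq)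
  }
  show "emb_outer t T f k i < M * T"
    unfolding emb_outer_def using embeds_less[OF f h(1)] d T by (intro enc_less) auto
qed

lemma embeds_inner:
  assumes f: "embeds n t T f" and m: "\<And>k. k < n \<Longrightarrow> m k \<le> M"
  shows "embeds n (\<lambda>k. m k * t k) (M * T) (emb_inner t T f)"
proof (rule embedsI)
  fix k i k' i' assume h: "k < n" "i < m k * t k" "k' < n" "i' < m k' * t k'"
  note d = div_mod_less[OF h(2)] div_mod_less[OF h(4)]
  have T: "f k (i mod t k) < T" "f k' (i' mod t k') < T" using d embeds_less[OF f] h by auto
  {
    assume "emb_inner t T f k i = emb_inner t T f k' i'"
    then have "f k (i mod t k) = f k' (i' mod t k')" "i div t k = i' div t k'"
      using T by (auto simp: emb_inner_def enc_inject)
    then show "k = k' \<and> i = i'"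
      using embeds_eq_iff[OF f h(1) _ h(3)] d by (metis div_mult_mod_eq)
  }
  have "i div t k < M" using d m[OF h(1)] by linarith
  then show "emb_inner t T f k i < M * T"
    unfolding emb_inner_def using T by (intro enc_less)
qed

text \<open>The part of the space outside of the blocks is never reached, but a valid protocol needs a total
  isometry; \<open>j\<close> sends it to fresh basis vectors.\<close>

definition block_iso :: "nat \<Rightarrow> (nat \<Rightarrow> nat) \<Rightarrow> nat \<Rightarrow> (nat \<Rightarrow> nat \<Rightarrow> nat) \<Rightarrow> (nat \<Rightarrow> nat) \<Rightarrow> nat
    \<Rightarrow> (nat \<Rightarrow> nat \<Rightarrow> nat) \<Rightarrow>
    (nat \<Rightarrow> nat) \<Rightarrow> (nat \<Rightarrow> complex mat) \<Rightarrow> complex mat" where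
  "block_iso n m M f m' M' g j V = Matrix.mat M' M (\<lambda>(y, x).
     if \<exists>k<n. \<exists>i<m k. x = f k i
     then \<Sum>k<n. \<Sum>i<m k. \<Sum>i'<m' k. if x = f k i \<and> y = g k i' then V k $$ (i', i) else 0
     else if y = j x then 1 else 0)"

text \<open>The images under \<open>j\<close> have to be distinct from each other and from all
  target positions of the blocks, so that the columns of the completed matrix remain
  orthonormal.\<close>

locale block_embedding =
  fixes n m M f m' M' g j
  assumes f: "embeds n m M f" and g: "embeds n m' M' g"
    and j_inj: "inj_on j {..<M}" and j_less: "\<And>x. x < M \<Longrightarrow> j x < M'"
    and j_g: "\<And>k i x. k < n \<Longrightarrow> i < m' k \<Longrightarrow> x < M \<Longrightarrow> g k i \<noteq> j x"
begin

lemma block_iso_carrier: "block_iso n m M f m' M' g j V \<in> carrier_mat M' M"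
  by (simp add: block_iso_def)

lemma block_iso_block:
  assumes k: "k < n" "i < m k" and k': "k' < n" "i' < m' k'"
  shows "block_iso n m M f m' M' g j V $$ (g k' i', f k i) = (if k = k' then V k $$ (i', i) else 0)"
proof -
  have "block_iso n m M f m' M' g j V $$ (g k' i', f k i)
      = (\<Sum>l<n. \<Sum>a<m l. \<Sum>b<m' l. if f k i = f l a \<and> g k' i' = g l b then V l $$ (b, a) else 0)"
    using k k' embeds_less[OF f] embeds_less[OF g] by (auto simp: block_iso_def)
  also have "\<dots> = (\<Sum>l<n. \<Sum>a<m l. \<Sum>b<m' l. if l = k then if a = i then if b = i'
      then if k = k' then V k $$ (i', i) else 0 else 0 else 0 else 0)"
    using k k' by (intro sum.cong refl) (auto simp: embeds_eq_iff[OF f] embeds_eq_iff[OF g])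
  also have "\<dots> = (if k = k' then V k $$ (i', i) else 0)"
  proof -
    have *: "(\<Sum>x\<in>A. if c then F x else 0) = (if c then \<Sum>x\<in>A. F x else (0 :: complex))"
        for A :: "nat set" and c F
      by simp
    show ?thesis unfolding * using k k' by (cases "k = k'") simp_all
  qed
  finally show ?thesis .
qed

lemma block_iso_outside:
  assumes k: "k < n" "i < m k" and y: "y < M'" "\<forall>k<n. \<forall>i<m' k. y \<noteq> g k i"
  shows "block_iso n m M f m' M' g j V $$ (y, f k i) = 0"
  using k y embeds_less[OF f] by (auto simp: block_iso_def intro!: sum.neutral)

lemma block_iso_junk:
  assumes "x < M" "\<forall>k<n. \<forall>i<m k. x \<noteq> f k i" "y < M'"
  shows "block_iso n m M f m' M' g j V $$ (y, x) = (if y = j x then 1 else 0)"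
  using assms by (auto simp: block_iso_def)

text \<open>Columns of the same block inherit orthonormality from \<open>V k\<close>; columns of
  different blocks have disjoint support, and the remaining columns are distinct basis vectors off
  the blocks. By conjugate symmetry, if either column lies in a block it may be taken as the
  first.\<close>

lemma isometry_block_iso:
  assumes V: "\<And>k. k < n \<Longrightarrow> isometry (m k) (m' k) (V k)"
  shows "isometry M M' (block_iso n m M f m' M' g j V)"
  unfolding isometry_iff
proof (intro conjI allI impI block_iso_carrier)
  let ?W = "block_iso n m M f m' M' g j V"
  have blk: "(\<Sum>y<M'. cnj (?W $$ (y, f k i)) * ?W $$ (y, x')) = (if f k i = x' then 1 else 0)"
    if k: "k < n" "i < m k" and x': "x' < M" for k i x'
  proof -
    have "(\<Sum>y<M'. cnj (?W $$ (y, f k i)) * ?W $$ (y, x'))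
        = (\<Sum>l<n. \<Sum>b<m' l. cnj (?W $$ (g l b, f k i)) * ?W $$ (g l b, x'))"
      using k by (intro sum_embeds[OF g]) (simp add: block_iso_outside)
    also have "\<dots> = (\<Sum>l<n. if l = k then \<Sum>b<m' k. cnj (V k $$ (b, i)) * ?W $$ (g k b, x') else 0)"
      using k by (intro sum.cong refl) (auto simp: block_iso_block)
    also have "\<dots> = (\<Sum>b<m' k. cnj (V k $$ (b, i)) * ?W $$ (g k b, x'))" using k by simp
    also have "\<dots> = (if f k i = x' then 1 else 0)"
    proof (cases "\<exists>k'<n. \<exists>i'<m k'. x' = f k' i'")
      case True
      then obtain k' i' where e: "k' < n" "i' < m k'" "x' = f k' i'" by blast
      have "(\<Sum>b<m' k. cnj (V k $$ (b, i)) * ?W $$ (g k b, x')) = (if k' = k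
          then \<Sum>b<m' k. cnj (V k $$ (b, i)) * V k $$ (b, i') else 0)"
        unfolding e using e k by (auto simp: block_iso_block)
      also have "\<dots> = (if f k i = x' then 1 else 0)"
        using V[OF k(1)] k e by (auto simp: isometry_iff embeds_eq_iff[OF f])
      finally show ?thesis .
    next
      case False
      then have "?W $$ (g k b, x') = 0" if "b < m' k" for b
        using that x' k j_g embeds_less[OF g] by (subst block_iso_junk) auto
      moreover have "f k i \<noteq> x'" using False k by auto
      ultimately show ?thesis by simp
    qed
    finally show ?thesis .
  qed
  fix x x' assume x: "x < M" "x' < M"
  show "(\<Sum>y<M'. cnj (?W $$ (y, x)) * ?W $$ (y, x')) = (if x = x' then 1 else 0)"
  proof (cases "(\<exists>k<n. \<exists>i<m k. x = f k i) \<or> (\<exists>k<n. \<exists>i<m k. x' = f k i)")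
    case True
    then show ?thesis
    proof
      assume "\<exists>k<n. \<exists>i<m k. x = f k i"
      then show ?thesis using blk x by blast
    next
      assume "\<exists>k<n. \<exists>i<m k. x' = f k i"
      then have "(\<Sum>y<M'. cnj (?W $$ (y, x')) * ?W $$ (y, x)) = (if x' = x then 1 else 0)"
          using blk x by blast
      then have "cnj (\<Sum>y<M'. cnj (?W $$ (y, x')) * ?W $$ (y, x)) = (if x = x' then 1 else 0)"
          by auto
      then show ?thesis by (simp add: mult.commute)
    qed
  next
    case False
    then have "(\<Sum>y<M'. cnj (?W $$ (y, x)) * ?W $$ (y, x')) = (\<Sum>y<M'. if y = j x
        then (if j x = j x' then 1 else 0) else 0)"
      using x by (intro sum.cong refl) (auto simp: block_iso_junk)
    also have "\<dots> = (if j x = j x' then 1 else 0)" using j_less[OF x(1)] by simp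
    finally show ?thesis using j_inj x by (auto simp: inj_on_def)
  qed
qed

end

section \<open>Superpositions whose label is held by both sides\<close>

text \<open>The bipartite vector \<open>\<Phi>\<close> is the superposition of the vectors
  \<open>\<phi> k\<close> with amplitudes \<open>s k\<close>, each placed in its own block on both
  sides. In particular it vanishes where the two labels disagree.\<close>

definition mixes :: "nat \<Rightarrow> (nat \<Rightarrow> complex) \<Rightarrow> (nat \<Rightarrow> nat) \<Rightarrow> nat \<Rightarrow> (nat \<Rightarrow> nat \<Rightarrow> nat) \<Rightarrow> (nat \<Rightarrow> nat)
    \<Rightarrow> nat \<Rightarrow> (nat \<Rightarrow> nat \<Rightarrow> nat) \<Rightarrow>
    (nat \<Rightarrow> nat \<Rightarrow> complex) \<Rightarrow> (nat \<Rightarrow> nat \<Rightarrow> nat \<Rightarrow> complex) \<Rightarrow> bool" where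
  "mixes n s m M f l L h \<Phi> \<phi> \<longleftrightarrow>
     (\<forall>k<n. \<forall>i<m k. \<forall>j<l k. \<Phi> (f k i) (h k j) = s k * \<phi> k i j) \<and>
     (\<forall>x<M. \<forall>y<L. (\<forall>k<n. \<forall>i<m k. \<forall>j<l k. x = f k i \<longrightarrow> y \<noteq> h k j) \<longrightarrow> \<Phi> x y = 0)"

lemma mixes_flip: "mixes n s m M f l L h \<Phi> \<phi>
    \<Longrightarrow> mixes n s l L h m M f (\<lambda>y x. \<Phi> x y) (\<lambda>k j i. \<phi> k i j)"
  unfolding mixes_def by (intro conjI allI impI) (blast, metis)

text \<open>A block isometry on one side acts as \<open>V k\<close> on the component
  \<open>k\<close> and preserves its label. Its completion off the blocks is never seen, because
  \<open>\<Phi>\<close> vanishes there. An action on the other side is handled through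
  \<open>mixes_flip\<close>.\<close>

lemma (in block_embedding) mixes_block_iso:
  assumes h: "embeds n l L h" and mix: "mixes n s m M f l L h \<Phi> \<phi>"
    and \<Phi>': "\<And>x' y. x' < M' \<Longrightarrow> y < L
        \<Longrightarrow> \<Phi>' x' y = (\<Sum>x<M. block_iso n m M f m' M' g j V $$ (x', x) * \<Phi> x y)"
    and \<phi>': "\<And>k i' b. k < n \<Longrightarrow> i' < m' k \<Longrightarrow> b < l k \<Longrightarrow> \<phi>' k i' b = (\<Sum>i<m k. V k $$ (i', i) * \<phi> k i b)"
  shows "mixes n s m' M' g l L h \<Phi>' \<phi>'"
proof -
  let ?W = "block_iso n m M f m' M' g j V"
  have mx: "\<Phi> (f k i) (h k b) = s k * \<phi> k i b" if "k < n" "i < m k" "b < l k" for k i b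
    using mix that by (simp add: mixes_def)
  have mx0: "\<Phi> x y = 0" if "x < M" "y < L" "\<forall>k<n. \<forall>i<m k. \<forall>b<l k. x = f k i \<longrightarrow> y \<noteq> h k b" for x y
    using mix that by (simp add: mixes_def)
  have S: "\<Phi>' x' (h k b) = (\<Sum>i<m k. ?W $$ (x', f k i) * (s k * \<phi> k i b))"
    if k: "k < n" "b < l k" "x' < M'" for x' k b
  proof -
    have hb: "h k b < L" using embeds_less[OF h] k by simp
    have z: "\<Phi> x (h k b) = 0" if "x < M" "\<forall>i<m k. x \<noteq> f k i" for x
      using that k embeds_eq_iff[OF h] hb by (intro mx0) auto
    have "\<Phi>' x' (h k b) = (\<Sum>a<n. \<Sum>i<m a. ?W $$ (x', f a i) * \<Phi> (f a i) (h k b))"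
      unfolding \<Phi>'[OF k(3) hb] using z k by (intro sum_embeds[OF f]) auto
    also have "\<dots> = (\<Sum>a<n. if a = k then \<Sum>i<m k. ?W $$ (x', f k i) * (s k * \<phi> k i b) else 0)"
    proof (intro sum.cong refl)
      fix a assume a: "a \<in> {..<n}"
      have "\<Phi> (f a i) (h k b) = 0" if "i < m a" "a \<noteq> k" for i
        using z[of "f a i"] that a k embeds_eq_iff[OF f] embeds_less[OF f] by auto
      then show "(\<Sum>i<m a. ?W $$ (x', f a i) * \<Phi> (f a i) (h k b)) = (if a = k
          then \<Sum>i<m k. ?W $$ (x', f k i) * (s k * \<phi> k i b) else 0)"
        using mx k by auto
    qed
    finally show ?thesis using k by simp
  qed
  show ?thesis
    unfolding mixes_def
  proof (intro conjI allI impI)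
    fix k i' b assume k: "k < n" "i' < m' k" "b < l k"
    show "\<Phi>' (g k i') (h k b) = s k * \<phi>' k i' b"
      unfolding S[OF k(1,3) embeds_less[OF g k(1,2)]] \<phi>'[OF k] sum_distrib_left
      using k by (intro sum.cong refl) (simp add: block_iso_block)
  next
    fix x' y assume x: "x' < M'" "y < L" and out: "\<forall>k<n. \<forall>i<m' k. \<forall>b<l k. x' = g k i \<longrightarrow> y \<noteq> h k b"
    show "\<Phi>' x' y = 0"
    proof (cases "\<exists>k<n. \<exists>b<l k. y = h k b")
      case True
      then obtain k b where k: "k < n" "b < l k" "y = h k b" by blast
      have "?W $$ (x', f k i) = 0" if i: "i < m k" for i
      proof (cases "\<exists>k'<n. \<exists>i'<m' k'. x' = g k' i'")
        case True
        then obtain k' i' where e: "k' < n" "i' < m' k'" "x' = g k' i'" by blast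
        then have "k' \<noteq> k" using out k by auto
        then show ?thesis using block_iso_block[OF k(1) i e(1,2)] e by simp
      next
        case False
        then show ?thesis using block_iso_outside[OF k(1) i x(1)] by blast
      qed
      then show ?thesis unfolding k(3) S[OF k(1,2) x(1)] by simp
    next
      case False
      then have "\<Phi> a y = 0" if "a < M" for a using mx0 that x by auto
      then show ?thesis unfolding \<Phi>'[OF x] by simp
    qed
  qed
qed

lemma mixes_block: "mixes n s m M f l L h \<Phi> \<phi> \<Longrightarrow> k < n \<Longrightarrow> i < m k \<Longrightarrow> j < l k \<Longrightarrow> \<Phi> (f k i) (h k j)
    = s k * \<phi> k i j"
  by (simp add: mixes_def)

lemma mixes_outside:
  "mixes n s m M f l L h \<Phi> \<phi> \<Longrightarrow> x < M \<Longrightarrow> y < L \<Longrightarrow>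
    (\<And>k i j. k < n \<Longrightarrow> i < m k \<Longrightarrow> j < l k \<Longrightarrow> x = f k i \<Longrightarrow> y = h k j \<Longrightarrow> False) \<Longrightarrow> \<Phi> x y = 0"
  unfolding mixes_def by blast

lemma mixes_cross:
  assumes "mixes n s m M f l L h \<Phi> \<phi>" "embeds n m M f" "embeds n l L h"
    and "k < n" "i < m k" "k' < n" "j < l k'"
  shows "\<Phi> (f k i) (h k' j) = (if k = k' then s k * \<phi> k i j else 0)"
proof (cases "k = k'")
  case False
  have "\<Phi> (f k i) (h k' j) = 0"
    by (rule mixes_outside[OF assms(1)])
      (use False assms embeds_less[OF assms(2)] embeds_less[OF assms(3)] embeds_eq_iff[OF assms(2)]
          embeds_eq_iff[OF assms(3)] in auto)
  then show ?thesis using False by simp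
qed (use assms in \<open>auto intro: mixes_block\<close>)

text \<open>Components with different labels are orthogonal, so the squared norms add up. This
  serves both for the normalisation of the shared state and for the output probabilities.\<close>

lemma mixes_norm:
  assumes mx: "mixes n s m M f l L h \<Phi> \<phi>" and f: "embeds n m M f" and h: "embeds n l L h"
  shows "(\<Sum>x<M. \<Sum>y<L. (cmod (\<Phi> x y))\<^sup>2)
      = (\<Sum>k<n. (cmod (s k))\<^sup>2 * (\<Sum>i<m k. \<Sum>j<l k. (cmod (\<phi> k i j))\<^sup>2))"
proof -
  have "(\<Sum>x<M. \<Sum>y<L. (cmod (\<Phi> x y))\<^sup>2) = (\<Sum>k<n. \<Sum>i<m k. \<Sum>y<L. (cmod (\<Phi> (f k i) y))\<^sup>2)"
  proof (rule sum_embeds[OF f])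
    fix x assume "x < M" "\<forall>k<n. \<forall>i<m k. x \<noteq> f k i"
    then have "\<Phi> x y = 0" if "y < L" for y using mixes_outside[OF mx] that by blast
    then show "(\<Sum>y<L. (cmod (\<Phi> x y))\<^sup>2) = 0" by simp
  qed
  also have "\<dots> = (\<Sum>k<n. \<Sum>i<m k. \<Sum>j<l k. (cmod (s k * \<phi> k i j))\<^sup>2)"
  proof (rule sum.cong[OF refl], rule sum.cong[OF refl])
    fix k i assume k: "k \<in> {..<n}" "i \<in> {..<m k}"
    have "(\<Sum>y<L. (cmod (\<Phi> (f k i) y))\<^sup>2) = (\<Sum>k'<n. \<Sum>j<l k'. (cmod (\<Phi> (f k i) (h k' j)))\<^sup>2)"
    proof (rule sum_embeds[OF h])
      fix y assume "y < L" "\<forall>k<n. \<forall>i<l k. y \<noteq> h k i"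
      then show "(cmod (\<Phi> (f k i) y))\<^sup>2 = 0"
        using mixes_outside[OF mx embeds_less[OF f]] k by simp blast
    qed
    also have "\<dots> = (\<Sum>k'<n. if k' = k then \<Sum>j<l k. (cmod (s k * \<phi> k i j))\<^sup>2 else 0)"
      using k by (intro sum.cong refl) (simp add: mixes_cross[OF mx f h])
    finally show "(\<Sum>y<L. (cmod (\<Phi> (f k i) y))\<^sup>2) = (\<Sum>j<l k. (cmod (s k * \<phi> k i j))\<^sup>2)" using k
        by simp
  qed
  finally show ?thesis by (simp add: norm_mult power_mult_distrib sum_distrib_left)
qed

text \<open>When the label sits in the right factor of a register, fixing the value \<open>a\<close>
  of the left factor leaves a superposition of the same kind. In the application \<open>a\<close> is
  a measured output.\<close>

lemma mixes_inner_restrict: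
  assumes mx: "mixes n s (\<lambda>k. Z * t k) (Z * T) (emb_inner t T f) l L h \<Phi> \<phi>"
    and f: "embeds n t T f" and a: "a < Z"
  shows "mixes n s t T f l L h (\<lambda>g y. \<Phi> (a * T + g) y) (\<lambda>k g y. \<phi> k (a * t k + g) y)"
  unfolding mixes_def
proof (intro conjI allI impI)
  fix k i j assume k: "k < n" "i < t k" "j < l k"
  have "\<Phi> (emb_inner t T f k (a * t k + i)) (h k j) = s k * \<phi> k (a * t k + i) j"
    by (rule mixes_block[OF mx k(1) enc_less[OF a k(2)] k(3)])
  then show "\<Phi> (a * T + f k i) (h k j) = s k * \<phi> k (a * t k + i) j"
    using k by (simp add: emb_inner_def)
next
  fix x y assume x: "x < T" "y < L" and out: "\<forall>k<n. \<forall>i<t k. \<forall>j<l k. x = f k i \<longrightarrow> y \<noteq> h k j"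
  show "\<Phi> (a * T + x) y = 0"
  proof (rule mixes_outside[OF mx enc_less[OF a x(1)] x(2)])
    fix k i j assume k: "k < n" "i < Z * t k" "j < l k" "a * T + x = emb_inner t T f k i"
        "y = h k j"
    have d: "i mod t k < t k" using div_mod_less[OF k(2)] by simp
    have "f k (i mod t k) < T" by (rule embeds_less[OF f k(1) d])
    then have "x = f k (i mod t k)" using k(4) x by (auto simp: emb_inner_def enc_inject)
    then show False using out k d by blast
  qed
qed

definition mix_fun :: "nat \<Rightarrow> (nat \<Rightarrow> complex) \<Rightarrow> (nat \<Rightarrow> nat) \<Rightarrow> (nat \<Rightarrow> nat \<Rightarrow> nat) \<Rightarrow> (nat \<Rightarrow> nat)
    \<Rightarrow> (nat \<Rightarrow> nat \<Rightarrow> nat) \<Rightarrow>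
    (nat \<Rightarrow> nat \<Rightarrow> nat \<Rightarrow> complex) \<Rightarrow> nat \<Rightarrow> nat \<Rightarrow> complex" where
  "mix_fun n s m f l h \<phi> x y = (\<Sum>k<n. \<Sum>i<m k. \<Sum>j<l k. if x = f k i \<and> y = h k j then s k * \<phi> k i j
      else 0)"

lemma mixes_mix_fun:
  assumes f: "embeds n m M f" and h: "embeds n l L h"
  shows "mixes n s m M f l L h (mix_fun n s m f l h \<phi>) \<phi>"
  unfolding mixes_def
proof (intro conjI allI impI)
  fix k i j assume k: "k < n" "i < m k" "j < l k"
  have *: "(\<Sum>x\<in>A. if c then F x else 0) = (if c then \<Sum>x\<in>A. F x else (0 :: complex))"
      for A :: "nat set" and c F
    by simp
  have "mix_fun n s m f l h \<phi> (f k i) (h k j)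
      = (\<Sum>k'<n. \<Sum>i'<m k'. \<Sum>j'<l k'. if k' = k then if i' = i then if j' = j then s k * \<phi> k i j else
          0 else 0 else 0)"
    unfolding mix_fun_def using k
    by (intro sum.cong refl) (auto simp: embeds_eq_iff[OF f] embeds_eq_iff[OF h])
  also have "\<dots> = s k * \<phi> k i j" unfolding * using k by simp
  finally show "mix_fun n s m f l h \<phi> (f k i) (h k j) = s k * \<phi> k i j" .
next
  fix x y assume out: "\<forall>k<n. \<forall>i<m k. \<forall>j<l k. x = f k i \<longrightarrow> y \<noteq> h k j"
  show "mix_fun n s m f l h \<phi> x y = 0"
    unfolding mix_fun_def by (intro sum.neutral ballI) (use out in \<open>simp, blast\<close>)
qed

section \<open>Superpositions over three registers\<close>

text \<open>The outer registers carry the label, while the middle one, the message, only has a used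
  range \<open>c k\<close> that depends on it. The condition favours neither bracketing, so the
  conversions below can group the message with either party, whoever acts next.\<close>

definition mixes3 :: "nat \<Rightarrow> (nat \<Rightarrow> complex) \<Rightarrow> (nat \<Rightarrow> nat) \<Rightarrow> nat \<Rightarrow> (nat \<Rightarrow> nat \<Rightarrow> nat) \<Rightarrow> (nat \<Rightarrow> nat)
    \<Rightarrow> nat \<Rightarrow>
    (nat \<Rightarrow> nat) \<Rightarrow> nat \<Rightarrow> (nat \<Rightarrow> nat \<Rightarrow> nat) \<Rightarrow> (nat \<Rightarrow> complex) \<Rightarrow> (nat \<Rightarrow> nat \<Rightarrow> complex) \<Rightarrow> bool" where
  "mixes3 n s a A e c C b B e' F \<phi> \<longleftrightarrow>
     (\<forall>k<n. \<forall>i<a k. \<forall>x<c k. \<forall>j<b k. F ((e k i * C + x) * B + e' k j) = s k * \<phi> k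
         ((i * c k + x) * b k + j)) \<and>
     (\<forall>i<A. \<forall>x<C. \<forall>j<B. (\<forall>k<n. \<forall>i'<a k. \<forall>j'<b k. i = e k i' \<longrightarrow> x < c k \<longrightarrow> j \<noteq> e' k j') \<longrightarrow>
        F ((i * C + x) * B + j) = 0)"

context
  fixes n :: nat and s :: "nat \<Rightarrow> complex" and a :: "nat \<Rightarrow> nat" and A :: nat
      and e :: "nat \<Rightarrow> nat \<Rightarrow> nat"
    and c :: "nat \<Rightarrow> nat" and C :: nat and b :: "nat \<Rightarrow> nat" and B :: nat and e' :: "nat \<Rightarrow> nat \<Rightarrow> nat"
    and F :: "nat \<Rightarrow> complex" and \<phi> :: "nat \<Rightarrow> nat \<Rightarrow> complex"
  assumes e: "embeds n a A e" and e': "embeds n b B e'" and cC: "\<And>k. k < n \<Longrightarrow> c k \<le> C"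
begin

lemma mixes3_left:
  assumes mx: "mixes3 n s a A e c C b B e' F \<phi>"
  shows "mixes n s (\<lambda>k. a k * c k) (A * C) (emb_outer c C e) b B e' (\<lambda>x y. F (x * B + y)) (\<lambda>k x y.
      \<phi> k (x * b k + y))"
  unfolding mixes_def
proof (intro conjI allI impI)
  fix k i j assume k: "k < n" "i < a k * c k" "j < b k"
  note d = div_mod_less[OF k(2)]
  have "F ((e k (i div c k) * C + i mod c k) * B + e' k j)
      = s k * \<phi> k ((i div c k * c k + i mod c k) * b k + j)"
    using mx k d unfolding mixes3_def by blast
  then show "F (emb_outer c C e k i * B + e' k j) = s k * \<phi> k (i * b k + j)"
    by (simp add: emb_outer_def)
next
  fix x y assume x: "x < A * C" "y < B"
      and out: "\<forall>k<n. \<forall>i<a k * c k. \<forall>j<b k. x = emb_outer c C e k i \<longrightarrow> y \<noteq> e' k j"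
  note d = div_mod_less[OF x(1)]
  have "y \<noteq> e' k j" if k: "k < n" "i < a k" "j < b k" "x div C = e k i" "x mod C < c k" for k i j
  proof -
    have "x = emb_outer c C e k (i * c k + x mod C)" using k div_mult_mod_eq[of x C]
        by (simp add: emb_outer_def)
    then show ?thesis using out k enc_less[OF k(2) k(5)] by blast
  qed
  then have "F ((x div C * C + x mod C) * B + y) = 0"
    using mx d x unfolding mixes3_def by blast
  then show "F (x * B + y) = 0" by simp
qed

lemma mixes3_leftD:
  assumes mx: "mixes n s (\<lambda>k. a k * c k) (A * C) (emb_outer c C e) b B e' (\<lambda>x y. F (x * B + y))
      (\<lambda>k x y. \<phi> k (x * b k + y))"
  shows "mixes3 n s a A e c C b B e' F \<phi>"
  unfolding mixes3_def
proof (intro conjI allI impI)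
  fix k i x j assume k: "k < n" "i < a k" "x < c k" "j < b k"
  show "F ((e k i * C + x) * B + e' k j) = s k * \<phi> k ((i * c k + x) * b k + j)"
    using mixes_block[OF mx k(1) enc_less[OF k(2,3)] k(4)] k by (simp add: emb_outer_def)
next
  fix i x j assume x: "i < A" "x < C" "j < B"
      and out: "\<forall>k<n. \<forall>i'<a k. \<forall>j'<b k. i = e k i' \<longrightarrow> x < c k \<longrightarrow> j \<noteq> e' k j'"
  show "F ((i * C + x) * B + j) = 0"
  proof (rule mixes_outside[OF mx enc_less[OF x(1,2)] x(3)])
    fix k i' j' assume k: "k < n" "i' < a k * c k" "j' < b k" "i * C + x = emb_outer c C e k i'"
        "j = e' k j'"
    note d = div_mod_less[OF k(2)]
    have "i' mod c k < C" using d cC[OF k(1)] by linarith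
    then have "i = e k (i' div c k)" "x = i' mod c k" using k(4) x
        by (auto simp: emb_outer_def enc_inject)
    then show False using out k d by auto
  qed
qed

lemma mixes3_right:
  assumes mx: "mixes3 n s a A e c C b B e' F \<phi>"
  shows "mixes n s a A e (\<lambda>k. c k * b k) (C * B) (emb_inner b B e') (\<lambda>x y. F (x * (C * B) + y))
      (\<lambda>k x y. \<phi> k (x * (c k * b k) + y))"
  unfolding mixes_def
proof (intro conjI allI impI)
  fix k i j assume k: "k < n" "i < a k" "j < c k * b k"
  note d = div_mod_less[OF k(3)]
  have "F ((e k i * C + j div b k) * B + e' k (j mod b k))
      = s k * \<phi> k ((i * c k + j div b k) * b k + j mod b k)"
    using mx k d unfolding mixes3_def by blast
  moreover have "(i * c k + j div b k) * b k + j mod b k = i * (c k * b k) + j"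
    by (simp add: distrib_right mult.assoc add.assoc)
  ultimately show "F (e k i * (C * B) + emb_inner b B e' k j) = s k * \<phi> k (i * (c k * b k) + j)"
    by (simp add: emb_inner_def distrib_right mult.assoc add.assoc)
next
  fix x y assume x: "x < A" "y < C * B"
      and out: "\<forall>k<n. \<forall>i<a k. \<forall>j<c k * b k. x = e k i \<longrightarrow> y \<noteq> emb_inner b B e' k j"
  note d = div_mod_less[OF x(2)]
  have "y mod B \<noteq> e' k j" if k: "k < n" "i < a k" "j < b k" "x = e k i" "y div B < c k" for k i j
  proof
    assume "y mod B = e' k j"
    then have "y = emb_inner b B e' k (y div B * b k + j)"
      using k div_mult_mod_eq[of y B] by (simp add: emb_inner_def)
    then show False using out k enc_less[OF k(5) k(3)] by blast
  qed
  then have "F ((x * C + y div B) * B + y mod B) = 0"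
    using mx d x unfolding mixes3_def by blast
  then show "F (x * (C * B) + y) = 0" by (simp add: distrib_right mult.assoc add.assoc)
qed

lemma mixes3_rightD:
  assumes mx: "mixes n s a A e (\<lambda>k. c k * b k) (C * B) (emb_inner b B e') (\<lambda>x y. F (x * (C * B)
      + y)) (\<lambda>k x y. \<phi> k (x * (c k * b k) + y))"
  shows "mixes3 n s a A e c C b B e' F \<phi>"
  unfolding mixes3_def
proof (intro conjI allI impI)
  fix k i x j assume k: "k < n" "i < a k" "x < c k" "j < b k"
  show "F ((e k i * C + x) * B + e' k j) = s k * \<phi> k ((i * c k + x) * b k + j)"
    using mixes_block[OF mx k(1,2) enc_less[OF k(3,4)]] k
    by (simp add: emb_inner_def distrib_right mult.assoc add.assoc)
next
  fix i x j assume x: "i < A" "x < C" "j < B"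
      and out: "\<forall>k<n. \<forall>i'<a k. \<forall>j'<b k. i = e k i' \<longrightarrow> x < c k \<longrightarrow> j \<noteq> e' k j'"
  have "F (i * (C * B) + (x * B + j)) = 0"
  proof (rule mixes_outside[OF mx x(1) enc_less[OF x(2,3)]])
    fix k i' j' assume k: "k < n" "i' < a k" "j' < c k * b k" "i = e k i'"
        "x * B + j = emb_inner b B e' k j'"
    note d = div_mod_less[OF k(3)]
    have "e' k (j' mod b k) < B" using d embeds_less[OF e' k(1)] by blast
    then have "x = j' div b k" "j = e' k (j' mod b k)" using k(5) x
        by (auto simp: emb_inner_def enc_inject)
    then show False using out k d by auto
  qed
  then show "F ((i * C + x) * B + j) = 0" by (simp add: distrib_right mult.assoc add.assoc)
qed

lemma mixes3_cross:
  assumes mx: "mixes3 n s a A e c C b B e' F \<phi>" and k: "k < n" "i < a k" "k' < n" "j < b k'"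
      and x: "x < C"
  shows "F ((e k i * C + x) * B + e' k' j) = (if k = k' \<and> x < c k
      then s k * \<phi> k ((i * c k + x) * b k + j) else 0)"
proof (cases "k = k' \<and> x < c k")
  case True
  then show ?thesis using mx k unfolding mixes3_def by auto
next
  case False
  have "\<forall>l<n. \<forall>i'<a l. \<forall>j'<b l. e k i = e l i' \<longrightarrow> x < c l \<longrightarrow> e' k' j \<noteq> e' l j'"
    using False k embeds_eq_iff[OF e] embeds_eq_iff[OF e'] by auto
  then have "F ((e k i * C + x) * B + e' k' j) = 0"
    using mx x embeds_less[OF e k(1,2)] embeds_less[OF e' k(3,4)] unfolding mixes3_def by blast
  then show ?thesis by (subst if_not_P[OF False])
qed

lemma mixes3_outside:
  assumes mx: "mixes3 n s a A e c C b B e' F \<phi>" and x: "i < A" "x < C" "j < B"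
    and "\<And>k i' j'. k < n \<Longrightarrow> i' < a k \<Longrightarrow> j' < b k \<Longrightarrow> i = e k i' \<Longrightarrow> x < c k \<Longrightarrow> j = e' k j' \<Longrightarrow> False"
  shows "F ((i * C + x) * B + j) = 0"
  using assms unfolding mixes3_def by blast

end

subsection \<open>Mixtures of protocols\<close>

lemma initial_state_index:
  fixes P :: "('x::finite, 'y::finite, 'za::finite, 'zb::finite) protocol"
  assumes sh: "shared P \<in> carrier_mat (dim_TA P * dim_TB P) 1"
    and h: "x' < CARD('x)" "t < dim_TA P" "y' < CARD('y)" "t' < dim_TB P"
  shows "initial_state P x y $$ ((x' * dim_TA P + t) * (CARD('y) * dim_TB P) + (y' * dim_TB P + t'),
      0)
    = (if x' = to_nat_on UNIV x \<and> y' = to_nat_on UNIV y then shared P $$ (t * dim_TB P + t', 0) else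
        0)"
proof -
  let ?A = "kron (basis_ket x) (1\<^sub>m (dim_TA P))" and ?B = "kron (basis_ket y) (1\<^sub>m (dim_TB P))"
  have A: "?A \<in> carrier_mat (CARD('x) * dim_TA P) (1 * dim_TA P)"
      and B: "?B \<in> carrier_mat (CARD('y) * dim_TB P) (1 * dim_TB P)"
    by (intro kron_carrier; simp add: basis_ket_def)+
  have a: "?A $$ (x' * dim_TA P + t, k) = (if k = t \<and> x' = to_nat_on UNIV x then 1 else 0)"
      if "k < dim_TA P" for k
    using kron_enc[of "basis_ket x" "CARD('x)" 1 "1\<^sub>m (dim_TA P)" "dim_TA P" "dim_TA P" x' 0 t k] h
        that
    by (auto simp: basis_ket_def)
  have b: "?B $$ (y' * dim_TB P + t', k) = (if k = t' \<and> y' = to_nat_on UNIV y then 1 else 0)"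
      if "k < dim_TB P" for k
    using kron_enc[of "basis_ket y" "CARD('y)" 1 "1\<^sub>m (dim_TB P)" "dim_TB P" "dim_TB P" y' 0 t' k] h
        that
    by (auto simp: basis_ket_def)
  have "initial_state P x y $$ ((x' * dim_TA P + t) * (CARD('y) * dim_TB P) + (y' * dim_TB P + t'),
      0)
      = (\<Sum>k<1 * dim_TA P. ?A $$ (x' * dim_TA P + t, k) * (\<Sum>l<1 * dim_TB P. ?B $$
          (y' * dim_TB P + t', l) * shared P $$ (k * (1 * dim_TB P) + l, 0)))"
    unfolding initial_state_def using sh h by (intro kron_apply_both[OF A B] enc_less) auto
  also have "\<dots> = (\<Sum>k<dim_TA P. if k = t then
      if x' = to_nat_on UNIV x \<and> y' = to_nat_on UNIV y then shared P $$ (t * dim_TB P + t', 0) else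
          0 else 0)"
  proof -
    have "(\<Sum>l<dim_TB P. ?B $$ (y' * dim_TB P + t', l) * shared P $$ (k * dim_TB P + l, 0))
        = (\<Sum>l<dim_TB P. if l = t' then if y' = to_nat_on UNIV y then shared P $$ (k * dim_TB P + t',
            0) else 0 else 0)" for k
      by (intro sum.cong refl) (simp add: b)
    then have "(\<Sum>l<dim_TB P. ?B $$ (y' * dim_TB P + t', l) * shared P $$ (k * dim_TB P + l, 0))
        = (if y' = to_nat_on UNIV y then shared P $$ (k * dim_TB P + t', 0) else 0)" for k
      using h by simp
    then show ?thesis unfolding mult_1 by (intro sum.cong refl) (simp add: a)
  qed
  finally show ?thesis using h by simp
qed

lemma isometry_1_iff:
  "isometry 1 m v \<longleftrightarrow> v \<in> carrier_mat m 1 \<and> (\<Sum>k<m. (cmod (v $$ (k, 0)))\<^sup>2) = 1"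
proof -
  have "(\<Sum>k<m. cnj (v $$ (k, 0)) * v $$ (k, 0)) = of_real (\<Sum>k<m. (cmod (v $$ (k, 0)))\<^sup>2)"
    unfolding of_real_sum complex_norm_square by (simp add: mult.commute)
  then have e: "(\<Sum>k<m. cnj (v $$ (k, 0)) * v $$ (k, 0)) = 1 \<longleftrightarrow> (\<Sum>k<m. (cmod (v $$ (k, 0)))\<^sup>2) = 1"
    by (simp only: of_real_eq_1_iff)
  have "isometry 1 m v \<longleftrightarrow> v \<in> carrier_mat m 1 \<and> (\<Sum>k<m. cnj (v $$ (k, 0)) * v $$ (k, 0)) = 1"
    by (simp add: isometry_iff)
  then show ?thesis unfolding e .
qed

lemma input_run_0: "valid_protocol Q \<Longrightarrow> input_run Q 0 z = initial_state Q (fst z) (snd z)"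
  using initial_state_carrier[of Q "fst z" "snd z"] by (simp add: input_run_def)

lemma input_run_Suc_odd:
  assumes v: "valid_protocol Q" and i: "i < rounds Q" "odd (Suc i)"
      and j: "x < dim_A Q (Suc i) * dim_C Q (Suc i)" "y < dim_B Q i"
  shows "input_run Q (Suc i) z $$ (x * dim_B Q i + y, 0)
    = (\<Sum>k<dim_A Q i * dim_C Q i. round_iso Q (Suc i) $$ (x, k) * input_run Q i z $$
        (k * dim_B Q i + y, 0))"
proof -
  note R = round_iso_carrier(1)[OF v i]
  have V: "round_iso Q (Suc i) \<in> carrier_mat (dim_A Q (Suc i) * dim_C Q (Suc i)) (dim_A Q i
      * dim_C Q i)"
    using R isometry_carrier by blast
  have K: "kron (round_iso Q (Suc i)) (1\<^sub>m (dim_B Q i))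
      \<in> carrier_mat (dim_ACB Q (Suc i)) (dim_ACB Q i)"
    using R V by (simp add: kron_carrier)
  have rc: "run Q i \<in> carrier_mat (dim_ACB Q i) (dim_ACB Q 0)"
      by (rule run_carrier[OF v]) (use i in simp)
  have "input_run Q (Suc i) z = kron (round_iso Q (Suc i)) (1\<^sub>m (dim_B Q i)) * input_run Q i z"
    unfolding input_run_def using i K rc initial_state_carrier[OF v]
    by (simp add: assoc_mult_mat[OF K rc initial_state_carrier[OF v]])
  then show ?thesis
    using kron_apply_left[OF V _ j] input_run_carrier[OF v, of i] i by simp
qed

lemma input_run_Suc_even:
  assumes v: "valid_protocol Q" and i: "i < rounds Q" "even (Suc i)"
      and j: "x < dim_A Q i" "y < dim_C Q (Suc i) * dim_B Q (Suc i)"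
  shows "input_run Q (Suc i) z $$ (x * (dim_C Q (Suc i) * dim_B Q (Suc i)) + y, 0)
    = (\<Sum>k<dim_C Q i * dim_B Q i. round_iso Q (Suc i) $$ (y, k) * input_run Q i z $$
        (x * (dim_C Q i * dim_B Q i) + k, 0))"
proof -
  note R = round_iso_carrier(2)[OF v i]
  have V: "round_iso Q (Suc i) \<in> carrier_mat (dim_C Q (Suc i) * dim_B Q (Suc i)) (dim_C Q i
      * dim_B Q i)"
    using R isometry_carrier by blast
  have K: "kron (1\<^sub>m (dim_A Q i)) (round_iso Q (Suc i))
      \<in> carrier_mat (dim_A Q i * (dim_C Q (Suc i) * dim_B Q (Suc i))) (dim_ACB Q i)"
    unfolding mult.assoc using V by (intro kron_carrier) auto
  have rc: "run Q i \<in> carrier_mat (dim_ACB Q i) (dim_ACB Q 0)"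
      by (rule run_carrier[OF v]) (use i in simp)
  have "input_run Q (Suc i) z = kron (1\<^sub>m (dim_A Q i)) (round_iso Q (Suc i)) * input_run Q i z"
    unfolding input_run_def using i
    by (simp add: assoc_mult_mat[OF K rc initial_state_carrier[OF v]])
  moreover have "input_run Q i z \<in> carrier_mat (dim_A Q i * (dim_C Q i * dim_B Q i)) 1"
    using input_run_carrier[OF v, of i z] i by (simp add: mult.assoc)
  ultimately show ?thesis using kron_apply_right[OF V _ j] by simp
qed

definition output_vec :: "('x::finite, 'y::finite, 'za::finite, 'zb::finite) protocol \<Rightarrow> 'x \<times> 'y
    \<Rightarrow> complex mat" where
  "output_vec Q z = kron (final_A Q) (final_B Q) * input_run Q (rounds Q) z"

lemma final_carrier:
  fixes Q :: "('x::finite, 'y::finite, 'za::finite, 'zb::finite) protocol"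
  assumes "valid_protocol Q"
  defines "odd_r \<equiv> odd (rounds Q)" and "A \<equiv> dim_A Q (rounds Q)" and "B \<equiv> dim_B Q (rounds Q)"
      and "C \<equiv> dim_C Q (rounds Q)"
  shows "final_A Q \<in> carrier_mat (CARD('za) * dim_GA Q) (if odd_r then A else A * C)"
    and "final_B Q \<in> carrier_mat (CARD('zb) * dim_GB Q) (if odd_r then C * B else B)"
  using assms by (auto simp: valid_protocol_def Let_def intro: isometry_carrier)

lemma output_vec_index:
  fixes Q :: "('x::finite, 'y::finite, 'za::finite, 'zb::finite) protocol"
  assumes v: "valid_protocol Q" and h: "x < CARD('za) * dim_GA Q" "y < CARD('zb) * dim_GB Q"
  defines "odd_r \<equiv> odd (rounds Q)" and "A \<equiv> dim_A Q (rounds Q)" and "B \<equiv> dim_B Q (rounds Q)"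
      and "C \<equiv> dim_C Q (rounds Q)"
  defines "nB \<equiv> if odd_r then C * B else B"
  shows "output_vec Q z $$ (x * (CARD('zb) * dim_GB Q) + y, 0)
      = (\<Sum>k<(if odd_r then A else A * C). final_A Q $$ (x, k) *
    (\<Sum>l<nB. final_B Q $$ (y, l) * input_run Q (rounds Q) z $$ (k * nB + l, 0)))"
  unfolding output_vec_def nB_def
proof (rule kron_apply_both)
  show "final_A Q \<in> carrier_mat (CARD('za) * dim_GA Q) (if odd_r then A else A * C)"
    "final_B Q \<in> carrier_mat (CARD('zb) * dim_GB Q) (if odd_r then C * B else B)"
    using final_carrier[OF v] by (auto simp: odd_r_def A_def B_def C_def split: if_splits)
  show "input_run Q (rounds Q) z \<in> carrier_mat ((if odd_r then A else A * C) * (if odd_r then C * B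
      else B)) 1"
    using input_run_carrier[OF v order_refl, of z] by (simp add: A_def B_def C_def mult.assoc)
qed (use h in auto)

lemma output_prob_eq:
  fixes Q :: "('x::finite, 'y::finite, 'za::finite, 'zb::finite) protocol"
  shows "output_prob Q x y za zb = (\<Sum>g<dim_GA Q. \<Sum>h<dim_GB Q. (cmod (output_vec Q (x, y) $$
    ((to_nat_on UNIV za * dim_GA Q + g) * (CARD('zb) * dim_GB Q) + (to_nat_on UNIV zb * dim_GB Q +
        h), 0)))\<^sup>2)"
  by (simp add: output_prob_def output_vec_def input_run_def Let_def)

section \<open>Construction of the mixed protocol\<close>

locale protocol_mixture =
  fixes P :: "nat \<Rightarrow> ('x::finite, 'y::finite, 'za::finite, 'zb::finite) protocol" and n r :: nat
      and p :: "nat \<Rightarrow> real"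
  assumes valid: "\<And>k. valid_protocol (P k)" and rounds: "\<And>k. rounds (P k) = r"
    and p_nonneg: "\<And>k. p k \<ge> 0" and p_sum: "(\<Sum>k<n. p k) = 1"
begin

text \<open>The shared randomness is the index \<open>k\<close>, which both parties keep as the residue modulo \<open>n\<close> of the index of
  their own register.  The message register carries no such label.  The input registers have to remain the
  leading factors of \<open>A\<^sub>0\<close> and \<open>B\<^sub>0\<close>, hence the exceptions in \<open>eA\<close> and \<open>eB\<close> before a party acts for the
  first time.\<close>

abbreviation "interleave \<equiv> \<lambda>k i. n * i + k"

definition TA where "TA = n * (\<Sum>k<n. dim_TA (P k))"
definition TB where "TB = n * (\<Sum>k<n. dim_TB (P k))"

definition eA where "eA i = (if i = 0 then emb_inner (\<lambda>k. dim_TA (P k)) TA interleave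
    else interleave)" for i :: nat
definition eB where "eB i = (if i \<le> 1 then emb_inner (\<lambda>k. dim_TB (P k)) TB interleave
    else interleave)" for i :: nat

text \<open>The sum bounds the message dimension of each protocol. The additional 1 keeps the
  register nonempty, so that the completion of an isometry can use message 0.\<close>

definition dC where "dC i = (if i = 0 then 1 else Suc (\<Sum>k<n. dim_C (P k) i))" for i :: nat

text \<open>After each of her rounds Alice has room for the interleaved blocks, plus a copy of the
  whole space on which the round acted, into which the completion maps. The register of Bob is built
  in the same way.\<close>

primrec dA where
  "dA 0 = CARD('x) * TA"
| "dA (Suc i) = (if odd (Suc i) then n * (\<Sum>k<n. dim_A (P k) (Suc i)) + dA i * dC i else dA i)"

primrec dB where
  "dB 0 = CARD('y) * TB"
| "dB (Suc i) = (if odd (Suc i) then dB i else n * (\<Sum>k<n. dim_B (P k) (Suc i)) + dC i * dB i)"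

definition eAC where "eAC i = emb_outer (\<lambda>k. dim_C (P k) i) (dC i) (eA i)"
definition eCB where "eCB i = emb_inner (\<lambda>k. dim_B (P k) i) (dB i) (eB i)"

text \<open>Off the blocks, the vector with index \<open>x\<close> is sent to message 0 and to a
  position of Alice beyond all interleaved blocks; in \<open>isoB\<close> Bob's register plays this
  role.\<close>

definition isoA where
  "isoA i = block_iso n (\<lambda>k. dim_A (P k) i * dim_C (P k) i) (dA i * dC i) (eAC i)
     (\<lambda>k. dim_A (P k) (Suc i) * dim_C (P k) (Suc i)) (dA (Suc i) * dC (Suc i)) (eAC (Suc i))
     (\<lambda>x. (n * (\<Sum>k<n. dim_A (P k) (Suc i)) + x) * dC (Suc i) + 0) (\<lambda>k. round_iso (P k) (Suc i))"

definition isoB where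
  "isoB i = block_iso n (\<lambda>k. dim_C (P k) i * dim_B (P k) i) (dC i * dB i) (eCB i)
     (\<lambda>k. dim_C (P k) (Suc i) * dim_B (P k) (Suc i)) (dC (Suc i) * dB (Suc i)) (eCB (Suc i))
     (\<lambda>x. 0 * dB (Suc i) + (n * (\<Sum>k<n. dim_B (P k) (Suc i)) + x)) (\<lambda>k. round_iso (P k) (Suc i))"

text \<open>From here on, the registers on which the final isometries act: the last message belongs
  to Bob if \<open>r\<close> is odd and to Alice otherwise.\<close>

definition mixA where "mixA = (\<lambda>k. if odd r then dim_A (P k) r else dim_A (P k) r * dim_C (P k) r)"
definition mixB where "mixB = (\<lambda>k. if odd r then dim_C (P k) r * dim_B (P k) r else dim_B (P k) r)"
definition dimA where "dimA = (if odd r then dA r else dA r * dC r)"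
definition dimB where "dimB = (if odd r then dC r * dB r else dB r)"
definition embA where "embA = (if odd r then eA r else eAC r)"
definition embB where "embB = (if odd r then eCB r else eB r)"
text \<open>The summand \<open>dimA\<close> is room for the completion of the final isometry. The
  label moves into the discarded register, as the output register must not contain it.\<close>

definition GA where "GA = n * (\<Sum>k<n. dim_GA (P k)) + dimA"
definition GB where "GB = n * (\<Sum>k<n. dim_GB (P k)) + dimB"
definition outA where "outA = emb_inner (\<lambda>k. dim_GA (P k)) GA interleave"
definition outB where "outB = emb_inner (\<lambda>k. dim_GB (P k)) GB interleave"

definition finA where
  "finA = block_iso n mixA dimA embA (\<lambda>k. CARD('za) * dim_GA (P k)) (CARD('za) * GA) outA
     (\<lambda>x. 0 * GA + (n * (\<Sum>k<n. dim_GA (P k)) + x)) (\<lambda>k. final_A (P k))"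
definition finB where
  "finB = block_iso n mixB dimB embB (\<lambda>k. CARD('zb) * dim_GB (P k)) (CARD('zb) * GB) outB
     (\<lambda>x. 0 * GB + (n * (\<Sum>k<n. dim_GB (P k)) + x)) (\<lambda>k. final_B (P k))"

definition amplitude where "amplitude k = complex_of_real (sqrt (p k))"

text \<open>The shared state has to be pure, so the random index becomes a coherent superposition
  with amplitudes \<open>sqrt (p k)\<close> and a copy of the label on each side.\<close>

definition shared_mix where
  "shared_mix = Matrix.mat (TA * TB) 1 (\<lambda>(i, _).
     mix_fun n amplitude (\<lambda>k. dim_TA (P k)) interleave (\<lambda>k. dim_TB (P k)) interleave
       (\<lambda>k t t'. shared (P k) $$ (t * dim_TB (P k) + t', 0)) (i div TB) (i mod TB))"

definition mixture :: "('x, 'y, 'za, 'zb) protocol" where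
  "mixture = Protocol r TA TB shared_mix dA dB dC (\<lambda>i. if odd i then isoA (i - 1)
      else isoB (i - 1)) GA GB finA finB"

lemma mixture_sel [simp]:
  "rounds mixture = r" "dim_TA mixture = TA" "dim_TB mixture = TB" "shared mixture = shared_mix"
  "dim_A mixture = dA" "dim_B mixture = dB" "dim_C mixture = dC"
  "round_iso mixture = (\<lambda>i. if odd i then isoA (i - 1) else isoB (i - 1))"
  "dim_GA mixture = GA" "dim_GB mixture = GB" "final_A mixture = finA" "final_B mixture = finB"
  by (simp_all add: mixture_def)

section \<open>Validity of the mixed protocol\<close>

lemma dims0: "dim_A (P k) 0 = CARD('x) * dim_TA (P k)" "dim_B (P k) 0 = CARD('y) * dim_TB (P k)"
    "dim_C (P k) 0 = 1"
  using valid[of k] by (auto simp: valid_protocol_def)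

lemma round_odd:
  assumes "i < r" "odd (Suc i)"
  shows "dim_B (P k) (Suc i) = dim_B (P k) i"
    and "isometry (dim_A (P k) i * dim_C (P k) i) (dim_A (P k) (Suc i)
        * dim_C (P k) (Suc i)) (round_iso (P k) (Suc i))"
  using round_iso_carrier(1)[OF valid, of i k] assms by (auto simp: rounds)

lemma round_even:
  assumes "i < r" "even (Suc i)"
  shows "dim_A (P k) (Suc i) = dim_A (P k) i"
    and "isometry (dim_C (P k) i * dim_B (P k) i) (dim_C (P k) (Suc i)
        * dim_B (P k) (Suc i)) (round_iso (P k) (Suc i))"
  using round_iso_carrier(2)[OF valid, of i k] assms by (auto simp: rounds)

text \<open>A round of Alice provides the room, and the rounds of Bob change neither side. Bob first
  acts in round 2, which explains the bound on \<open>i\<close> in \<open>dB_ge\<close>.\<close>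

lemma dA_ge: "1 \<le> i \<Longrightarrow> i \<le> r \<Longrightarrow> n * (\<Sum>k<n. dim_A (P k) i) \<le> dA i"
proof (induction i)
  case (Suc i)
  show ?case
  proof (cases "odd (Suc i)")
    case False
    then have "1 \<le> i" by (cases i) auto
    then show ?thesis using Suc False round_even(1)[of i] by simp
  qed simp
qed simp

lemma dB_ge: "2 \<le> i \<Longrightarrow> i \<le> r \<Longrightarrow> n * (\<Sum>k<n. dim_B (P k) i) \<le> dB i"
proof (induction i)
  case (Suc i)
  show ?case
  proof (cases "odd (Suc i)")
    case True
    then have "2 \<le> i" using Suc.prems by presburger
    then show ?thesis using Suc True round_odd(1)[of i] by simp
  qed simp
qed simp

lemma embeds_eA: "i \<le> r \<Longrightarrow> embeds n (\<lambda>k. dim_A (P k) i) (dA i) (eA i)"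
proof (cases "i = 0")
  case True
  have "embeds n (\<lambda>k. CARD('x) * dim_TA (P k)) (CARD('x)
      * TA) (emb_inner (\<lambda>k. dim_TA (P k)) TA interleave)"
    by (intro embeds_inner embeds_interleave) (auto simp: TA_def)
  then show ?thesis using True by (simp add: eA_def dims0)
next
  case False
  assume "i \<le> r"
  then show ?thesis using False dA_ge[of i] by (simp add: eA_def embeds_interleave)
qed

lemma embeds_eB: "i \<le> r \<Longrightarrow> embeds n (\<lambda>k. dim_B (P k) i) (dB i) (eB i)"
proof (cases "i \<le> 1")
  case True
  assume "i \<le> r"
  have "embeds n (\<lambda>k. CARD('y) * dim_TB (P k)) (CARD('y)
      * TB) (emb_inner (\<lambda>k. dim_TB (P k)) TB interleave)"
    by (intro embeds_inner embeds_interleave) (auto simp: TB_def)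
  moreover have "dim_B (P k) i = dim_B (P k) 0" for k
    using True \<open>i \<le> r\<close> round_odd(1)[of 0 k] by (cases i) auto
  moreover have "dB i = dB 0" using True by (cases i) auto
  ultimately show ?thesis using True by (simp add: eB_def dims0)
next
  case False
  assume "i \<le> r"
  then show ?thesis using False dB_ge[of i] by (simp add: eB_def embeds_interleave)
qed

lemma dim_C_le: "k < n \<Longrightarrow> dim_C (P k) i \<le> dC i"
proof (cases "i = 0")
  case False
  assume "k < n"
  then have "dim_C (P k) i \<le> (\<Sum>k<n. dim_C (P k) i)"
    by (intro member_le_sum[of k "{..<n}" "\<lambda>k. dim_C (P k) i"]) auto
  then show ?thesis using False by (simp add: dC_def)
qed (simp add: dims0 dC_def)

lemma dC_pos: "dC i > 0" by (simp add: dC_def)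

lemma embeds_eAC: "i \<le> r \<Longrightarrow> embeds n (\<lambda>k. dim_A (P k) i * dim_C (P k) i) (dA i * dC i) (eAC i)"
  unfolding eAC_def by (intro embeds_outer embeds_eA dim_C_le)

lemma embeds_eCB: "i \<le> r \<Longrightarrow> embeds n (\<lambda>k. dim_C (P k) i * dim_B (P k) i) (dC i * dB i) (eCB i)"
  unfolding eCB_def by (intro embeds_inner embeds_eB dim_C_le)

lemma interleave_less: "k < n \<Longrightarrow> i < m k \<Longrightarrow> n * i + k < n * (\<Sum>k<n. m k)"
  using embeds_less[OF embeds_interleave[of n m]] by blast

text \<open>Interleaved blocks occupy the positions of Alice below \<open>n\<close> times the sum of
  the dimensions, and the completion uses those from there on, so the targets are disjoint.\<close>

lemma block_embedding_isoA:
  assumes i: "i < r" "odd (Suc i)"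
  shows "block_embedding n (\<lambda>k. dim_A (P k) i * dim_C (P k) i) (dA i * dC i) (eAC i)
     (\<lambda>k. dim_A (P k) (Suc i) * dim_C (P k) (Suc i)) (dA (Suc i) * dC (Suc i)) (eAC (Suc i))
     (\<lambda>x. (n * (\<Sum>k<n. dim_A (P k) (Suc i)) + x) * dC (Suc i) + 0)"
proof
  show "embeds n (\<lambda>k. dim_A (P k) i * dim_C (P k) i) (dA i * dC i) (eAC i)" using i
      by (intro embeds_eAC) auto
  show "embeds n (\<lambda>k. dim_A (P k) (Suc i) * dim_C (P k) (Suc i)) (dA (Suc i)
      * dC (Suc i)) (eAC (Suc i))"
    using i by (intro embeds_eAC) auto
  show "inj_on (\<lambda>x. (n * (\<Sum>k<n. dim_A (P k) (Suc i)) + x) * dC (Suc i) + 0) {..<dA i * dC i}"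
    using dC_pos[of "Suc i"] by (auto simp: inj_on_def)
  fix x assume x: "x < dA i * dC i"
  then show "(n * (\<Sum>k<n. dim_A (P k) (Suc i)) + x) * dC (Suc i) + 0 < dA (Suc i) * dC (Suc i)"
    using i dC_pos by (intro enc_less) auto
  fix k a assume k: "k < n" "a < dim_A (P k) (Suc i) * dim_C (P k) (Suc i)"
  note d = div_mod_less[OF k(2)]
  have "a mod dim_C (P k) (Suc i) < dC (Suc i)" using d dim_C_le[OF k(1), of "Suc i"] by linarith
  moreover have "n * (a div dim_C (P k) (Suc i)) + k < n * (\<Sum>k<n. dim_A (P k) (Suc i))"
    using d k(1) by (intro interleave_less[where m = "\<lambda>k. dim_A (P k) (Suc i)"]) auto
  ultimately show "eAC (Suc i) k a \<noteq> (n * (\<Sum>k<n. dim_A (P k) (Suc i)) + x) * dC (Suc i) + 0"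
    unfolding eAC_def emb_outer_def using dC_pos[of "Suc i"]
        by (subst enc_inject) (auto simp: eA_def)
qed

lemma block_embedding_isoB:
  assumes i: "i < r" "even (Suc i)"
  shows "block_embedding n (\<lambda>k. dim_C (P k) i * dim_B (P k) i) (dC i * dB i) (eCB i)
     (\<lambda>k. dim_C (P k) (Suc i) * dim_B (P k) (Suc i)) (dC (Suc i) * dB (Suc i)) (eCB (Suc i))
     (\<lambda>x. 0 * dB (Suc i) + (n * (\<Sum>k<n. dim_B (P k) (Suc i)) + x))"
proof
  show "embeds n (\<lambda>k. dim_C (P k) i * dim_B (P k) i) (dC i * dB i) (eCB i)" using i
      by (intro embeds_eCB) auto
  show "embeds n (\<lambda>k. dim_C (P k) (Suc i) * dim_B (P k) (Suc i)) (dC (Suc i)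
      * dB (Suc i)) (eCB (Suc i))"
    using i by (intro embeds_eCB) auto
  show "inj_on (\<lambda>x. 0 * dB (Suc i) + (n * (\<Sum>k<n. dim_B (P k) (Suc i)) + x)) {..<dC i * dB i}"
    by (auto simp: inj_on_def)
  fix x assume x: "x < dC i * dB i"
  then have xB: "n * (\<Sum>k<n. dim_B (P k) (Suc i)) + x < dB (Suc i)" using i by simp
  then show "0 * dB (Suc i) + (n * (\<Sum>k<n. dim_B (P k) (Suc i)) + x) < dC (Suc i) * dB (Suc i)"
    using dC_pos by (intro enc_less) auto
  fix k a assume k: "k < n" "a < dim_C (P k) (Suc i) * dim_B (P k) (Suc i)"
  note d = div_mod_less[OF k(2)]
  have 1: "n * (a mod dim_B (P k) (Suc i)) + k < n * (\<Sum>k<n. dim_B (P k) (Suc i))"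
    using d k(1) by (intro interleave_less[where m = "\<lambda>k. dim_B (P k) (Suc i)"]) auto
  have e: "eB (Suc i) = interleave" using i by (cases i) (auto simp: eB_def)
  show "eCB (Suc i) k a \<noteq> 0 * dB (Suc i) + (n * (\<Sum>k<n. dim_B (P k) (Suc i)) + x)"
    unfolding eCB_def emb_inner_def e using 1 xB by (subst enc_inject) auto
qed

lemma block_embedding_out:
  assumes f: "embeds n m M f" and Z: "Z > (0::nat)" and G: "G = n * (\<Sum>k<n. g k) + M"
  shows "block_embedding n m M f (\<lambda>k. Z * g k) (Z * G) (emb_inner g G interleave) (\<lambda>x. 0 * G
      + (n * (\<Sum>k<n. g k) + x))"
proof
  show "embeds n m M f" by fact
  show "embeds n (\<lambda>k. Z * g k) (Z * G) (emb_inner g G interleave)"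
    by (intro embeds_inner embeds_interleave) (auto simp: G)
  show "inj_on (\<lambda>x. 0 * G + (n * (\<Sum>k<n. g k) + x)) {..<M}" by (auto simp: inj_on_def)
  fix x assume x: "x < M"
  then have xG: "n * (\<Sum>k<n. g k) + x < G" by (simp add: G)
  then show "0 * G + (n * (\<Sum>k<n. g k) + x) < Z * G" using Z by (intro enc_less)
  fix k i assume k: "k < n" "i < Z * g k"
  have 1: "n * (i mod g k) + k < n * (\<Sum>k<n. g k)"
    using div_mod_less[OF k(2)] k(1) by (intro interleave_less) auto
  show "emb_inner g G interleave k i \<noteq> 0 * G + (n * (\<Sum>k<n. g k) + x)"
    unfolding emb_inner_def using 1 xG by (subst enc_inject) auto
qed

lemma embeds_embA: "embeds n mixA dimA embA"
  by (simp add: mixA_def dimA_def embA_def embeds_eA embeds_eAC)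

lemma embeds_embB: "embeds n mixB dimB embB"
  by (simp add: mixB_def dimB_def embB_def embeds_eB embeds_eCB)

lemmas block_embedding_finA =
  block_embedding_out[OF embeds_embA zero_less_card_finite[where 'a = 'za] GA_def, folded outA_def]
lemmas block_embedding_finB =
  block_embedding_out[OF embeds_embB zero_less_card_finite[where 'a = 'zb] GB_def, folded outB_def]

lemma final_isometry: "isometry (mixA k) (CARD('za) * dim_GA (P k)) (final_A (P k))"
  "isometry (mixB k) (CARD('zb) * dim_GB (P k)) (final_B (P k))"
  using valid[of k] by (auto simp: valid_protocol_def mixA_def mixB_def Let_def rounds)

lemma shared_carrier: "shared (P k) \<in> carrier_mat (dim_TA (P k) * dim_TB (P k)) 1"
  using valid[of k] by (auto simp: valid_protocol_def intro: isometry_carrier)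

lemma shared_mix_carrier: "shared_mix \<in> carrier_mat (TA * TB) 1"
  by (simp add: shared_mix_def)

lemma embeds_T: "embeds n (\<lambda>k. dim_TA (P k)) TA interleave"
    "embeds n (\<lambda>k. dim_TB (P k)) TB interleave"
  by (simp_all add: embeds_interleave TA_def TB_def)

lemma mixes_shared:
  "mixes n amplitude (\<lambda>k. dim_TA (P k)) TA interleave (\<lambda>k. dim_TB (P k)) TB interleave
     (\<lambda>t t'. shared_mix $$ (t * TB + t', 0)) (\<lambda>k t t'. shared (P k) $$ (t * dim_TB (P k) + t', 0))"
proof -
  let ?F = "mix_fun n amplitude (\<lambda>k. dim_TA (P k)) interleave (\<lambda>k. dim_TB (P k)) interleave
       (\<lambda>k t t'. shared (P k) $$ (t * dim_TB (P k) + t', 0))"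
  have F: "shared_mix $$ (t * TB + t', 0) = ?F t t'" if "t < TA" "t' < TB" for t t'
    using that enc_less[OF that] by (simp add: shared_mix_def)
  have "mixes n amplitude (\<lambda>k. dim_TA (P k)) TA interleave (\<lambda>k. dim_TB (P k)) TB interleave ?F
      (\<lambda>k t t'. shared (P k) $$ (t * dim_TB (P k) + t', 0))"
    by (rule mixes_mix_fun[OF embeds_T])
  then show ?thesis
    unfolding mixes_def using F embeds_less[OF embeds_T(1)] embeds_less[OF embeds_T(2)] by auto
qed

lemma amplitude_norm: "(cmod (amplitude k))\<^sup>2 = p k"
    "amplitude k * cnj (amplitude k) = of_real (p k)"
  using p_nonneg[of k] by (auto simp: amplitude_def simp flip: of_real_mult)

lemma isometry_shared_mix: "isometry 1 (TA * TB) shared_mix"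
proof -
  have "(\<Sum>k<TA * TB. (cmod (shared_mix $$ (k, 0)))\<^sup>2)
      = (\<Sum>t<TA. \<Sum>t'<TB. (cmod (shared_mix $$ (t * TB + t', 0)))\<^sup>2)"
    by (rule sum_enc)
  also have "\<dots> = (\<Sum>k<n. p k *
      (\<Sum>t<dim_TA (P k). \<Sum>t'<dim_TB (P k). (cmod (shared (P k) $$ (t * dim_TB (P k) + t', 0)))\<^sup>2))"
    using mixes_norm[OF mixes_shared embeds_T] by (simp add: amplitude_norm)
  also have "\<dots> = (\<Sum>k<n. p k * 1)"
  proof (intro sum.cong refl arg_cong[of _ _ "(*) _"])
    fix k
    have "isometry 1 (dim_TA (P k) * dim_TB (P k)) (shared (P k))" using valid[of k]
        by (simp add: valid_protocol_def)
    then show "(\<Sum>t<dim_TA (P k). \<Sum>t'<dim_TB (P k). (cmod (shared (P k) $$ (t * dim_TB (P k) + t',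
        0)))\<^sup>2) = 1"
      by (simp only: isometry_1_iff sum_enc)
  qed
  finally show ?thesis unfolding isometry_1_iff using shared_mix_carrier p_sum by simp
qed

lemma valid_mixture: "valid_protocol mixture"
  unfolding valid_protocol_def
proof (intro conjI ballI)
  show "isometry 1 (dim_TA mixture * dim_TB mixture) (shared mixture)" using isometry_shared_mix
      by simp
  show "dim_A mixture 0 = CARD('x) * dim_TA mixture" "dim_B mixture 0 = CARD('y) * dim_TB mixture"
      "dim_C mixture 0 = 1"
    by (simp_all add: dC_def)
  fix i assume "i \<in> {1..rounds mixture}"
  then obtain j where j: "i = Suc j" "j < r" by (cases i) auto
  show "if odd i then dim_B mixture i = dim_B mixture (i - 1) \<and>
        isometry (dim_A mixture (i - 1) * dim_C mixture (i - 1)) (dim_A mixture i * dim_C mixture i)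
            (round_iso mixture i)
      else dim_A mixture i = dim_A mixture (i - 1) \<and>
        isometry (dim_C mixture (i - 1) * dim_B mixture (i - 1)) (dim_C mixture i * dim_B mixture i)
            (round_iso mixture i)"
  proof (cases "odd i")
    case True
    have "isometry (dA j * dC j) (dA (Suc j) * dC (Suc j)) (isoA j)"
      unfolding isoA_def using j True round_odd(2)
      by (intro block_embedding.isometry_block_iso[OF block_embedding_isoA]) auto
    then show ?thesis using True j by simp
  next
    case False
    have "isometry (dC j * dB j) (dC (Suc j) * dB (Suc j)) (isoB j)"
      unfolding isoB_def using j False round_even(2)
      by (intro block_embedding.isometry_block_iso[OF block_embedding_isoB]) auto
    then show ?thesis using False j by simp
  qed
next
  have A: "isometry dimA (CARD('za) * GA) finA"
    unfolding finA_def by (intro block_embedding.isometry_block_iso[OF block_embedding_finA]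
        final_isometry)
  have B: "isometry dimB (CARD('zb) * GB) finB"
    unfolding finB_def by (intro block_embedding.isometry_block_iso[OF block_embedding_finB]
        final_isometry)
  show "let r = rounds mixture; outA = CARD('za) * dim_GA mixture; outB = CARD('zb) * dim_GB mixture
    in if odd r then isometry (dim_A mixture r) outA (final_A mixture) \<and> isometry
        (dim_C mixture r * dim_B mixture r) outB (final_B mixture)
       else isometry (dim_A mixture r * dim_C mixture r) outA (final_A mixture) \<and> isometry
           (dim_B mixture r) outB (final_B mixture)"
    using A B by (auto simp: Let_def dimA_def dimB_def split: if_splits)
qed

section \<open>The runs of the mixed protocol are superpositions of runs\<close>

definition mixed_at :: "nat \<Rightarrow> 'x \<times> 'y \<Rightarrow> bool" where
  "mixed_at i z \<longleftrightarrow> mixes3 n amplitude (\<lambda>k. dim_A (P k) i) (dA i) (eA i) (\<lambda>k. dim_C (P k) i) (dC i)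
     (\<lambda>k. dim_B (P k) i) (dB i) (eB i) (\<lambda>x. input_run mixture i z $$ (x, 0)) (\<lambda>k x. input_run (P k)
         i z $$ (x, 0))"

text \<open>The input sits in leading factors common to all \<open>k\<close>, and only the shared
  part is superposed. The indices are split accordingly into an input part and a shared
  part.\<close>

lemma mixed_at_0: "mixed_at 0 z"
  unfolding mixed_at_def mixes3_def
proof (intro conjI allI impI)
  fix k a c b
  assume k: "k < n" "a < dim_A (P k) 0" "c < dim_C (P k) 0" "b < dim_B (P k) 0"
  define x t y t' where "x = a div dim_TA (P k)" and "t = a mod dim_TA (P k)"
      and "y = b div dim_TB (P k)" and "t' = b mod dim_TB (P k)"
  have h: "x < CARD('x)" "t < dim_TA (P k)" "y < CARD('y)" "t' < dim_TB (P k)"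
    using k div_mod_less[of a "CARD('x)" "dim_TA (P k)"] div_mod_less[of b "CARD('y)" "dim_TB
        (P k)"]
    by (auto simp: dims0 x_def t_def y_def t'_def)
  have T: "n * t + k < TA" "n * t' + k < TB"
    using embeds_less[OF embeds_T(1) k(1) h(2)] embeds_less[OF embeds_T(2) k(1) h(4)] .
  have "input_run mixture 0 z $$ ((x * TA + (n * t + k)) * (CARD('y) * TB)
      + (y * TB + (n * t' + k)), 0)
      = (if x = to_nat_on UNIV (fst z) \<and> y = to_nat_on UNIV (snd z) then shared_mix $$
          ((n * t + k) * TB + (n * t' + k), 0) else 0)"
    using initial_state_index[of mixture x "n * t + k" y "n * t'
        + k" "fst z" "snd z"] shared_mix_carrier h T
    by (simp add: input_run_0[OF valid_mixture])
  also have "shared_mix $$ ((n * t + k) * TB + (n * t' + k), 0)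
      = amplitude k * shared (P k) $$ (t * dim_TB (P k) + t', 0)"
    using mixes_block[OF mixes_shared k(1) h(2,4)] .
  also have "(if x = to_nat_on UNIV (fst z) \<and> y = to_nat_on UNIV (snd z)
      then amplitude k * shared (P k) $$ (t * dim_TB (P k) + t', 0) else 0)
      = amplitude k * input_run (P k) 0 z $$ ((x * dim_TA (P k) + t) * (CARD('y) * dim_TB (P k)) +
          (y * dim_TB (P k) + t'), 0)"
    using initial_state_index[OF shared_carrier h, of "fst z" "snd z"]
        by (simp add: input_run_0[OF valid])
  finally show "input_run mixture 0 z $$ ((eA 0 k a * dC 0 + c) * dB 0 + eB 0 k b, 0)
      = amplitude k * input_run (P k) 0 z $$ ((a * dim_C (P k) 0 + c) * dim_B (P k) 0 + b, 0)"
    using k by (simp add: eA_def eB_def dC_def dims0 emb_inner_def x_def t_def y_def t'_def)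
next
  fix a c b
  assume k: "a < dA 0" "c < dC 0" "b < dB 0"
    and out: "\<forall>k<n. \<forall>i'<dim_A (P k) 0. \<forall>j'<dim_B (P k) 0. a = eA 0 k i' \<longrightarrow> c < dim_C (P k) 0
        \<longrightarrow> b \<noteq> eB 0 k j'"
  define x t y t' where "x = a div TA" and "t = a mod TA" and "y = b div TB" and "t' = b mod TB"
  have h: "x < CARD('x)" "t < TA" "y < CARD('y)" "t' < TB"
    using k div_mod_less[of a "CARD('x)" TA] div_mod_less[of b "CARD('y)" TB]
    by (auto simp: x_def t_def y_def t'_def)
  have ab: "a = x * TA + t" "b = y * TB + t'" unfolding x_def t_def y_def t'_def
      by (rule div_mult_mod_eq[symmetric])+
  have "shared_mix $$ (t * TB + t', 0) = 0"
  proof (rule mixes_outside[OF mixes_shared h(2,4)])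
    fix k i j assume q: "k < n" "i < dim_TA (P k)" "j < dim_TB (P k)" "t = n * i + k"
        "t' = n * j + k"
    have "a = eA 0 k (x * dim_TA (P k) + i)" "b = eB 0 k (y * dim_TB (P k) + j)"
      using q by (simp_all add: ab eA_def eB_def emb_inner_def)
    moreover have "x * dim_TA (P k) + i < dim_A (P k) 0" "y * dim_TB (P k) + j < dim_B (P k) 0"
      using q h by (simp_all add: dims0 enc_less)
    ultimately show False using out q k by (auto simp: dims0 dC_def)
  qed
  then have "input_run mixture 0 z $$ ((x * TA + t) * (CARD('y) * TB) + (y * TB + t'), 0) = 0"
    using initial_state_index[of mixture x t y t' "fst z" "snd z"] shared_mix_carrier h
    by (simp add: input_run_0[OF valid_mixture])
  then show "input_run mixture 0 z $$ ((a * dC 0 + c) * dB 0 + b, 0) = 0"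
    using k by (simp add: ab dC_def)
qed

lemma mixed_at_left:
  assumes i: "i \<le> r"
  shows "mixed_at i z \<longleftrightarrow> mixes n amplitude (\<lambda>k. dim_A (P k) i * dim_C (P k) i) (dA i
      * dC i) (eAC i) (\<lambda>k. dim_B (P k) i) (dB i) (eB i)
     (\<lambda>x y. input_run mixture i z $$ (x * dB i + y, 0)) (\<lambda>k x y. input_run (P k) i z $$
         (x * dim_B (P k) i + y, 0))"
  unfolding mixed_at_def eAC_def
  using mixes3_left[where c = "\<lambda>k. dim_C (P k) i" and s = amplitude and F = "\<lambda>x.
      input_run mixture i z $$ (x, 0)"
      and \<phi> = "\<lambda>k x. input_run (P k) i z $$ (x, 0)", OF embeds_eA[OF i] embeds_eB[OF i] dim_C_le]
    mixes3_leftD[where c = "\<lambda>k. dim_C (P k) i" and s = amplitude and F = "\<lambda>x.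
        input_run mixture i z $$ (x, 0)"
      and \<phi> = "\<lambda>k x. input_run (P k) i z $$ (x, 0)", OF embeds_eA[OF i] embeds_eB[OF i] dim_C_le]
  by blast

lemma mixed_at_right:
  assumes i: "i \<le> r"
  shows "mixed_at i z \<longleftrightarrow> mixes n amplitude (\<lambda>k. dim_A (P k) i) (dA i) (eA i) (\<lambda>k. dim_C (P k) i
      * dim_B (P k) i) (dC i * dB i) (eCB i)
     (\<lambda>x y. input_run mixture i z $$ (x * (dC i * dB i) + y, 0)) (\<lambda>k x y. input_run (P k) i z $$
         (x * (dim_C (P k) i * dim_B (P k) i) + y, 0))"
  unfolding mixed_at_def eCB_def
  using mixes3_right[where c = "\<lambda>k. dim_C (P k) i" and s = amplitude and F = "\<lambda>x.
      input_run mixture i z $$ (x, 0)"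
      and \<phi> = "\<lambda>k x. input_run (P k) i z $$ (x, 0)", OF embeds_eA[OF i] embeds_eB[OF i] dim_C_le]
    mixes3_rightD[where c = "\<lambda>k. dim_C (P k) i" and s = amplitude and F = "\<lambda>x.
        input_run mixture i z $$ (x, 0)"
      and \<phi> = "\<lambda>k x. input_run (P k) i z $$ (x, 0)", OF embeds_eA[OF i] embeds_eB[OF i] dim_C_le]
  by blast

text \<open>Alice acts on AC against B and Bob on CB against A. The invariant is rebracketed to the
  matching bipartition, for Bob also flipped, and then preserved by
  \<open>mixes_block_iso\<close>.\<close>

lemma mixed_at_all: "i \<le> r \<Longrightarrow> mixed_at i z"
proof (induction i)
  case 0
  show ?case by (rule mixed_at_0)
next
  case (Suc i)
  then have i: "i < r" "i \<le> r" and IH: "mixed_at i z" by auto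
  show ?case
  proof (cases "odd (Suc i)")
    case True
    \<comment> \<open>The embedding \<open>eB\<close> changes its form between \<open>i = 1\<close>
      and \<open>i = 2\<close>, so it is constant across every round of Alice, including the
      first.\<close>
    have eqs: "(\<lambda>k. dim_B (P k) (Suc i)) = (\<lambda>k. dim_B (P k) i)"
        "dim_B (P k) (Suc i) = dim_B (P k) i" "dB (Suc i) = dB i" "eB (Suc i) = eB i" for k
      using round_odd(1)[OF i(1) True] True by (auto simp: eB_def fun_eq_iff elim!: oddE)
    show ?thesis
      unfolding mixed_at_left[OF Suc.prems] eqs
    proof (rule block_embedding.mixes_block_iso[OF block_embedding_isoA[OF i(1) True]
        embeds_eB[OF i(2)] IH[unfolded mixed_at_left[OF i(2)]]])
      fix x' y assume h: "x' < dA (Suc i) * dC (Suc i)" "y < dB i"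
      show "input_run mixture (Suc i) z $$ (x' * dB i + y, 0)
          = (\<Sum>x<dA i * dC i. block_iso n (\<lambda>k. dim_A (P k) i * dim_C (P k) i) (dA i * dC i) (eAC i)
             (\<lambda>k. dim_A (P k) (Suc i) * dim_C (P k) (Suc i)) (dA (Suc i) * dC (Suc i)) (eAC (Suc i))
             (\<lambda>x. (n * (\<Sum>k<n. dim_A (P k) (Suc i)) + x) * dC (Suc i) + 0) (\<lambda>k. round_iso (P k)
                 (Suc i)) $$ (x', x)
             * input_run mixture i z $$ (x * dB i + y, 0))"
        using input_run_Suc_odd[OF valid_mixture, of i x' y z] i True h
            unfolding isoA_def[symmetric] by simp
    next
      fix k i' b assume h: "k < n" "i' < dim_A (P k) (Suc i) * dim_C (P k) (Suc i)"
          "b < dim_B (P k) i"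
      show "input_run (P k) (Suc i) z $$ (i' * dim_B (P k) i + b, 0)
          = (\<Sum>ia<dim_A (P k) i * dim_C (P k) i. round_iso (P k) (Suc i) $$ (i', ia) * input_run
              (P k) i z $$ (ia * dim_B (P k) i + b, 0))"
        by (rule input_run_Suc_odd[OF valid]) (use i True h rounds in auto)
    qed
  next
    case False
    have eqs: "(\<lambda>k. dim_A (P k) (Suc i)) = (\<lambda>k. dim_A (P k) i)" "dA (Suc i) = dA i"
        "eA (Suc i) = eA i"
      using round_even(1)[OF i(1)] False by (auto simp: eA_def fun_eq_iff)
    have "mixes n amplitude (\<lambda>k. dim_C (P k) (Suc i) * dim_B (P k) (Suc i)) (dC (Suc i)
        * dB (Suc i)) (eCB (Suc i)) (\<lambda>k. dim_A (P k) i) (dA i) (eA i)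
        (\<lambda>y x. input_run mixture (Suc i) z $$ (x * (dC (Suc i) * dB (Suc i)) + y, 0))
        (\<lambda>k y x. input_run (P k) (Suc i) z $$ (x * (dim_C (P k) (Suc i) * dim_B (P k) (Suc i)) + y,
            0))"
    proof (rule block_embedding.mixes_block_iso[OF block_embedding_isoB[OF i(1)] embeds_eA[OF i(2)]
        mixes_flip[OF IH[unfolded mixed_at_right[OF i(2)]]]])
      show "even (Suc i)" using False by simp
      fix x' y assume h: "x' < dC (Suc i) * dB (Suc i)" "y < dA i"
      show "input_run mixture (Suc i) z $$ (y * (dC (Suc i) * dB (Suc i)) + x', 0)
          = (\<Sum>x<dC i * dB i. block_iso n (\<lambda>k. dim_C (P k) i * dim_B (P k) i) (dC i * dB i) (eCB i)
             (\<lambda>k. dim_C (P k) (Suc i) * dim_B (P k) (Suc i)) (dC (Suc i) * dB (Suc i)) (eCB (Suc i))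
             (\<lambda>x. 0 * dB (Suc i) + (n * (\<Sum>k<n. dim_B (P k) (Suc i)) + x)) (\<lambda>k. round_iso (P k)
                 (Suc i)) $$ (x', x)
             * input_run mixture i z $$ (y * (dC i * dB i) + x, 0))"
        using input_run_Suc_even[OF valid_mixture, of i y x' z] i False h
            unfolding isoB_def[symmetric] by simp
    next
      fix k i' b assume h: "k < n" "i' < dim_C (P k) (Suc i) * dim_B (P k) (Suc i)"
          "b < dim_A (P k) i"
      show "input_run (P k) (Suc i) z $$ (b * (dim_C (P k) (Suc i) * dim_B (P k) (Suc i)) + i', 0)
          = (\<Sum>ia<dim_C (P k) i * dim_B (P k) i. round_iso (P k) (Suc i) $$ (i', ia) * input_run
              (P k) i z $$ (b * (dim_C (P k) i * dim_B (P k) i) + ia, 0))"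
        by (rule input_run_Suc_even[OF valid]) (use i False h rounds in auto)
    qed
    then show ?thesis unfolding mixed_at_right[OF Suc.prems] eqs by (rule mixes_flip)
  qed
qed

section \<open>Information cost and error of the mixed protocol\<close>

lemma amp_cross:
  assumes i: "i \<le> r" and h: "k < n" "a < dim_A (P k) i" "k' < n" "b < dim_B (P k') i" "c < dC i"
  shows "amp mixture i z (eA i k a) c (eB i k' b) = (if k = k' \<and> c < dim_C (P k) i
      then amplitude k * amp (P k) i z a c b else 0)"
  unfolding amp_def mixture_sel
  by (rule mixes3_cross[OF embeds_eA[OF i] embeds_eB[OF i] dim_C_le mixed_at_all[OF i, unfolded
      mixed_at_def] h])

lemma amp_outside:
  assumes "i \<le> r" "a < dA i" "c < dC i" "b < dB i"
    and "\<And>k a' b'. k < n \<Longrightarrow> a' < dim_A (P k) i \<Longrightarrow> b' < dim_B (P k) i \<Longrightarrow> a = eA i k a'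
        \<Longrightarrow> c < dim_C (P k) i \<Longrightarrow> b = eB i k b' \<Longrightarrow> False"
  shows "amp mixture i z a c b = 0"
  using mixes3_outside[OF embeds_eA[OF assms(1)] embeds_eB[OF assms(1)] dim_C_le
      mixed_at_all[OF assms(1), unfolded mixed_at_def] assms(2-4)] assms(5)
  by (simp add: amp_def) blast

text \<open>Alice's register, which is traced out, holds a copy of the label. Coherence between
  different labels is lost, and a block diagonal state with weights \<open>p k\<close>
  remains.\<close>

lemma wstate_CB_mixture:
  assumes i: "i \<le> r" and h: "k < n" "c < dim_C (P k) i" "b < dim_B (P k) i" "l < n"
      "c' < dim_C (P l) i" "b' < dim_B (P l) i"
  shows "wstate_CB mixture i w (c, eB i k b) (c', eB i l b') = (if k = l
      then of_real (p k) * wstate_CB (P k) i w (c, b) (c', b') else 0)"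
proof -
  have c: "c < dC i" "c' < dC i" using h dim_C_le by (meson less_le_trans)+
  have bB: "eB i k b < dB i" "eB i l b' < dB i" using embeds_less[OF embeds_eB[OF i]] h by auto
  have S: "(\<Sum>a<dA i. amp mixture i z a c (eB i k b) * cnj (amp mixture i z a c' (eB i l b')))
      = (if k = l then of_real (p k) * (\<Sum>a<dim_A (P k) i. amp (P k) i z a c b * cnj
          (amp (P k) i z a c' b')) else 0)" for z
  proof -
    have "(\<Sum>a<dA i. amp mixture i z a c (eB i k b) * cnj (amp mixture i z a c' (eB i l b')))
        = (\<Sum>m<n. \<Sum>a<dim_A (P m) i. amp mixture i z (eA i m a) c (eB i k b) * cnj
            (amp mixture i z (eA i m a) c' (eB i l b')))"
    proof (rule sum_embeds[OF embeds_eA[OF i]])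
      fix x assume x: "x < dA i" "\<forall>k<n. \<forall>a<dim_A (P k) i. x \<noteq> eA i k a"
      have "amp mixture i z x c (eB i k b) = 0"
          by (rule amp_outside[OF i x(1) c(1) bB(1)]) (use x in auto)
      then show "amp mixture i z x c (eB i k b) * cnj (amp mixture i z x c' (eB i l b')) = 0"
          by simp
    qed
    also have "\<dots> = (\<Sum>m<n. if m = k then if k = l
        then \<Sum>a<dim_A (P k) i. of_real (p k) * (amp (P k) i z a c b * cnj (amp (P k) i z a c' b'))
        else 0 else 0)"
      using h c by (intro sum.cong refl) (auto simp: amp_cross[OF i] amplitude_norm(2)[symmetric]
          mult_ac intro!: sum.cong)
    finally show ?thesis using h by (simp add: sum_distrib_left)
  qed
  show ?thesis by (simp only: wstate_CB_def case_prod_conv mixture_sel S)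
      (simp add: sum_distrib_left mult.left_commute)
qed

lemma wstate_CA_mixture:
  assumes i: "i \<le> r" and h: "k < n" "c < dim_C (P k) i" "a < dim_A (P k) i" "l < n"
      "c' < dim_C (P l) i" "a' < dim_A (P l) i"
  shows "wstate_CA mixture i w (c, eA i k a) (c', eA i l a') = (if k = l
      then of_real (p k) * wstate_CA (P k) i w (c, a) (c', a') else 0)"
proof -
  have c: "c < dC i" "c' < dC i" using h dim_C_le by (meson less_le_trans)+
  have bB: "eA i k a < dA i" "eA i l a' < dA i" using embeds_less[OF embeds_eA[OF i]] h by auto
  have S: "(\<Sum>b<dB i. amp mixture i z (eA i k a) c b * cnj (amp mixture i z (eA i l a') c' b))
      = (if k = l then of_real (p k) * (\<Sum>b<dim_B (P k) i. amp (P k) i z a c b * cnj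
          (amp (P k) i z a' c' b)) else 0)" for z
  proof -
    have "(\<Sum>b<dB i. amp mixture i z (eA i k a) c b * cnj (amp mixture i z (eA i l a') c' b))
        = (\<Sum>m<n. \<Sum>b<dim_B (P m) i. amp mixture i z (eA i k a) c (eB i m b) * cnj
            (amp mixture i z (eA i l a') c' (eB i m b)))"
    proof (rule sum_embeds[OF embeds_eB[OF i]])
      fix x assume x: "x < dB i" "\<forall>k<n. \<forall>a<dim_B (P k) i. x \<noteq> eB i k a"
      have "amp mixture i z (eA i k a) c x = 0"
          by (rule amp_outside[OF i bB(1) c(1) x(1)]) (use x in auto)
      then show "amp mixture i z (eA i k a) c x * cnj (amp mixture i z (eA i l a') c' x) = 0"
          by simp
    qed
    also have "\<dots> = (\<Sum>m<n. if m = k then if k = l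
        then \<Sum>b<dim_B (P k) i. of_real (p k) * (amp (P k) i z a c b * cnj (amp (P k) i z a' c' b))
        else 0 else 0)"
      using h c by (intro sum.cong refl) (auto simp: amp_cross[OF i] amplitude_norm(2)[symmetric]
          mult_ac intro!: sum.cong)
    finally show ?thesis using h by (simp add: sum_distrib_left)
  qed
  show ?thesis by (simp only: wstate_CA_def case_prod_conv mixture_sel S)
      (simp add: sum_distrib_left mult.left_commute)
qed

text \<open>Both conditioning registers, B and A, carry the label, so each of the two conditional
  entropies is affine; no information about the label is charged to the message.\<close>

lemma round_info_mixture:
  assumes i: "i \<le> r" and w: "\<And>z. w z \<ge> 0"
  shows "round_info mixture i w = (\<Sum>k<n. p k * round_info (P k) i w)"
proof -
  have B: "cond_ent {..<dC i} {..<dB i} (wstate_CB mixture i w)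
      = (\<Sum>k<n. p k * cond_ent {..<dim_C (P k) i} {..<dim_B (P k) i} (wstate_CB (P k) i w))"
  proof (rule cond_ent_block_diagonal[where h = "eB i"])
    fix c b c' b' assume h: "c \<in> {..<dC i}" "b \<in> {..<dB i}" "c' \<in> {..<dC i}" "b' \<in> {..<dB i}"
      and out: "\<forall>k\<in>{..<n}. c \<in> {..<dim_C (P k) i} \<longrightarrow> (\<forall>b0\<in>{..<dim_B (P k) i}. b \<noteq> eB i k b0)"
    have "amp mixture i z a c b = 0" if "a < dA i" for z a
      by (rule amp_outside[OF i that]) (use h out in auto)
    then show "wstate_CB mixture i w (c, b) (c', b') = 0 \<and> wstate_CB mixture i w (c', b') (c, b)
        = 0"
      by (simp add: wstate_CB_def)
  next
    show "inj_on (\<lambda>(k, b). eB i k b) (SIGMA k:{..<n}. {..<dim_B (P k) i})"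
      using embeds_eB[OF i] by (simp add: embeds_def)
  next
    fix k assume "k \<in> {..<n}"
    then show "{..<dim_C (P k) i} \<subseteq> {..<dC i}" using dim_C_le[of k i] by auto
  qed (use wstate_CB_mixture[OF i] embeds_less[OF embeds_eB[OF i]] p_nonneg psd_on_wstate_CB[OF w]
      in auto)
  have A: "cond_ent {..<dC i} {..<dA i} (wstate_CA mixture i w)
      = (\<Sum>k<n. p k * cond_ent {..<dim_C (P k) i} {..<dim_A (P k) i} (wstate_CA (P k) i w))"
  proof (rule cond_ent_block_diagonal[where h = "eA i"])
    fix c a c' a' assume h: "c \<in> {..<dC i}" "a \<in> {..<dA i}" "c' \<in> {..<dC i}" "a' \<in> {..<dA i}"
      and out: "\<forall>k\<in>{..<n}. c \<in> {..<dim_C (P k) i} \<longrightarrow> (\<forall>b0\<in>{..<dim_A (P k) i}. a \<noteq> eA i k b0)"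
    have "amp mixture i z a c b = 0" if "b < dB i" for z b
      by (rule amp_outside[OF i _ _ that]) (use h out in auto)
    then show "wstate_CA mixture i w (c, a) (c', a') = 0 \<and> wstate_CA mixture i w (c', a') (c, a)
        = 0"
      by (simp add: wstate_CA_def)
  next
    show "inj_on (\<lambda>(k, b). eA i k b) (SIGMA k:{..<n}. {..<dim_A (P k) i})"
      using embeds_eA[OF i] by (simp add: embeds_def)
  next
    fix k assume "k \<in> {..<n}"
    then show "{..<dim_C (P k) i} \<subseteq> {..<dC i}" using dim_C_le[of k i] by auto
  qed (use wstate_CA_mixture[OF i] embeds_less[OF embeds_eA[OF i]] p_nonneg psd_on_wstate_CA[OF w]
      in auto)
  show ?thesis
    unfolding round_info_def mixture_sel A B sum.distrib[symmetric] sum_distrib_left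
    by (intro sum.cong refl) (simp add: algebra_simps)
qed

lemma QIC_weight_mixture:
  assumes w: "\<And>z. w z \<ge> 0"
  shows "QIC_weight mixture w = (\<Sum>k<n. p k * QIC_weight (P k) w)"
proof -
  have "QIC_weight mixture w = (\<Sum>i\<in>{1..r}. \<Sum>k<n. p k * round_info (P k) i w)"
    unfolding QIC_weight_def mixture_sel using round_info_mixture[OF _ w]
        by (intro sum.cong refl) auto
  also have "\<dots> = (\<Sum>k<n. \<Sum>i\<in>{1..r}. p k * round_info (P k) i w)" by (rule sum.swap)
  finally show ?thesis by (simp add: QIC_weight_def rounds sum_distrib_left)
qed

lemma mixes_final:
  "mixes n amplitude mixA dimA embA mixB dimB embB (\<lambda>x y. input_run mixture r z $$ (x * dimB + y,
      0))
     (\<lambda>k x y. input_run (P k) r z $$ (x * mixB k + y, 0))"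
  using mixed_at_left[OF order_refl, of z] mixed_at_right[OF order_refl,
      of z] mixed_at_all[OF order_refl, of z]
  by (simp add: mixA_def mixB_def dimA_def dimB_def embA_def embB_def)

lemma mixes_output:
  "mixes n amplitude (\<lambda>k. CARD('za) * dim_GA (P k)) (CARD('za) * GA) outA (\<lambda>k. CARD('zb)
      * dim_GB (P k)) (CARD('zb) * GB) outB
     (\<lambda>x y. output_vec mixture z $$ (x * (CARD('zb) * GB) + y, 0))
     (\<lambda>k x y. output_vec (P k) z $$ (x * (CARD('zb) * dim_GB (P k)) + y, 0))"
proof (rule block_embedding.mixes_block_iso[OF block_embedding_finA])
  show "embeds n (\<lambda>k. CARD('zb) * dim_GB (P k)) (CARD('zb) * GB) outB"
    using block_embedding_finB by (simp add: block_embedding_def)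
  have "mixes n amplitude (\<lambda>k. CARD('zb) * dim_GB (P k)) (CARD('zb) * GB) outB mixA dimA embA
     (\<lambda>y x. \<Sum>l<dimB. finB $$ (y, l) * input_run mixture r z $$ (x * dimB + l, 0))
     (\<lambda>k y x. \<Sum>l<mixB k. final_B (P k) $$ (y, l) * input_run (P k) r z $$ (x * mixB k + l, 0))"
    by (rule block_embedding.mixes_block_iso[OF block_embedding_finB embeds_embA
        mixes_flip[OF mixes_final[of z]], where V = "\<lambda>k. final_B (P k)"])
      (simp_all add: finB_def)
  then show "mixes n amplitude mixA dimA embA (\<lambda>k. CARD('zb) * dim_GB (P k)) (CARD('zb) * GB) outB
     (\<lambda>x y. \<Sum>l<dimB. finB $$ (y, l) * input_run mixture r z $$ (x * dimB + l, 0))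
     (\<lambda>k x y. \<Sum>l<mixB k. final_B (P k) $$ (y, l) * input_run (P k) r z $$ (x * mixB k + l, 0))"
    by (rule mixes_flip)
next
  fix x' y assume "x' < CARD('za) * GA" "y < CARD('zb) * GB"
  then show "output_vec mixture z $$ (x' * (CARD('zb) * GB) + y, 0)
     = (\<Sum>x<dimA. block_iso n mixA dimA embA (\<lambda>k. CARD('za) * dim_GA (P k)) (CARD('za) * GA) outA
     (\<lambda>x. 0 * GA + (n * (\<Sum>k<n. dim_GA (P k)) + x)) (\<lambda>k. final_A (P k)) $$ (x', x) *
       (\<Sum>l<dimB. finB $$ (y, l) * input_run mixture r z $$ (x * dimB + l, 0)))"
    using output_vec_index[OF valid_mixture, of x' y z] unfolding finA_def[symmetric]
    by (simp add: dimA_def dimB_def)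
next
  fix k i' b assume "i' < CARD('za) * dim_GA (P k)" "b < CARD('zb) * dim_GB (P k)"
  then show "output_vec (P k) z $$ (i' * (CARD('zb) * dim_GB (P k)) + b, 0)
      = (\<Sum>i<mixA k. final_A (P k) $$ (i', i) * (\<Sum>l<mixB k. final_B (P k) $$ (b, l) * input_run (P k)
          r z $$ (i * mixB k + l, 0)))"
    using output_vec_index[OF valid, of i' k b z] by (simp add: mixA_def mixB_def rounds)
qed

text \<open>For fixed outputs the remaining amplitudes on the discarded registers form a
  superposition with orthogonal labels, whose squared norm is the average of the individual
  probabilities.\<close>

lemma output_prob_mixture:
    "output_prob mixture x y za zb = (\<Sum>k<n. p k * output_prob (P k) x y za zb)"
proof -
  have eG: "embeds n (\<lambda>k. dim_GA (P k)) GA interleave" "embeds n (\<lambda>k. dim_GB (P k)) GB interleave"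
    by (simp_all add: embeds_interleave GA_def GB_def)
  note 1 = mixes_inner_restrict[OF mixes_output[unfolded outA_def] eG(1) to_nat_on_less[of za]]
  note 2 = mixes_inner_restrict[OF mixes_flip[OF 1, unfolded outB_def] eG(2) to_nat_on_less[of zb]]
  note 3 = mixes_norm[OF mixes_flip[OF 2] eG, of "(x, y)"]
  show ?thesis using 3 by (simp add: output_prob_eq amplitude_norm)
qed

lemma error_prob_mixture: "error_prob T mixture x y = (\<Sum>k<n. p k * error_prob T (P k) x y)"
proof -
  have "error_prob T mixture x y
      = (\<Sum>(za, zb) | (x, y, za, zb) \<notin> T. \<Sum>k<n. p k * output_prob (P k) x y za zb)"
    by (simp add: error_prob_def output_prob_mixture)
  also have "\<dots> = (\<Sum>k<n. \<Sum>(za, zb) | (x, y, za, zb) \<notin> T. p k * output_prob (P k) x y za zb)"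
    by (simp add: split_def) (rule sum.swap)
  finally show ?thesis by (simp add: error_prob_def sum_distrib_left split_def)
qed

end

subsection \<open>Padding with trivial rounds; finite minimax\<close>

text \<open>The party that has just received the last message, and would act next, absorbs it into
  its own register and sends a message of dimension 1. The final isometries therefore still
  fit.\<close>

definition pad_round :: "('x, 'y, 'za, 'zb) protocol \<Rightarrow> ('x, 'y, 'za, 'zb) protocol" where
  "pad_round P = (let r = rounds P in Protocol (Suc r) (dim_TA P) (dim_TB P) (shared P)
     ((dim_A P)(Suc r := if odd (Suc r) then dim_A P r * dim_C P r else dim_A P r))
     ((dim_B P)(Suc r := if odd (Suc r) then dim_B P r else dim_C P r * dim_B P r))
     ((dim_C P)(Suc r := 1))
     ((round_iso P)(Suc r := 1\<^sub>m (if odd (Suc r) then dim_A P r * dim_C P r else dim_C P r * dim_B P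
         r)))
     (dim_GA P) (dim_GB P) (final_A P) (final_B P))"

lemma pad_round_sel [simp]:
  "rounds (pad_round P) = Suc (rounds P)" "dim_TA (pad_round P) = dim_TA P"
      "dim_TB (pad_round P) = dim_TB P"
  "shared (pad_round P) = shared P" "dim_GA (pad_round P) = dim_GA P"
      "dim_GB (pad_round P) = dim_GB P"
  "final_A (pad_round P) = final_A P" "final_B (pad_round P) = final_B P"
  "dim_A (pad_round P) = (dim_A P)(Suc (rounds P) := if odd (Suc (rounds P))
      then dim_A P (rounds P) * dim_C P (rounds P) else dim_A P (rounds P))"
  "dim_B (pad_round P) = (dim_B P)(Suc (rounds P) := if odd (Suc (rounds P)) then dim_B P (rounds P)
      else dim_C P (rounds P) * dim_B P (rounds P))"
  "dim_C (pad_round P) = (dim_C P)(Suc (rounds P) := 1)"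
  "round_iso (pad_round P) = (round_iso P)(Suc (rounds P) := 1\<^sub>m (if odd (Suc (rounds P))
      then dim_A P (rounds P) * dim_C P (rounds P) else dim_C P (rounds P) * dim_B P (rounds P)))"
  by (simp_all add: pad_round_def Let_def)

lemma valid_pad_round:
  fixes P :: "('x::finite, 'y::finite, 'za::finite, 'zb::finite) protocol"
  assumes v: "valid_protocol P"
  shows "valid_protocol (pad_round P)"
proof -
  have r: "if odd i
        then dim_B P i = dim_B P (i - 1) \<and>
             isometry (dim_A P (i - 1) * dim_C P (i - 1)) (dim_A P i * dim_C P i) (round_iso P i)
        else dim_A P i = dim_A P (i - 1) \<and>
             isometry (dim_C P (i - 1) * dim_B P (i - 1)) (dim_C P i * dim_B P i) (round_iso P i)"
    if "i \<in> {1..rounds P}" for i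
    using v that unfolding valid_protocol_def by blast
  have R: "if odd i
        then dim_B (pad_round P) i = dim_B (pad_round P) (i - 1) \<and>
             isometry (dim_A (pad_round P) (i - 1) * dim_C (pad_round P) (i - 1))
                 (dim_A (pad_round P) i * dim_C (pad_round P) i) (round_iso (pad_round P) i)
        else dim_A (pad_round P) i = dim_A (pad_round P) (i - 1) \<and>
             isometry (dim_C (pad_round P) (i - 1) * dim_B (pad_round P) (i - 1))
                 (dim_C (pad_round P) i * dim_B (pad_round P) i) (round_iso (pad_round P) i)"
    if i: "i \<in> {1..Suc (rounds P)}" for i
  proof (cases "i = Suc (rounds P)")
    case True
    then show ?thesis by (simp add: isometry_one)
  next
    case False
    then have "i \<in> {1..rounds P}" "i - 1 \<noteq> Suc (rounds P)" using i by auto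
    then show ?thesis using r[of i] False by (auto split: if_splits)
  qed
  have "isometry 1 (dim_TA P * dim_TB P) (shared P)" "dim_A P 0 = CARD('x) * dim_TA P"
    "dim_B P 0 = CARD('y) * dim_TB P" "dim_C P 0 = 1"
    using v unfolding valid_protocol_def by blast+
  moreover have "if odd (rounds P)
        then isometry (dim_A P (rounds P)) (CARD('za) * dim_GA P) (final_A P) \<and>
             isometry (dim_C P (rounds P) * dim_B P (rounds P)) (CARD('zb) * dim_GB P) (final_B P)
        else isometry (dim_A P (rounds P) * dim_C P (rounds P)) (CARD('za) * dim_GA P) (final_A P) \<and>
             isometry (dim_B P (rounds P)) (CARD('zb) * dim_GB P) (final_B P)"
    using v by (simp add: valid_protocol_def Let_def)
  ultimately show ?thesis
    unfolding valid_protocol_def Let_def by (intro conjI ballI R) simp_all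
qed

lemma run_pad_round: "i \<le> rounds P \<Longrightarrow> run (pad_round P) i = run P i"
  by (induction i) auto

lemma initial_state_pad_round: "initial_state (pad_round P) = initial_state P"
  by (intro ext) (simp add: initial_state_def)

lemma input_run_pad_round: "i \<le> rounds P \<Longrightarrow> input_run (pad_round P) i = input_run P i"
  by (intro ext) (simp add: input_run_def run_pad_round initial_state_pad_round)

lemma run_pad_round_last:
  fixes P :: "('x::finite, 'y::finite, 'za::finite, 'zb::finite) protocol"
  assumes "valid_protocol P"
  shows "run (pad_round P) (Suc (rounds P)) = run P (rounds P)"
proof -
  have "run P (rounds P) \<in> carrier_mat (dim_ACB P (rounds P)) (dim_ACB P 0)"
    by (rule run_carrier[OF assms order_refl])
  then show ?thesis by (simp add: run_pad_round kron_one mult.assoc)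
qed

lemma cond_ent_trivial:
  assumes "finite B" "psd_on ({..<1} \<times> B) \<rho>"
  shows "cond_ent {..<1::nat} B \<rho> = 0"
proof -
  have "ent ({..<1::nat} \<times> B) \<rho> = (\<Sum>k\<in>{()}. 1 * ent B (trace_fst {..<1} \<rho>) - 1 * log 2 1 * Re
      (\<Sum>i\<in>B. trace_fst {..<1} \<rho> i i))"
    by (rule ent_block_diagonal[where h = "\<lambda>_ b. (0, b)"])
      (use assms psd_on_trace_fst[OF _ assms(1), of "{..<1}" \<rho>] in \<open>auto
          simp: inj_on_def trace_fst_def lessThan_Suc\<close>)
  then show ?thesis by (simp add: cond_ent_def)
qed

lemma round_info_trivial_message:
  assumes "dim_C P i = 1" "\<And>z. w z \<ge> 0"
  shows "round_info P i w = 0"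
  unfolding round_info_def assms(1)
  by (simp add: cond_ent_trivial psd_on_wstate_CB psd_on_wstate_CA assms(2) del: lessThan_Suc
      One_nat_def)

lemma QIC_weight_pad_round:
  assumes "\<And>z. w z \<ge> 0"
  shows "QIC_weight (pad_round P) w = QIC_weight P w"
proof -
  have "round_info (pad_round P) i w = round_info P i w" if "i \<le> rounds P" for i
  proof -
    have "amp (pad_round P) i = amp P i"
      using that by (intro ext) (simp add: amp_def input_run_pad_round)
    then have "wstate_CB (pad_round P) i w = wstate_CB P i w"
        "wstate_CA (pad_round P) i w = wstate_CA P i w"
      using that by (simp_all add: wstate_CB_def wstate_CA_def)
    then show ?thesis using that by (simp add: round_info_def)
  qed
  moreover have "round_info (pad_round P) (Suc (rounds P)) w = 0"
    by (rule round_info_trivial_message) (use assms in auto)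
  ultimately show ?thesis by (simp add: QIC_weight_def)
qed

lemma error_prob_pad_round:
  fixes P :: "('x::finite, 'y::finite, 'za::finite, 'zb::finite) protocol"
  assumes "valid_protocol P"
  shows "error_prob T (pad_round P) x y = error_prob T P x y"
proof -
  have "output_prob (pad_round P) x y za zb = output_prob P x y za zb" for za zb
    using run_pad_round_last[OF assms]
        by (simp add: output_prob_def initial_state_pad_round del: run.simps)
  then show ?thesis by (simp add: error_prob_def)
qed

lemma pad_to_rounds:
  fixes P :: "('x::finite, 'y::finite, 'za::finite, 'zb::finite) protocol"
  assumes "valid_protocol P" "rounds P \<le> m"
  shows "\<exists>Q. valid_protocol Q \<and> rounds Q = m \<and> (\<forall>w. (\<forall>z. w z \<ge> 0) \<longrightarrow> QIC_weight Q w = QIC_weight P w)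
      \<and>
    (\<forall>x y. error_prob T Q x y = error_prob T P x y)"
  using assms(2)
proof (induction m rule: dec_induct)
  case base
  then show ?case using assms(1) by blast
next
  case (step m)
  then obtain Q where Q: "valid_protocol Q" "rounds Q = m"
      "\<forall>w. (\<forall>z. w z \<ge> 0) \<longrightarrow> QIC_weight Q w = QIC_weight P w"
    "\<forall>x y. error_prob T Q x y = error_prob T P x y" by blast
  have "QIC_weight (pad_round Q) w = QIC_weight P w" if "\<forall>z. w z \<ge> 0" for w
    using Q(3)[rule_format, of w] QIC_weight_pad_round[of w Q] that by metis
  moreover have "valid_protocol (pad_round Q)" "rounds (pad_round Q) = Suc m"
    "\<forall>x y. error_prob T (pad_round Q) x y = error_prob T P x y"
    using Q by (auto simp: valid_pad_round error_prob_pad_round)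
  ultimately show ?case by blast
qed

lemma mixture_exists:
  fixes P Q :: "('x::finite, 'y::finite, 'za::finite, 'zb::finite) protocol"
  assumes "valid_protocol P" "valid_protocol Q" "0 \<le> t" "t \<le> 1"
  shows "\<exists>R. valid_protocol R \<and>
    (\<forall>w. (\<forall>z. w z \<ge> 0) \<longrightarrow> QIC_weight R w = t * QIC_weight P w + (1 - t) * QIC_weight Q w) \<and>
    (\<forall>x y. error_prob T R x y = t * error_prob T P x y + (1 - t) * error_prob T Q x y)"
proof -
  let ?m = "max (rounds P) (rounds Q)"
  obtain P' where P': "valid_protocol P'" "rounds P' = ?m"
      "\<forall>w. (\<forall>z. w z \<ge> 0) \<longrightarrow> QIC_weight P' w = QIC_weight P w"
    "\<forall>x y. error_prob T P' x y = error_prob T P x y"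
    using pad_to_rounds[OF assms(1), of ?m T] by auto
  obtain Q' where Q': "valid_protocol Q'" "rounds Q' = ?m"
      "\<forall>w. (\<forall>z. w z \<ge> 0) \<longrightarrow> QIC_weight Q' w = QIC_weight Q w"
    "\<forall>x y. error_prob T Q' x y = error_prob T Q x y"
    using pad_to_rounds[OF assms(2), of ?m T] by auto
  let ?P = "\<lambda>k. if k = 0 then P' else Q'" and ?p = "\<lambda>k. if k = 0 then t else 1 - t"
  interpret protocol_mixture ?P 2 ?m ?p
    by unfold_locales (use P' Q' assms in \<open>auto simp: numeral_2_eq_2\<close>)
  have "QIC_weight mixture w = t * QIC_weight P w + (1 - t) * QIC_weight Q w" if "\<forall>z. w z \<ge> 0" for w
    using QIC_weight_mixture[of w] P' Q' that by (simp add: numeral_2_eq_2)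
  moreover have "error_prob T mixture x y = t * error_prob T P x y + (1 - t) * error_prob T Q x y"
      for x y
    using error_prob_mixture[of T x y] P' Q' by (simp add: numeral_2_eq_2)
  ultimately show ?thesis using valid_mixture by blast
qed

section \<open>A minimax theorem for finitely many payoffs\<close>

text \<open>Otherwise a line separates \<open>K\<close> from a quadrant. The quadrant is unbounded
  below in both coordinates, so the normal is nonnegative; normalised, it gives a weight
  \<open>t\<close> contradicting \<open>le\<close>. The slack \<open>\<delta>\<close> makes the
  contradiction strict, as \<open>K\<close> need not be closed.\<close>

lemma minimax_plane:
  fixes K :: "(real \<times> real) set"
  assumes conv: "convex K" and \<delta>: "\<delta> > 0"
    and le: "\<And>t. 0 \<le> t \<Longrightarrow> t \<le> 1 \<Longrightarrow> \<exists>(a, b)\<in>K. t * a + (1 - t) * b \<le> c"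
  shows "\<exists>(a, b)\<in>K. a \<le> c + \<delta> \<and> b \<le> c + \<delta>"
proof (rule ccontr)
  assume no: "\<not> ?thesis"
  let ?D = "{..c + \<delta>} \<times> {..c + \<delta>}"
  have "K \<noteq> {}" using le[of 0] by auto
  moreover have "?D \<inter> K = {}" using no by auto
  moreover have "convex ?D" by (intro convex_Times) auto
  moreover have "?D \<noteq> {}" by auto
  ultimately have "\<exists>n \<beta>. n \<noteq> 0 \<and> (\<forall>x\<in>?D. inner n x \<le> \<beta>) \<and> (\<forall>x\<in>K. inner n x \<ge> \<beta>)"
    using separating_hyperplane_sets[of ?D K] conv by blast
  then obtain n \<beta> where n: "n \<noteq> 0" and D: "\<And>x. x \<in> ?D \<Longrightarrow> inner n x \<le> \<beta>"
      and K: "\<And>x. x \<in> K \<Longrightarrow> inner n x \<ge> \<beta>"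
    by blast
  obtain u v where uv: "n = (u, v)" by (cases n)
  have D': "u * a + v * b \<le> \<beta>" if "a \<le> c + \<delta>" "b \<le> c + \<delta>" for a b
    using D[of "(a, b)"] that by (simp add: uv)
  have nonneg: "x \<ge> 0" if h: "\<And>M. M \<ge> 0 \<Longrightarrow> x * (c + \<delta> - M) + y \<le> \<beta>" for x y
  proof (rule ccontr)
    assume "\<not> x \<ge> 0"
    then have x: "- x > 0" by simp
    \<comment> \<open>With a negative coefficient, moving this far into the quadrant exceeds
      \<open>\<beta>\<close>.\<close>
    define M where "M = max 0 ((\<beta> - y - x * (c + \<delta>)) / (- x) + 1)"
    have "(\<beta> - y - x * (c + \<delta>)) / (- x) < M" by (simp add: M_def)
    then have "\<beta> - y - x * (c + \<delta>) < M * (- x)" by (simp only: pos_divide_less_eq[OF x])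
    moreover have "M \<ge> 0" by (simp add: M_def)
    ultimately show False using h[of M] by (simp add: algebra_simps)
  qed
  have u: "u \<ge> 0" by (rule nonneg[of u "v * (c + \<delta>)"]) (use D' in auto)
  have v: "v \<ge> 0" by (rule nonneg[of v "u * (c + \<delta>)"]) (subst add.commute, rule D', auto)
  have s: "u + v > 0" using n u v by (auto simp: uv zero_prod_def less_le)
  obtain a b where ab: "(a, b) \<in> K" "u / (u + v) * a + (1 - u / (u + v)) * b \<le> c"
    using le[of "u / (u + v)"] u v s by auto
  have "1 - u / (u + v) = v / (u + v)" using s by (simp add: field_simps)
  then have "(u * a + v * b) / (u + v) \<le> c" using ab(2) by (simp add: add_divide_distrib)
  then have "u * a + v * b \<le> c * (u + v)" using s by (simp add: pos_divide_le_eq)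
  moreover have "\<beta> \<le> u * a + v * b" using K[OF ab(1)] by (simp add: uv)
  moreover have "(u + v) * (c + \<delta>) \<le> \<beta>" using D'[of "c + \<delta>" "c + \<delta>"] by (simp add: algebra_simps)
  ultimately have "(u + v) * (c + \<delta>) \<le> (u + v) * c" by (simp add: mult.commute)
  then show False using s \<delta> by simp
qed

text \<open>Induction on the number of payoffs: for every \<open>t\<close> the last two are merged
  with weights \<open>t\<close> and \<open>1 - t\<close>, which the induction hypothesis can handle,
  and the planar case then finds one strategy that is good for both. Half of \<open>\<delta>\<close>
  is spent on each of these two steps.\<close>

lemma minimax_finite:
  fixes f :: "nat \<Rightarrow> 's \<Rightarrow> real"
  assumes "\<And>P Q t. P \<in> S \<Longrightarrow> Q \<in> S \<Longrightarrow> 0 \<le> t \<Longrightarrow> t \<le> 1 \<Longrightarrow> \<exists>R\<in>S. \<forall>i<Suc m. f i R \<le> t * f i P + (1 - t)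
      * f i Q"
    and "\<And>\<nu>. (\<And>i. i < Suc m \<Longrightarrow> \<nu> i \<ge> 0) \<Longrightarrow> (\<Sum>i<Suc m. \<nu> i) = 1 \<Longrightarrow> \<exists>P\<in>S. (\<Sum>i<Suc m. \<nu> i * f i P) \<le> c"
    and "\<delta> > 0"
  shows "\<exists>P\<in>S. \<forall>i<Suc m. f i P \<le> c + \<delta>"
  using assms
proof (induction m arbitrary: f \<delta>)
  case 0
  obtain P where "P \<in> S" "f 0 P \<le> c" using "0.prems"(2)[of "\<lambda>_. 1"] by auto
  then show ?case using "0.prems"(3) by (intro bexI[of _ P]) auto
next
  case (Suc m)
  define S' where "S' = {P \<in> S. \<forall>i<m. f i P \<le> c + \<delta> / 2}"
  \<comment> \<open>The upper closure makes \<open>K\<close> convex although mixing strategies only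
    gives inequalities for the payoffs.\<close>
  define K where "K = {(a, b). \<exists>P\<in>S'. f m P \<le> a \<and> f (Suc m) P \<le> b}"
  have mix: "\<exists>R\<in>S'. f m R \<le> t * f m P + (1 - t) * f m Q \<and> f (Suc m) R \<le> t * f (Suc m) P + (1 - t)
      * f (Suc m) Q"
    if h: "P \<in> S'" "Q \<in> S'" "0 \<le> t" "t \<le> 1" for P Q t
  proof -
    obtain R where R: "R \<in> S" "\<forall>i<Suc (Suc m). f i R \<le> t * f i P + (1 - t) * f i Q"
      using Suc.prems(1)[of P Q t] h by (auto simp: S'_def)
    have "f i R \<le> c + \<delta> / 2" if "i < m" for i
    proof -
      have "f i R \<le> t * f i P + (1 - t) * f i Q" using R that by simp
      also have "\<dots> \<le> t * (c + \<delta> / 2) + (1 - t) * (c + \<delta> / 2)"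
        using h that by (intro add_mono mult_left_mono) (auto simp: S'_def)
      finally show ?thesis by (simp only: distrib_right[symmetric]) simp
    qed
    then show ?thesis using R by (auto simp: S'_def)
  qed
  have "convex K"
  proof (rule convexI)
    fix x y and s t :: real assume h: "x \<in> K" "y \<in> K" "0 \<le> s" "0 \<le> t" "s + t = 1"
    obtain P Q where PQ: "P \<in> S'" "f m P \<le> fst x" "f (Suc m) P \<le> snd x" "Q \<in> S'" "f m Q \<le> fst y"
        "f (Suc m) Q \<le> snd y"
      using h by (auto simp: K_def)
    obtain R where R: "R \<in> S'" "f m R \<le> s * f m P + (1 - s) * f m Q"
        "f (Suc m) R \<le> s * f (Suc m) P + (1 - s) * f (Suc m) Q"
      using mix[OF PQ(1,4), of s] h by auto
    have t: "1 - s = t" using h by simp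
    have "s * f m P + t * f m Q \<le> s * fst x + t * fst y"
        "s * f (Suc m) P + t * f (Suc m) Q \<le> s * snd x + t * snd y"
      using PQ h by (intro add_mono mult_left_mono; simp)+
    then show "s *\<^sub>R x + t *\<^sub>R y \<in> K"
      using R unfolding K_def t by (intro CollectI) (auto simp: split_def intro!: bexI[of _ R])
  qed
  moreover have "\<exists>(a, b)\<in>K. t * a + (1 - t) * b \<le> c + \<delta> / 2" if t: "0 \<le> t" "t \<le> 1" for t
  proof -
    define g where "g i P = (if i < m then f i P else t * f m P + (1 - t) * f (Suc m) P)" for i P
    have "\<exists>P\<in>S. \<forall>i<Suc m. g i P \<le> c + \<delta> / 2"
    proof (rule Suc.IH)
      fix P Q and s :: real assume h: "P \<in> S" "Q \<in> S" "0 \<le> s" "s \<le> 1"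
      obtain R where R: "R \<in> S" "\<And>i. i < Suc (Suc m) \<Longrightarrow> f i R \<le> s * f i P + (1 - s) * f i Q"
        using Suc.prems(1)[OF h] by auto
      have "t * f m R + (1 - t) * f (Suc m) R
          \<le> t * (s * f m P + (1 - s) * f m Q) + (1 - t) * (s * f (Suc m) P + (1 - s) * f (Suc m) Q)"
        using t R(2) by (intro add_mono mult_left_mono) auto
      then have "\<forall>i<Suc m. g i R \<le> s * g i P + (1 - s) * g i Q"
        using R(2) by (auto simp: g_def algebra_simps)
      then show "\<exists>R\<in>S. \<forall>i<Suc m. g i R \<le> s * g i P + (1 - s) * g i Q" using R(1) by blast
    next
      fix \<nu> :: "nat \<Rightarrow> real" assume \<nu>: "\<And>i. i < Suc m \<Longrightarrow> \<nu> i \<ge> 0" "(\<Sum>i<Suc m. \<nu> i) = 1"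
      \<comment> \<open>The weight of the merged payoff is distributed over its two
        constituents.\<close>
      define \<mu> where "\<mu> i = (if i < m then \<nu> i else if i = m then \<nu> m * t else \<nu> m * (1 - t))" for i
      have eq: "(\<Sum>i<Suc (Suc m). \<mu> i * h i) = (\<Sum>i<m. \<nu> i * h i) + \<nu> m
          * (t * h m + (1 - t) * h (Suc m))" for h :: "nat \<Rightarrow> real"
        by (simp add: \<mu>_def algebra_simps)
      have "\<exists>P\<in>S. (\<Sum>i<Suc (Suc m). \<mu> i * f i P) \<le> c"
      proof (rule Suc.prems(2))
        show "\<mu> i \<ge> 0" if "i < Suc (Suc m)" for i using \<nu>(1) t by (auto simp: \<mu>_def)
        show "(\<Sum>i<Suc (Suc m). \<mu> i) = 1" using eq[of "\<lambda>_. 1"] \<nu>(2) by simp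
      qed
      then obtain P where "P \<in> S" "(\<Sum>i<Suc (Suc m). \<mu> i * f i P) \<le> c" by blast
      moreover have "(\<Sum>i<Suc m. \<nu> i * g i P) = (\<Sum>i<Suc (Suc m). \<mu> i * f i P)"
        unfolding eq by (simp add: g_def)
      ultimately show "\<exists>P\<in>S. (\<Sum>i<Suc m. \<nu> i * g i P) \<le> c" by (intro bexI[of _ P]) linarith+
    qed (use Suc.prems(3) in simp)
    then obtain P where P: "P \<in> S" "\<And>i. i < Suc m \<Longrightarrow> g i P \<le> c + \<delta> / 2" by blast
    have "f i P \<le> c + \<delta> / 2" if "i < m" for i using P(2)[of i] that by (simp add: g_def)
    then have "P \<in> S'" using P(1) by (simp add: S'_def)
    moreover have "t * f m P + (1 - t) * f (Suc m) P \<le> c + \<delta> / 2" using P(2)[of m]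
        by (simp add: g_def)
    ultimately show ?thesis unfolding K_def by blast
  qed
  ultimately obtain a b where ab: "(a, b) \<in> K" "a \<le> c + \<delta> / 2 + \<delta> / 2" "b \<le> c + \<delta> / 2 + \<delta> / 2"
    using minimax_plane[of K "\<delta> / 2" "c + \<delta> / 2"] Suc.prems(3) by auto
  then obtain P where P: "P \<in> S'" "f m P \<le> a" "f (Suc m) P \<le> b" by (auto simp: K_def)
  have "f i P \<le> c + \<delta>" if i: "i < Suc (Suc m)" for i
  proof -
    consider "i < m" | "i = m" | "i = Suc m" using i by (auto simp: less_Suc_eq)
    then show ?thesis
    proof cases
      case 1
      then have "f i P \<le> c + \<delta> / 2" using P(1) by (simp add: S'_def)
      then show ?thesis using Suc.prems(3) by linarith
    next
      case 2
      then show ?thesis using P ab by simp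
    next
      case 3
      then show ?thesis using P ab by simp
    qed
  qed
  then show ?case using P(1) by (auto simp: S'_def)
qed

subsection \<open>The minimax argument\<close>

definition error_weight ::
    "('x \<times> 'y \<times> 'za \<times> 'zb) set \<Rightarrow> ('x::finite, 'y::finite, 'za::finite, 'zb::finite) protocol \<Rightarrow>
    ('x \<times> 'y \<Rightarrow> real) \<Rightarrow> real" where
  "error_weight T P w = (\<Sum>z\<in>UNIV. w z * error_prob T P (fst z) (snd z))"

lemma expectation_error_prob:
  fixes P :: "('x::finite, 'y::finite, 'za::finite, 'zb::finite) protocol"
  shows "measure_pmf.expectation \<mu> (\<lambda>(x, y). error_prob T P x y) = error_weight T P (pmf \<mu>)"
  unfolding error_weight_def
  by (subst integral_measure_pmf_real[of UNIV]) (auto simp: split_def mult.commute)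

lemma error_prob_nonneg: "error_prob T P x y \<ge> 0"
  by (auto simp: error_prob_def output_prob_def Let_def intro!: sum_nonneg)

definition payoff ::
    "real \<Rightarrow> real \<Rightarrow> ('x \<times> 'y \<times> 'za \<times> 'zb) set \<Rightarrow> ('x::finite, 'y::finite, 'za::finite,
    'zb::finite) protocol \<Rightarrow>
    ('x \<times> 'y \<Rightarrow> real) \<Rightarrow> real" where
  "payoff a b T P w = a * QIC_weight P w + b * error_weight T P w"

lemma pmf_of_weights:
  fixes w :: "'c::finite \<Rightarrow> real"
  assumes "\<And>z. w z \<ge> 0" "(\<Sum>z\<in>UNIV. w z) = 1"
  shows "\<exists>\<mu>. pmf \<mu> = w"
proof
  show "pmf (embed_pmf w) = w"
    by (rule ext, rule pmf_embed_pmf) (use assms in \<open>auto simp: nn_integral_count_space_finite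
        sum_ennreal\<close>)
qed

text \<open>Rounding down and adding 1 dominates \<open>n\<close> times the distribution by positive
  integers, while the total exceeds \<open>n\<close> by at most the number of points.\<close>

lemma grid_domination:
  fixes \<mu> :: "'c::finite pmf"
  assumes "n \<ge> 1" and k_def: "k = (\<lambda>z. nat \<lfloor>real n * pmf \<mu> z\<rfloor> + 1)"
  shows "k \<in> (UNIV \<rightarrow>\<^sub>E {1..n + 1})" and "real n * pmf \<mu> z \<le> real (k z)"
    and "(\<Sum>z\<in>UNIV. real (k z)) \<le> real n + real CARD('c)"
proof -
  have fl: "real (nat \<lfloor>real n * pmf \<mu> z\<rfloor>) \<le> real n * pmf \<mu> z"
      "real n * pmf \<mu> z \<le> real (nat \<lfloor>real n * pmf \<mu> z\<rfloor>) + 1" for z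
    by (simp_all add: of_nat_nat floor_le_iff real_of_int_floor_add_one_ge)
  have "real (nat \<lfloor>real n * pmf \<mu> z\<rfloor>) \<le> real n" for z
  proof -
    have "real n * pmf \<mu> z \<le> real n * 1" by (intro mult_left_mono pmf_le_1) simp
    then show ?thesis using fl(1)[of z] by linarith
  qed
  then have "nat \<lfloor>real n * pmf \<mu> z\<rfloor> \<le> n" for z by (simp only: of_nat_le_iff)
  then show "k \<in> (UNIV \<rightarrow>\<^sub>E {1..n + 1})" by (auto simp: k_def)
  show "real n * pmf \<mu> z \<le> real (k z)" unfolding k_def of_nat_add of_nat_1 by (rule fl(2))
  have "(\<Sum>z\<in>UNIV. real (k z)) \<le> (\<Sum>z\<in>UNIV. real n * pmf \<mu> z + 1)"
    using fl(1) by (intro sum_mono) (simp add: k_def)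
  also have "\<dots> = real n * (\<Sum>z\<in>UNIV. pmf \<mu> z) + real CARD('c)"
    by (simp add: sum.distrib sum_distrib_left)
  also have "(\<Sum>z\<in>UNIV. pmf \<mu> z) = 1" by (rule sum_pmf_eq_1) auto
  finally show "(\<Sum>z\<in>UNIV. real (k z)) \<le> real n + real CARD('c)" by simp
qed

context
  fixes a b :: real and T :: "('x::finite \<times> 'y::finite \<times> 'za::finite \<times> 'zb::finite) set"
  assumes a: "a \<ge> 0" and b: "b \<ge> 0"
begin

lemma payoff_add:
  assumes "\<And>z. w z \<ge> 0" "\<And>z. w' z \<ge> 0"
  shows "payoff a b T P w + payoff a b T P w' \<le> payoff a b T P (\<lambda>z. w z + w' z)"
proof -
  have "a * (QIC_weight P w + QIC_weight P w') \<le> a * QIC_weight P (\<lambda>z. w z + w' z)"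
    using a by (intro mult_left_mono QIC_weight_add assms)
  moreover have "error_weight T P (\<lambda>z. w z + w' z) = error_weight T P w + error_weight T P w'"
    by (simp add: error_weight_def distrib_right sum.distrib)
  ultimately show ?thesis by (simp add: payoff_def algebra_simps)
qed

lemma payoff_scale:
  assumes "\<And>z. w z \<ge> 0" "t \<ge> 0"
  shows "payoff a b T P (\<lambda>z. t * w z) = t * payoff a b T P w"
  using QIC_weight_scale[of w t P] assms
  by (simp add: payoff_def error_weight_def sum_distrib_left algebra_simps)

lemma payoff_mono:
  assumes "\<And>z. w z \<ge> 0" "\<And>z. w z \<le> w' z"
  shows "payoff a b T P w \<le> payoff a b T P w'"
  unfolding payoff_def error_weight_def using a b assms
  by (intro add_mono mult_left_mono QIC_weight_mono sum_mono mult_right_mono) (auto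
      simp: error_prob_nonneg)

text \<open>Jensen's inequality, as a consequence of superadditivity and homogeneity.\<close>

lemma payoff_sum:
  fixes m :: nat
  assumes "\<And>i z. i < m \<Longrightarrow> w i z \<ge> 0" "\<And>i. i < m \<Longrightarrow> \<nu> i \<ge> 0"
  shows "(\<Sum>i<m. \<nu> i * payoff a b T P (w i)) \<le> payoff a b T P (\<lambda>z. \<Sum>i<m. \<nu> i * w i z)"
  using assms
proof (induction m)
  case 0
  show ?case using payoff_scale[of "\<lambda>_. 0" 0 P] by simp
next
  case (Suc m)
  have "(\<Sum>i<Suc m. \<nu> i * payoff a b T P (w i))
      \<le> payoff a b T P (\<lambda>z. \<Sum>i<m. \<nu> i * w i z) + payoff a b T P (\<lambda>z. \<nu> m * w m z)"
    using Suc by (simp add: payoff_scale)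
  also have "\<dots> \<le> payoff a b T P (\<lambda>z. (\<Sum>i<m. \<nu> i * w i z) + \<nu> m * w m z)"
    by (rule payoff_add) (use Suc.prems in \<open>auto intro!: sum_nonneg\<close>)
  finally show ?case by simp
qed

lemma payoff_mixture:
  assumes "valid_protocol P" "valid_protocol Q" "0 \<le> t" "t \<le> 1"
  shows "\<exists>R. valid_protocol R \<and>
    (\<forall>w. (\<forall>z. w z \<ge> 0) \<longrightarrow> payoff a b T R w = t * payoff a b T P w + (1 - t) * payoff a b T Q w)"
proof -
  obtain R where R: "valid_protocol R"
    "\<And>w. (\<forall>z. w z \<ge> 0) \<Longrightarrow> QIC_weight R w = t * QIC_weight P w + (1 - t) * QIC_weight Q w"
    "\<And>x y. error_prob T R x y = t * error_prob T P x y + (1 - t) * error_prob T Q x y"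
    using mixture_exists[OF assms, of T] by blast
  have e: "error_weight T R w = t * error_weight T P w + (1 - t) * error_weight T Q w" for w
  proof -
    have "error_weight T R w = (\<Sum>z\<in>UNIV. t * (w z * error_prob T P (fst z) (snd z)) + (1 - t)
        * (w z * error_prob T Q (fst z) (snd z)))"
      unfolding error_weight_def R(3) by (intro sum.cong refl) (simp add: algebra_simps)
    then show ?thesis by (simp only: error_weight_def sum.distrib sum_distrib_left)
  qed
  have "payoff a b T R w = t * payoff a b T P w + (1 - t) * payoff a b T Q w" if "\<forall>z. w z \<ge> 0" for w
    unfolding payoff_def e R(2)[OF that] by (simp add: algebra_simps)
  then show ?thesis using R(1) by blast
qed

text \<open>Since the payoff is monotone and homogeneous in the weights, every
  distribution is dominated up to a factor close to 1 by one from a finite grid, which replaces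
  a compactness argument and needs no continuity of the entropy.\<close>

lemma payoff_minimax:
  assumes le: "\<And>\<mu>. \<exists>P. valid_protocol P \<and> payoff a b T P (pmf \<mu>) \<le> c" and c: "0 \<le> c" "c < 1"
  shows "\<exists>P. valid_protocol P \<and> (\<forall>\<mu>. payoff a b T P (pmf \<mu>) \<le> 1)"
proof -
  \<comment> \<open>The gap between \<open>c\<close> and 1 is shared: the minimax step loses up to
    \<open>d\<close>, and the passage from the grid to all distributions loses up to 1.\<close>
  define d where "d = (1 + c) / 2"
  have d: "c < d" "0 \<le> d" "d < 1" using c by (auto simp: d_def)
  let ?N = "real CARD('x \<times> 'y)"
  \<comment> \<open>The grid has to be so fine that the domination factor, at most
    \<open>(n + N) / n\<close> for \<open>N\<close> input pairs, times \<open>d\<close> is at most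
    1.\<close>
  obtain n0 :: nat where n0: "real n0 > ?N * d / (1 - d)" using reals_Archimedean2 by blast
  define n where "n = Suc n0"
  have n: "n \<ge> 1" "real n > 0" by (auto simp: n_def)
  have nd: "(real n + ?N) * d \<le> real n"
  proof -
    have "?N * d / (1 - d) < real n" using n0 by (simp add: n_def)
    then have "?N * d < real n * (1 - d)" using d by (simp add: pos_divide_less_eq)
    then show ?thesis by (simp add: algebra_simps)
  qed
  let ?M = "UNIV \<rightarrow>\<^sub>E {1..n + 1} :: ('x \<times> 'y \<Rightarrow> nat) set"
  have finM: "finite ?M" by (rule finite_PiE) auto
  have neM: "?M \<noteq> {}" by auto
  define v where "v k z = real (k z) / (\<Sum>z\<in>UNIV. real (k z))" for k :: "'x \<times> 'y \<Rightarrow> nat" and z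
  have kpos: "(\<Sum>z\<in>UNIV. real (k z)) > 0" if "k \<in> ?M" for k
  proof -
    have "k z \<in> {1..n + 1}" for z using that by (rule PiE_mem) simp
    then have "0 < real (k z)" for z by (simp add: Suc_le_eq)
    then show ?thesis by (intro sum_pos) auto
  qed
  have v0: "v k z \<ge> 0" for k z by (auto simp: v_def intro!: divide_nonneg_nonneg sum_nonneg)
  have v1: "(\<Sum>z\<in>UNIV. v k z) = 1" if "k \<in> ?M" for k
    using kpos[OF that] by (simp add: v_def sum_divide_distrib[symmetric])
  obtain m where m: "card ?M = Suc m" using finM neM by (cases "card ?M") auto
  obtain h where h: "bij_betw h {..<Suc m} ?M"
    using ex_bij_betw_nat_finite[OF finM] m by (auto simp: lessThan_atLeast0)
  have hM: "h i \<in> ?M" if "i < Suc m" for i using h that by (auto simp: bij_betw_def)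
  have "\<exists>P\<in>{P :: ('x, 'y, 'za, 'zb) protocol. valid_protocol P}. \<forall>i<Suc m. payoff a b T P (v (h i))
      \<le> c + (d - c)"
  proof (rule minimax_finite)
    fix P Q :: "('x, 'y, 'za, 'zb) protocol" and t :: real
    assume "P \<in> {P. valid_protocol P}" "Q \<in> {P. valid_protocol P}" "0 \<le> t" "t \<le> 1"
    then obtain R where "valid_protocol R"
        "\<forall>w. (\<forall>z. w z \<ge> 0) \<longrightarrow> payoff a b T R w = t * payoff a b T P w + (1 - t) * payoff a b T Q w"
      using payoff_mixture[of P Q t] by auto
    then show "\<exists>R\<in>{P. valid_protocol P}. \<forall>i<Suc m. payoff a b T R (v (h i))
        \<le> t * payoff a b T P (v (h i)) + (1 - t) * payoff a b T Q (v (h i))"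
      using v0 by (intro bexI[of _ R]) auto
  next
    fix \<nu> :: "nat \<Rightarrow> real" assume \<nu>: "\<And>i. i < Suc m \<Longrightarrow> \<nu> i \<ge> 0" "(\<Sum>i<Suc m. \<nu> i) = 1"
    \<comment> \<open>An average of grid distributions is again a distribution, so the assumption
      supplies a protocol for it; concavity bounds the averaged payoff.\<close>
    have "\<exists>\<mu>. pmf \<mu> = (\<lambda>z. \<Sum>i<Suc m. \<nu> i * v (h i) z)"
    proof (rule pmf_of_weights)
      show "(\<Sum>i<Suc m. \<nu> i * v (h i) z) \<ge> 0" for z using \<nu>(1) v0 by (intro sum_nonneg) auto
      have "(\<Sum>z\<in>UNIV. \<Sum>i<Suc m. \<nu> i * v (h i) z) = (\<Sum>i<Suc m. \<nu> i * (\<Sum>z\<in>UNIV. v (h i) z))"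
        unfolding sum_distrib_left by (rule sum.swap)
      also have "\<dots> = (\<Sum>i<Suc m. \<nu> i)" using v1[OF hM] by (intro sum.cong refl) auto
      finally show "(\<Sum>z\<in>UNIV. \<Sum>i<Suc m. \<nu> i * v (h i) z) = 1" using \<nu>(2) by simp
    qed
    then obtain \<mu> where \<mu>: "pmf \<mu> = (\<lambda>z. \<Sum>i<Suc m. \<nu> i * v (h i) z)" by blast
    obtain P where P: "valid_protocol P" "payoff a b T P (pmf \<mu>) \<le> c" using le by blast
    have "(\<Sum>i<Suc m. \<nu> i * payoff a b T P (v (h i))) \<le> payoff a b T P (pmf \<mu>)"
      unfolding \<mu> using \<nu>(1) v0 by (intro payoff_sum) auto
    then show "\<exists>P\<in>{P. valid_protocol P}. (\<Sum>i<Suc m. \<nu> i * payoff a b T P (v (h i))) \<le> c"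
      using P by (intro bexI[of _ P]) (auto simp del: sum.lessThan_Suc)
  qed (use d in simp)
  then obtain P :: "('x, 'y, 'za, 'zb) protocol"
      where P: "valid_protocol P" "\<And>i. i < Suc m \<Longrightarrow> payoff a b T P (v (h i)) \<le> d"
    by auto
  have Pk: "payoff a b T P (v k) \<le> d" if "k \<in> ?M" for k
  proof -
    have "k \<in> h ` {..<Suc m}" unfolding bij_betw_imp_surj_on[OF h] by (rule that)
    then show ?thesis using P(2) by auto
  qed
  have "payoff a b T P (pmf \<mu>) \<le> 1" for \<mu>
  proof -
    define k where "k = (\<lambda>z. nat \<lfloor>real n * pmf \<mu> z\<rfloor> + 1)"
    define S where "S = (\<Sum>z\<in>UNIV. real (k z))"
    note g = grid_domination[OF n(1) k_def]
    have S: "S > 0" using kpos[OF g(1)] by (simp add: S_def)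
    have "real n * payoff a b T P (pmf \<mu>) = payoff a b T P (\<lambda>z. real n * pmf \<mu> z)"
      by (rule payoff_scale[symmetric]) auto
    also have "\<dots> \<le> payoff a b T P (\<lambda>z. real (k z))"
    proof (rule payoff_mono)
      show "0 \<le> real n * pmf \<mu> z" "real n * pmf \<mu> z \<le> real (k z)" for z using g(2)[of z] by simp_all
    qed
    also have "(\<lambda>z. real (k z)) = (\<lambda>z. S * v k z)"
      unfolding v_def S_def[symmetric] using S by simp
    also have "payoff a b T P (\<lambda>z. S * v k z) = S * payoff a b T P (v k)"
      by (rule payoff_scale) (use v0 S in auto)
    also have "\<dots> \<le> S * d" using Pk[OF g(1)] S by (intro mult_left_mono) auto
    also have "\<dots> \<le> (real n + ?N) * d"
      using g(3) d(2) unfolding S_def by (intro mult_right_mono) auto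
    also have "\<dots> \<le> real n * 1" using nd by simp
    finally show ?thesis using n(2) by (simp only: mult_le_cancel_left_pos)
  qed
  then show ?thesis using P(1) by blast
qed

end

text \<open>The error probability on a single input is read off at a point mass, where the information
  cost vanishes; the slack \<open>\<delta>\<close> affects the information cost only.\<close>

lemma QIC_le_of_QIC_D:
  fixes T :: "('x::finite \<times> 'y::finite \<times> 'za::finite \<times> 'zb::finite) set"
  assumes eps: "0 < \<epsilon>" and alpha: "0 < \<alpha>" "\<alpha> < 1" and I: "QIC_D T \<epsilon> = ereal I" "I \<ge> 0"
      and \<delta>: "\<delta> > 0"
  shows "QIC T (\<epsilon> / \<alpha>) \<le> ereal ((I + \<delta>) / (1 - \<alpha>))"
proof -
  \<comment> \<open>Dividing by \<open>I + \<delta>\<close> rather than \<open>I\<close> covers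
    \<open>I = 0\<close> and leaves room below 1 for the value \<open>c\<close> of the game.\<close>
  define a where "a = (1 - \<alpha>) / (I + \<delta>)"
  define b where "b = \<alpha> / \<epsilon>"
  have a: "a > 0" using alpha I \<delta> by (simp add: a_def)
  have b: "b > 0" using alpha eps by (simp add: b_def)
  define c where "c = a * (I + \<delta> / 2) + \<alpha>"
  have c: "0 \<le> c" "c < 1"
  proof -
    show "0 \<le> c" using a I \<delta> alpha by (simp add: c_def)
    have "a * (I + \<delta> / 2) < a * (I + \<delta>)" using a \<delta> by (intro mult_strict_left_mono) auto
    also have "\<dots> = 1 - \<alpha>" using I \<delta> by (simp add: a_def)
    finally show "c < 1" by (simp add: c_def)
  qed
  have "\<exists>P :: ('x, 'y, 'za, 'zb) protocol. valid_protocol P \<and> payoff a b T P (pmf \<mu>) \<le> c" for \<mu>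
  proof -
    have "QIC_dist T \<mu> \<epsilon> \<le> ereal I" unfolding I(1)[symmetric] QIC_D_def by (rule SUP_upper) simp
    \<comment> \<open>The infimum need not be attained; half of the slack provides an actual
      protocol.\<close>
    also have "\<dots> < ereal (I + \<delta> / 2)" using \<delta> by simp
    finally obtain P :: "('x, 'y, 'za, 'zb) protocol" where P: "valid_protocol P"
      "measure_pmf.expectation \<mu> (\<lambda>(x, y). error_prob T P x y) \<le> \<epsilon>" "QIC_protocol P \<mu> < I + \<delta> / 2"
      unfolding QIC_dist_def INF_less_iff by auto
    have "a * QIC_weight P (pmf \<mu>) \<le> a * (I + \<delta> / 2)"
      using P a by (intro mult_left_mono) (auto simp: QIC_protocol_eq_weight)
    moreover have "b * error_weight T P (pmf \<mu>) \<le> b * \<epsilon>"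
      using P b by (intro mult_left_mono) (auto simp: expectation_error_prob)
    moreover have "b * \<epsilon> = \<alpha>" using eps by (simp add: b_def)
    ultimately show ?thesis using P(1) by (intro exI[of _ P]) (simp add: payoff_def c_def)
  qed
  from payoff_minimax[OF less_imp_le[OF a] less_imp_le[OF b] this c]
  obtain P :: "('x, 'y, 'za, 'zb) protocol"
      where P: "valid_protocol P" "\<And>\<mu>. payoff a b T P (pmf \<mu>) \<le> 1" by blast
  have "error_prob T P x y \<le> \<epsilon> / \<alpha>" for x y
  proof -
    have pm: "pmf (return_pmf (x, y)) = (\<lambda>z. if z = (x, y) then 1 else 0)"
      by (auto simp: fun_eq_iff pmf_return indicator_def)
    have "error_weight T P (pmf (return_pmf (x, y))) = (\<Sum>z\<in>UNIV. if z = (x, y)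
        then error_prob T P x y else 0)"
      unfolding error_weight_def pm by (intro sum.cong refl) auto
    then have "error_weight T P (pmf (return_pmf (x, y))) = error_prob T P x y" by simp
    moreover have "QIC_weight P (pmf (return_pmf (x, y))) = 0" unfolding pm
        by (rule QIC_weight_point)
    ultimately have "b * error_prob T P x y \<le> 1" using P(2)[of "return_pmf (x, y)"]
        by (simp add: payoff_def)
    then show ?thesis using eps alpha by (simp add: b_def field_simps)
  qed
  moreover have "QIC_protocol P \<mu> \<le> (I + \<delta>) / (1 - \<alpha>)" for \<mu>
  proof -
    have "b * error_weight T P (pmf \<mu>) \<ge> 0"
      using b by (auto simp: error_weight_def error_prob_nonneg
          intro!: mult_nonneg_nonneg sum_nonneg)
    then have "a * QIC_weight P (pmf \<mu>) \<le> 1" using P(2)[of \<mu>] by (simp add: payoff_def)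
    then show ?thesis using alpha I \<delta> P(1) by (simp add: a_def QIC_protocol_eq_weight field_simps)
  qed
  ultimately show ?thesis
    unfolding QIC_def using P(1) by (intro INF_lower2[of P] SUP_least) auto
qed

lemma QIC_dist_nonneg: "0 \<le> QIC_dist T \<mu> \<epsilon>"
  unfolding QIC_dist_def
      by (intro INF_greatest) (auto simp: QIC_protocol_eq_weight QIC_weight_nonneg)

theorem theorem4p11:
  fixes T :: "('x::finite \<times> 'y::finite \<times> 'za::finite \<times> 'zb::finite) set"
    and \<epsilon> \<alpha> :: real
  assumes "0 < \<epsilon>" "\<epsilon> < 1" and "0 < \<alpha>" "\<alpha> < 1"
  shows "QIC T (\<epsilon> / \<alpha>) \<le> QIC_D T \<epsilon> / ereal (1 - \<alpha>)"
proof (cases "QIC_D T \<epsilon> = \<infinity>")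
  case True
  then show ?thesis using assms by simp
next
  case False
  \<comment> \<open>Nonnegativity excludes the value minus infinity, so that a real \<open>I\<close>
    can be extracted.\<close>
  have "0 \<le> QIC_D T \<epsilon>"
    unfolding QIC_D_def by (rule SUP_upper2) (rule UNIV_I, rule QIC_dist_nonneg)
  then obtain I where I: "QIC_D T \<epsilon> = ereal I" "I \<ge> 0"
    using False by (cases "QIC_D T \<epsilon>") auto
  have "QIC T (\<epsilon> / \<alpha>) \<le> ereal (I / (1 - \<alpha>)) + ereal e" if e: "e > 0" for e
  proof -
    \<comment> \<open>The slack \<open>e * (1 - \<alpha>)\<close> is chosen so that it becomes
      \<open>e\<close> after the division.\<close>
    have "QIC T (\<epsilon> / \<alpha>) \<le> ereal ((I + e * (1 - \<alpha>)) / (1 - \<alpha>))"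
      by (rule QIC_le_of_QIC_D[OF assms(1,3,4) I]) (use e assms in simp)
    also have "(I + e * (1 - \<alpha>)) / (1 - \<alpha>) = I / (1 - \<alpha>) + e"
      using assms by (simp add: field_simps)
    finally show ?thesis by simp
  qed
  then have "QIC T (\<epsilon> / \<alpha>) \<le> ereal (I / (1 - \<alpha>))" by (rule ereal_le_epsilon2)
  then show ?thesis using assms by (simp add: I)
qed

end
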